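(* In the operator setting, let $\alpha\in\mathbb{R}^d$ have all coordinates positive and let $A\in L(\mathcal{X},\mathcal{Y})$ be $\mathcal{T}_{\mathcal{X}\mathcal{Y}}$-continuous with $A\in D(\mathbf{h}_\alpha)$. If $A$ is invertible with $B=A^{-1}\in L(\mathcal{Y},\mathcal{X})$, then there is $\beta\in\mathbb{R}^d$ with all coordinates positive such that $B$ is $\mathcal{T}_{\mathcal{Y}\mathcal{X}}$-continuous and $B\in D(\mathbf{h}_\beta)$.
   Context: Fourier transform $\hat f(\lambda)=\int f(t)e^{-it\cdot\lambda}dt$. A Banach $L^1(\mathbb{R}^d)$-module structure on a Banach space $\mathcal{M}$ associated with a representation $\mathcal{T}:\mathbb{R}^d\to B(\mathcal{M})$ by invertible isometries is a bilinear map $(f,x)\mapsto fx$ with $(f*g)x=f(gx)$, $\|fx\|\le\|f\|_1\|x\|$, $\mathcal{T}(t)(fx)=(f(\cdot+t))x=f(\mathcal{T}(t)x)$, non-degenerate; $x$ is $\mathcal{T}$-continuous if $t\mapsto\mathcal{T}(t)x$ is norm continuous, and then $fx=\int f(t)\mathcal{T}(-t)x\,dt$. Beurling spectrum $\Lambda(x,\mathcal{T})$: set of $\gamma$ with $\hat f(\gamma)=0$ for all $f$ with $fx=0$. Operator setting: $\mathcal{X},\mathcal{Y}$ complex Banach spaces; each of $L(\mathcal{X},\mathcal{Y}),L(\mathcal{Y},\mathcal{X}),B(\mathcal{X}),B(\mathcal{Y})$ carries such a module structure with representations $\mathcal{T}_{\mathcal{U}\mathcal{V}}$ satisfying $\mathcal{T}_{\mathcal{U}\mathcal{W}}(t)(BA)=(\mathcal{T}_{\mathcal{V}\mathcal{W}}(t)B)(\mathcal{T}_{\mathcal{U}\mathcal{V}}(t)A)$,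 and coupled: $A,B$ mutually inverse iff $\mathcal{T}_{\mathcal{X}\mathcal{Y}}(t)A$, $\mathcal{T}_{\mathcal{Y}\mathcal{X}}(t)B$ are, for all $t$. Functional calculus: for $h$ such that $h\hat\varphi$ is an $L^1$-Fourier transform whenever $\hat\varphi$ is compactly supported, set $h\diamond x=(h\hat\varphi)^\vee x$ for $x$ of compact spectrum ($\hat\varphi$ compactly supported, $\equiv1$ near $\Lambda(x)$); $D(h)$ is the domain of the closure. $\mathbf{h}_\alpha(\lambda)=\exp(\sum_k\alpha_k|\lambda_k|)$. *)

theory Defs
  imports "HOL-Analysis.Analysis"
begin

class complex_vector = real_vector +
  fixes scaleC :: "complex \<Rightarrow> 'a \<Rightarrow> 'a"  (infixr \<open>*\<^sub>C\<close> 75)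
  assumes scaleC_add_right: "a *\<^sub>C (x + y) = a *\<^sub>C x + a *\<^sub>C y"
    and scaleC_add_left: "(a + b) *\<^sub>C x = a *\<^sub>C x + b *\<^sub>C x"
    and scaleC_scaleC: "a *\<^sub>C (b *\<^sub>C x) = (a * b) *\<^sub>C x"
    and scaleC_one: "1 *\<^sub>C x = x"
    and scaleC_of_real: "(complex_of_real r) *\<^sub>C x = r *\<^sub>R x"

class complex_normed_vector = complex_vector + real_normed_vector +
  assumes norm_scaleC: "norm (a *\<^sub>C x) = cmod a * norm x"

lemma bounded_linear_scaleC_right:
  "bounded_linear (\<lambda>x::'a::complex_normed_vector. c *\<^sub>C x)"
proof (rule bounded_linear_intro[where K = "cmod c"])
  fix x y :: 'a
  show "c *\<^sub>C (x + y) = c *\<^sub>C x + c *\<^sub>C y" by (rule scaleC_add_right)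
next
  fix r :: real and x :: 'a
  have "c *\<^sub>C (r *\<^sub>R x) = c *\<^sub>C (complex_of_real r *\<^sub>C x)" by (simp add: scaleC_of_real)
  also have "\<dots> = (complex_of_real r * c) *\<^sub>C x" by (simp add: scaleC_scaleC mult.commute)
  also have "\<dots> = r *\<^sub>R (c *\<^sub>C x)" by (simp add: scaleC_scaleC[symmetric] scaleC_of_real)
  finally show "c *\<^sub>C (r *\<^sub>R x) = r *\<^sub>R (c *\<^sub>C x)" .
next
  fix x :: 'a show "norm (c *\<^sub>C x) \<le> norm x * cmod c" by (simp add: norm_scaleC mult.commute)
qed

instantiation blinfun :: (real_normed_vector, complex_normed_vector) complex_normed_vector
begin

lift_definition scaleC_blinfun :: "complex \<Rightarrow> 'a \<Rightarrow>\<^sub>L 'b \<Rightarrow> 'a \<Rightarrow>\<^sub>L 'b"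
  is "\<lambda>c f x. c *\<^sub>C f x"
  by (rule bounded_linear_compose[OF bounded_linear_scaleC_right])

instance
proof
  fix a b :: complex and x y :: "'a \<Rightarrow>\<^sub>L 'b" and r :: real
  show "a *\<^sub>C (x + y) = a *\<^sub>C x + a *\<^sub>C y"
    by (rule blinfun_eqI) (simp add: scaleC_blinfun.rep_eq blinfun.add_left scaleC_add_right)
  show "(a + b) *\<^sub>C x = a *\<^sub>C x + b *\<^sub>C x"
    by (rule blinfun_eqI) (simp add: scaleC_blinfun.rep_eq blinfun.add_left scaleC_add_left)
  show "a *\<^sub>C b *\<^sub>C x = (a * b) *\<^sub>C x"
    by (rule blinfun_eqI) (simp add: scaleC_blinfun.rep_eq scaleC_scaleC)
  show "1 *\<^sub>C x = x"
    by (rule blinfun_eqI) (simp add: scaleC_blinfun.rep_eq scaleC_one)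
  show "complex_of_real r *\<^sub>C x = r *\<^sub>R x"
    by (rule blinfun_eqI) (simp add: scaleC_blinfun.rep_eq scaleC_of_real blinfun.scaleR_left)
  have "onorm (\<lambda>v. a *\<^sub>C blinfun_apply x v) = onorm (\<lambda>v. cmod a *\<^sub>R blinfun_apply x v)"
    unfolding onorm_def by (simp add: norm_scaleC)
  also have "\<dots> = cmod a * onorm (blinfun_apply x)"
    using onorm_scaleR[OF blinfun.bounded_linear_right, of "cmod a" x] by simp
  finally show "norm (a *\<^sub>C x) = cmod a * norm x"
    by (simp add: norm_blinfun.rep_eq scaleC_blinfun.rep_eq)
qed

end

definition L1fun :: "(real^'n \<Rightarrow> complex) \<Rightarrow> bool" where
  "L1fun f \<longleftrightarrow> integrable lborel f"

definition L1norm :: "(real^'n \<Rightarrow> complex) \<Rightarrow> real" where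
  "L1norm f = (\<integral>t. cmod (f t) \<partial>lborel)"

definition conv :: "(real^'n \<Rightarrow> complex) \<Rightarrow> (real^'n \<Rightarrow> complex) \<Rightarrow> real^'n \<Rightarrow> complex" where
  "conv f g = (\<lambda>t. \<integral>s. f s * g (t - s) \<partial>lborel)"

definition fourier :: "(real^'n \<Rightarrow> complex) \<Rightarrow> real^'n \<Rightarrow> complex" where
  "fourier f = (\<lambda>\<gamma>. \<integral>t. f t * exp (- \<i> * complex_of_real (t \<bullet> \<gamma>)) \<partial>lborel)"

text \<open>The Banach space is a closed complex subspace M of a complex Banach type 'm.
  T is a representation of R^d by invertible (complex-linear) isometries of M;
  act is the module multiplication (f, x) \<mapsto> f x.\<close>

definition L1_module ::
  "'m::{complex_normed_vector,banach} set \<Rightarrow> (real^'n \<Rightarrow> 'm \<Rightarrow> 'm)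
     \<Rightarrow> ((real^'n \<Rightarrow> complex) \<Rightarrow> 'm \<Rightarrow> 'm) \<Rightarrow> bool" where
  "L1_module M T act \<longleftrightarrow>
     \<comment> \<open>M is a (complex) Banach space\<close>
     closed M \<and> 0 \<in> M \<and> (\<forall>x\<in>M. \<forall>y\<in>M. x + y \<in> M) \<and> (\<forall>c. \<forall>x\<in>M. c *\<^sub>C x \<in> M) \<and>
     \<comment> \<open>T is a representation by invertible linear isometries\<close>
     (\<forall>t. \<forall>x\<in>M. T t x \<in> M) \<and>
     (\<forall>x\<in>M. T 0 x = x) \<and>
     (\<forall>s t. \<forall>x\<in>M. T (s + t) x = T s (T t x)) \<and>
     (\<forall>t. \<forall>x\<in>M. \<forall>y\<in>M. T t (x + y) = T t x + T t y) \<and>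
     (\<forall>t c. \<forall>x\<in>M. T t (c *\<^sub>C x) = c *\<^sub>C T t x) \<and>
     (\<forall>t. \<forall>x\<in>M. norm (T t x) = norm x) \<and>
     \<comment> \<open>module axioms\<close>
     (\<forall>f g. L1fun f \<longrightarrow> L1fun g \<longrightarrow> (\<forall>x\<in>M. \<forall>y\<in>M. \<forall>c.
        act f x \<in> M \<and>
        act (\<lambda>s. f s + g s) x = act f x + act g x \<and>
        act (\<lambda>s. c * f s) x = c *\<^sub>C act f x \<and>
        act f (x + y) = act f x + act f y \<and>
        act f (c *\<^sub>C x) = c *\<^sub>C act f x \<and>
        act (conv f g) x = act f (act g x) \<and>
        norm (act f x) \<le> L1norm f * norm x \<and>
        (\<forall>t. T t (act f x) = act (\<lambda>s. f (s + t)) x \<and> T t (act f x) = act f (T t x)))) \<and>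
     \<comment> \<open>non-degeneracy\<close>
     (\<forall>x\<in>M. (\<forall>f. L1fun f \<longrightarrow> act f x = 0) \<longrightarrow> x = 0)"

definition T_continuous :: "(real^'n \<Rightarrow> 'm::real_normed_vector \<Rightarrow> 'm) \<Rightarrow> 'm \<Rightarrow> bool" where
  "T_continuous T x \<longleftrightarrow> continuous_on UNIV (\<lambda>t. T t x)"

definition beurling_spectrum ::
  "((real^'n \<Rightarrow> complex) \<Rightarrow> 'm::zero \<Rightarrow> 'm) \<Rightarrow> 'm \<Rightarrow> (real^'n) set" where
  "beurling_spectrum act x = {\<gamma>. \<forall>f. L1fun f \<and> act f x = 0 \<longrightarrow> fourier f \<gamma> = 0}"

definition compact_fourier_support :: "(real^'n \<Rightarrow> complex) \<Rightarrow> bool" where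
  "compact_fourier_support \<phi> \<longleftrightarrow> compact (closure {\<gamma>. fourier \<phi> \<gamma> \<noteq> 0})"

definition fc_admissible :: "(real^'n \<Rightarrow> complex) \<Rightarrow> bool" where
  "fc_admissible h \<longleftrightarrow> (\<forall>\<phi>. L1fun \<phi> \<and> compact_fourier_support \<phi> \<longrightarrow>
      (\<exists>\<psi>. L1fun \<psi> \<and> fourier \<psi> = (\<lambda>\<gamma>. h \<gamma> * fourier \<phi> \<gamma>)))"

text \<open>Graph of x \<mapsto> h \<diamond> x on the elements of compact spectrum:
  h \<diamond> x = (h \<phi>^)\<or> x with \<phi>^ compactly supported and \<phi>^ = 1 near the spectrum of x.\<close>
definition fc_graph ::
  "'m::{complex_normed_vector,banach} set \<Rightarrow> ((real^'n \<Rightarrow> complex) \<Rightarrow> 'm \<Rightarrow> 'm)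
     \<Rightarrow> (real^'n \<Rightarrow> complex) \<Rightarrow> ('m \<times> 'm) set" where
  "fc_graph M act h = {(x, act \<psi> x) | x \<phi> \<psi>.
      x \<in> M \<and> compact (beurling_spectrum act x) \<and>
      L1fun \<phi> \<and> compact_fourier_support \<phi> \<and>
      (\<exists>U. open U \<and> beurling_spectrum act x \<subseteq> U \<and> (\<forall>\<gamma>\<in>U. fourier \<phi> \<gamma> = 1)) \<and>
      L1fun \<psi> \<and> fourier \<psi> = (\<lambda>\<gamma>. h \<gamma> * fourier \<phi> \<gamma>)}"

definition fc_domain ::
  "'m::{complex_normed_vector,banach} set \<Rightarrow> ((real^'n \<Rightarrow> complex) \<Rightarrow> 'm \<Rightarrow> 'm)
     \<Rightarrow> (real^'n \<Rightarrow> complex) \<Rightarrow> 'm set" where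
  "fc_domain M act h =
     (if fc_admissible h then {x. \<exists>y. (x, y) \<in> closure (fc_graph M act h)} else {})"

definition h_alpha :: "real^'n \<Rightarrow> real^'n \<Rightarrow> complex" where
  "h_alpha \<alpha> = (\<lambda>\<gamma>. complex_of_real (exp (\<Sum>k\<in>UNIV. \<alpha> $ k * \<bar>\<gamma> $ k\<bar>)))"

definition clin_ops :: "('x::complex_normed_vector \<Rightarrow>\<^sub>L 'y::complex_normed_vector) set" where
  "clin_ops = {A. \<forall>c v. blinfun_apply A (c *\<^sub>C v) = c *\<^sub>C blinfun_apply A v}"

definition mutually_inverse ::
  "('x::real_normed_vector \<Rightarrow>\<^sub>L 'y::real_normed_vector) \<Rightarrow> ('y \<Rightarrow>\<^sub>L 'x) \<Rightarrow> bool" where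
  "mutually_inverse A B \<longleftrightarrow> B o\<^sub>L A = id_blinfun \<and> A o\<^sub>L B = id_blinfun"

definition operator_setting ::
  "(real^'n \<Rightarrow> ('x::{complex_normed_vector,banach} \<Rightarrow>\<^sub>L 'y::{complex_normed_vector,banach})
      \<Rightarrow> ('x \<Rightarrow>\<^sub>L 'y))
   \<Rightarrow> ((real^'n \<Rightarrow> complex) \<Rightarrow> ('x \<Rightarrow>\<^sub>L 'y) \<Rightarrow> ('x \<Rightarrow>\<^sub>L 'y))
   \<Rightarrow> (real^'n \<Rightarrow> ('y \<Rightarrow>\<^sub>L 'x) \<Rightarrow> ('y \<Rightarrow>\<^sub>L 'x))
   \<Rightarrow> ((real^'n \<Rightarrow> complex) \<Rightarrow> ('y \<Rightarrow>\<^sub>L 'x) \<Rightarrow> ('y \<Rightarrow>\<^sub>L 'x))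
   \<Rightarrow> (real^'n \<Rightarrow> ('x \<Rightarrow>\<^sub>L 'x) \<Rightarrow> ('x \<Rightarrow>\<^sub>L 'x))
   \<Rightarrow> ((real^'n \<Rightarrow> complex) \<Rightarrow> ('x \<Rightarrow>\<^sub>L 'x) \<Rightarrow> ('x \<Rightarrow>\<^sub>L 'x))
   \<Rightarrow> (real^'n \<Rightarrow> ('y \<Rightarrow>\<^sub>L 'y) \<Rightarrow> ('y \<Rightarrow>\<^sub>L 'y))
   \<Rightarrow> ((real^'n \<Rightarrow> complex) \<Rightarrow> ('y \<Rightarrow>\<^sub>L 'y) \<Rightarrow> ('y \<Rightarrow>\<^sub>L 'y)) \<Rightarrow> bool" where
  "operator_setting Txy axy Tyx ayx Txx axx Tyy ayy \<longleftrightarrow>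
     L1_module clin_ops Txy axy \<and> L1_module clin_ops Tyx ayx \<and>
     L1_module clin_ops Txx axx \<and> L1_module clin_ops Tyy ayy \<and>
     \<comment> \<open>T_UW(t)(BA) = (T_VW(t) B)(T_UV(t) A), for U,V,W \<in> {X,Y}\<close>
     (\<forall>t. \<forall>A\<in>clin_ops. \<forall>B\<in>clin_ops. Txx t (B o\<^sub>L A) = Txx t B o\<^sub>L Txx t A) \<and>
     (\<forall>t. \<forall>A\<in>clin_ops. \<forall>B\<in>clin_ops. Txy t (B o\<^sub>L A) = Txy t B o\<^sub>L Txx t A) \<and>
     (\<forall>t. \<forall>A\<in>clin_ops. \<forall>B\<in>clin_ops. Txx t (B o\<^sub>L A) = Tyx t B o\<^sub>L Txy t A) \<and>
     (\<forall>t. \<forall>A\<in>clin_ops. \<forall>B\<in>clin_ops. Txy t (B o\<^sub>L A) = Tyy t B o\<^sub>L Txy t A) \<and>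
     (\<forall>t. \<forall>A\<in>clin_ops. \<forall>B\<in>clin_ops. Tyx t (B o\<^sub>L A) = Txx t B o\<^sub>L Tyx t A) \<and>
     (\<forall>t. \<forall>A\<in>clin_ops. \<forall>B\<in>clin_ops. Tyy t (B o\<^sub>L A) = Txy t B o\<^sub>L Tyx t A) \<and>
     (\<forall>t. \<forall>A\<in>clin_ops. \<forall>B\<in>clin_ops. Tyx t (B o\<^sub>L A) = Tyx t B o\<^sub>L Tyy t A) \<and>
     (\<forall>t. \<forall>A\<in>clin_ops. \<forall>B\<in>clin_ops. Tyy t (B o\<^sub>L A) = Tyy t B o\<^sub>L Tyy t A) \<and>
     \<comment> \<open>coupling\<close>
     (\<forall>A\<in>clin_ops. \<forall>B\<in>clin_ops.
        mutually_inverse A B \<longleftrightarrow> (\<forall>t. mutually_inverse (Txy t A) (Tyx t B)))"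

end

theory Submission
  imports Defs "HOL-Probability.Sinc_Integral"
begin

text \<open>Idea. The reciprocal of the weight with parameter \<open>\<alpha>\<close> is the Fourier transform of a product \<open>P\<close> of
  Poisson kernels, so membership of \<open>A\<close> in the domain means that \<open>A = P y\<close> for some \<open>y\<close>; this uses that a
  function whose transform is 1 near the Beurling spectrum of \<open>x\<close> fixes \<open>x\<close> (a local Wiener argument).
  The iterated differences of \<open>P\<close> with step \<open>h\<close> in direction \<open>k\<close> have norm at most
  \<open>n! (|h| / \<alpha>\<^sub>k)^n\<close>, hence so do, up to a constant, those of the orbit of \<open>A\<close>, and the Leibniz rule
  applied to \<open>T(t)A T(t)B = 1\<close> transfers such factorial bounds to the orbit of \<open>B\<close>. On the spectral unit cube
  around the lattice point \<open>m\<close>, translation by \<open>\<pi> / m\<^sub>k\<close> is nearly \<open>-1\<close>, so differences with this step do not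
  decrease norms there; optimising over \<open>n\<close>, the component of \<open>B\<close> in that cube decays exponentially in \<open>m\<close>.
  On the cube, the weight with parameter \<open>\<beta> = \<alpha> / q\<close> grows exponentially at a rate that tends to 0 as \<open>q\<close>
  grows, so for large \<open>q\<close> the weighted components of \<open>B\<close> are still summable. No holomorphic extension
  of the orbits is needed.\<close>

section \<open>Fejer and Poisson kernels on the real line\<close>

text \<open>The weight is unbounded, hence not the transform of an integrable function, so the
  components of B have to be weighted cube by cube in frequency. The step of the differences must
  depend on the cube: a fixed step would give no gain in m, while step pi / m_k turns the factorial
  bound into n! (const / |m_k|)^n. The weight of \<alpha> is admissible because A lies in its
  domain; the weight of \<alpha> / q inherits this as a dilate. On a cube at distance about p q from
  the origin it is the p-th power of a dilate of one fixed transform, equal to the weight of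
  \<alpha> on the unit box. Dilation preserves the L1 norm, so the p-th power costs only a constant
  to the power |m| / q, and q is chosen against the decay rate of B. Fejer kernels supply the
  frequency cutoffs: their transforms are compactly supported tents which add up to 1 over the
  lattice, and each has norm 1 wherever it is centred. They also generate the Poisson kernel, whose
  transform is the reciprocal weight.\<close>

lemma integral_one_minus_cos_half_line:
  shows "set_integrable lborel {0<..} (\<lambda>t::real. (1 - cos t) / t\<^sup>2)"
    and "(LBINT t:{0<..}. (1 - cos t) / t\<^sup>2) = pi / 2"
proof -
  \<comment> \<open>Integration by parts: the boundary term \<open>(1 - cos t) / t\<close> leaves
    \<open>sin t / t\<close>, whose primitive is \<open>Si\<close>.\<close>
  let ?F = "\<lambda>t::real. Si t - (1 - cos t) / t"
  have D: "DERIV ?F x :> (1 - cos x) / x\<^sup>2" if "0 < ereal x" for x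
  proof -
    have "x > 0" using that by simp
    then show ?thesis
      by (auto intro!: derivative_eq_intros DERIV_Si simp: power2_eq_square field_simps)
  qed
  have cont: "isCont (\<lambda>t::real. (1 - cos t) / t\<^sup>2) x" if "0 < ereal x" for x
    using that by (auto intro!: continuous_intros)
  have nonneg: "AE x in lborel. 0 < ereal x \<longrightarrow> ereal x < \<infinity> \<longrightarrow> 0 \<le> (1 - cos x) / x\<^sup>2"
    by (auto intro!: AE_I2 divide_nonneg_nonneg)
  have lim0': "((\<lambda>t::real. (1 - cos t) / t) \<longlongrightarrow> 0) (at 0)"
  proof -
    have "((\<lambda>t. - ((cos (0 + t) - cos 0) / t)) \<longlongrightarrow> - (- sin (0::real))) (at 0)"
      using DERIV_cos[of "0::real"] unfolding DERIV_def by (intro tendsto_minus)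
    moreover have "(\<lambda>t. - ((cos (0 + t) - cos 0) / t)) = (\<lambda>t::real. (1 - cos t) / t)"
      by (auto simp: fun_eq_iff divide_simps)
    ultimately show ?thesis by simp
  qed
  have "(?F \<longlongrightarrow> Si 0 - 0) (at 0)"
    using isCont_Si[of 0] lim0' by (intro tendsto_diff) (auto simp: isCont_def)
  then have "(?F \<longlongrightarrow> 0) (at_right 0)"
    using Si_neg[of 0] by (auto intro: tendsto_mono[OF at_le])
  then have lim0: "((?F \<circ> real_of_ereal) \<longlongrightarrow> 0) (at_right 0)"
    by (simp add: zero_ereal_def ereal_tendsto_simps)
  have "((\<lambda>t::real. (1 - cos t) / t) \<longlongrightarrow> 0) at_top"
  proof (rule tendsto_sandwich[where f = "\<lambda>_. 0" and h = "\<lambda>t. 2 / t"])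
    show "\<forall>\<^sub>F t in at_top. (0::real) \<le> (1 - cos t) / t"
      using eventually_gt_at_top[of 0] by eventually_elim (auto intro!: divide_nonneg_pos)
    show "\<forall>\<^sub>F t::real in at_top. (1 - cos t) / t \<le> 2 / t"
      using eventually_gt_at_top[of 0]
    proof eventually_elim
      fix t :: real assume "0 < t"
      then show "(1 - cos t) / t \<le> 2 / t"
        using cos_ge_minus_one[of t] by (intro divide_right_mono) linarith+
    qed
    show "((\<lambda>t::real. 2 / t) \<longlongrightarrow> 0) at_top"
      by (intro tendsto_divide_0[OF tendsto_const] filterlim_at_top_imp_at_infinity filterlim_ident)
  qed auto
  then have "(?F \<longlongrightarrow> pi / 2 - 0) at_top"
    by (intro tendsto_diff Si_at_top)
  then have limoo: "((?F \<circ> real_of_ereal) \<longlongrightarrow> pi / 2) (at_left \<infinity>)"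
    by (simp add: ereal_tendsto_simps)
  note ftc = interval_integral_FTC_nonneg[of 0 \<infinity> ?F, OF _ D cont nonneg lim0 limoo]
  have "einterval 0 \<infinity> = {0<..}"
    by (auto simp: einterval_def)
  then show "set_integrable lborel {0<..} (\<lambda>t::real. (1 - cos t) / t\<^sup>2)"
    and "(LBINT t:{0<..}. (1 - cos t) / t\<^sup>2) = pi / 2"
    using ftc by (auto simp: interval_lebesgue_integral_def)
qed

text \<open>The factor |a| is what matters later: second differences of |a| are tents.\<close>

lemma has_integral_one_minus_cos:
  "has_bochner_integral lborel (\<lambda>t::real. (1 - cos (a * t)) / t\<^sup>2) (pi * \<bar>a\<bar>)"
proof -
  define g where "g = (\<lambda>t::real. indicator {0<..} t * ((1 - cos t) / t\<^sup>2))"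
  have g: "has_bochner_integral lborel g (pi / 2)"
    using integral_one_minus_cos_half_line
    by (simp add: g_def has_bochner_integral_iff set_integrable_def set_lebesgue_integral_def)
  then have "has_bochner_integral lborel (\<lambda>t. g (-t)) (pi / 2)"
    using lborel_has_bochner_integral_real_affine_iff[of "-1" g "pi/2" 0] by simp
  from has_bochner_integral_add[OF g this]
  have 1: "has_bochner_integral lborel (\<lambda>t. g t + g (-t)) pi" by simp
  \<comment> \<open>At t = 0 both sides vanish, because division by zero yields 0.\<close>
  have "(\<lambda>t. g t + g (-t)) = (\<lambda>t. (1 - cos t) / t\<^sup>2)"
    by (auto simp: g_def fun_eq_iff split: split_indicator)
  with 1 have 2: "has_bochner_integral lborel (\<lambda>t::real. (1 - cos t) / t\<^sup>2) pi" by simp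
  show ?thesis
  proof (cases "a = 0")
    case False
    have "has_bochner_integral lborel (\<lambda>t::real. (1 - cos (a * t)) / (a * t)\<^sup>2) (pi / \<bar>a\<bar>)"
      using lborel_has_bochner_integral_real_affine_iff[of a "\<lambda>t::real. (1 - cos t) / t\<^sup>2" pi 0] 2 False
      by (simp add: divide_inverse mult.commute)
    from has_bochner_integral_mult_right[OF this, of "a\<^sup>2"]
    have "has_bochner_integral lborel (\<lambda>t::real. (1 - cos (a * t)) / t\<^sup>2) (a\<^sup>2 * (pi / \<bar>a\<bar>))"
      using False by (simp add: power_mult_distrib)
    moreover have "a\<^sup>2 * (pi / \<bar>a\<bar>) = pi * \<bar>a\<bar>"
      using False by (simp add: field_simps power2_eq_square abs_if)
    ultimately show ?thesis by simp
  qed (simp add: has_bochner_integral_zero)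
qed

text \<open>This is (1 / (2 pi)) (sin (t/2) / (t/2))^2 for t \<noteq> 0. At 0 the value is 0 instead
  of the continuous value 1 / (2 pi); integrals do not see this, but pointwise identities have to
  exclude the point.\<close>

definition fejer :: "real \<Rightarrow> real" where
  "fejer t = (1 - cos t) / (pi * t\<^sup>2)"

definition tent :: "real \<Rightarrow> real" where
  "tent x = max 0 (1 - \<bar>x\<bar>)"

lemma fejer_nonneg: "0 \<le> fejer t"
  by (simp add: fejer_def)

lemma fejer_measurable [measurable]: "fejer \<in> borel_measurable borel"
  unfolding fejer_def by measurable

lemma fejer_even [simp]: "fejer (- t) = fejer t"
  by (simp add: fejer_def)

lemma has_integral_fejer: "has_bochner_integral lborel fejer 1"
  using has_bochner_integral_divide[OF has_integral_one_minus_cos[of 1], of pi]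
  by (simp add: fejer_def[abs_def] mult.commute)

lemma integrable_fejer: "integrable lborel fejer"
  using has_integral_fejer by (rule integrable.intros)

lemma tent_eq: "tent x = (\<bar>x + 1\<bar> + \<bar>x - 1\<bar>) / 2 - \<bar>x\<bar>"
  by (auto simp: tent_def max_def abs_if field_simps)

text \<open>The tent is half the second difference of |x|, and cos ((x + 1) t) + cos ((x - 1) t) = 2
  cos (x t) cos t. Hence the same combination of the integrals of
  \<open>(1 - cos (a * t)) / t^2\<close> at a = x + 1, x - 1 and x has integrand
  \<open>pi * fejer t * cos (t * x)\<close>.\<close>

lemma has_integral_fejer_cos:
  "has_bochner_integral lborel (\<lambda>t. fejer t * cos (t * x)) (tent x)"
proof -
  have 1: "has_bochner_integral lborel
     (\<lambda>t. (((1 - cos ((x + 1) * t)) / t\<^sup>2 + (1 - cos ((x - 1) * t)) / t\<^sup>2) / 2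
          - (1 - cos (x * t)) / t\<^sup>2) / pi)
     (((pi * \<bar>x + 1\<bar> + pi * \<bar>x - 1\<bar>) / 2 - pi * \<bar>x\<bar>) / pi)"
    by (intro has_bochner_integral_divide has_bochner_integral_diff has_bochner_integral_add
        has_integral_one_minus_cos)
  have "(((1 - cos ((x + 1) * t)) / t\<^sup>2 + (1 - cos ((x - 1) * t)) / t\<^sup>2) / 2
          - (1 - cos (x * t)) / t\<^sup>2) / pi = fejer t * cos (t * x)" for t
  proof -
    have "cos ((x + 1) * t) + cos ((x - 1) * t) = 2 * cos (x * t) * cos t"
      by (simp add: distrib_right left_diff_distrib cos_add cos_diff)
    then have "(1 - cos ((x + 1) * t)) + (1 - cos ((x - 1) * t)) - 2 * (1 - cos (x * t))
         = 2 * ((1 - cos t) * cos (t * x))"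
      by (simp add: algebra_simps)
    then have "((1 - cos ((x + 1) * t)) + (1 - cos ((x - 1) * t)) - 2 * (1 - cos (x * t))) / (2 * t\<^sup>2 * pi)
         = 2 * ((1 - cos t) * cos (t * x)) / (2 * t\<^sup>2 * pi)" by simp
    then show ?thesis
      by (simp add: fejer_def mult_ac add_divide_distrib diff_divide_distrib[of _ _ "_ * _"])
         (simp add: algebra_simps add_divide_distrib diff_divide_distrib)
  qed
  moreover have "((pi * \<bar>x + 1\<bar> + pi * \<bar>x - 1\<bar>) / 2 - pi * \<bar>x\<bar>) / pi = tent x"
    by (simp add: tent_eq field_simps)
  ultimately show ?thesis using 1 by simp
qed

lemma has_integral_fejer_sin:
  "has_bochner_integral lborel (\<lambda>t. fejer t * sin (t * x)) 0"
proof -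
  have int: "integrable lborel (\<lambda>t. fejer t * sin (t * x))"
    by (rule Bochner_Integration.integrable_bound[OF integrable_fejer])
       (auto simp: abs_mult mult_left_le intro!: AE_I2 mult_left_le)
  have "(\<integral>t. fejer t * sin (t * x) \<partial>lborel) = (\<integral>t. - (fejer t * sin (t * x)) \<partial>lborel)"
    by (subst lborel_integral_real_affine[of "-1" _ 0]) simp_all
  then have "(\<integral>t. fejer t * sin (t * x) \<partial>lborel) = 0" by simp
  with int show ?thesis by (simp add: has_bochner_integral_iff)
qed

lemma has_integral_fejer_exp:
  "has_bochner_integral lborel
     (\<lambda>t. complex_of_real (fejer t) * exp (- \<i> * complex_of_real (t * x))) (complex_of_real (tent x))"
proof -
  have "has_bochner_integral lborel
      (\<lambda>t. complex_of_real (fejer t * cos (t * x)) - \<i> * complex_of_real (fejer t * sin (t * x)))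
      (complex_of_real (tent x) - \<i> * complex_of_real 0)"
    by (intro has_bochner_integral_diff has_bochner_integral_mult_right
        has_bochner_integral_of_real has_integral_fejer_cos has_integral_fejer_sin)
  moreover have "complex_of_real (fejer t) * exp (- \<i> * complex_of_real (t * x)) =
      complex_of_real (fejer t * cos (t * x)) - \<i> * complex_of_real (fejer t * sin (t * x))" for t
  proof -
    have "exp (- \<i> * complex_of_real (t * x)) = complex_of_real (cos (t * x)) - \<i> * complex_of_real (sin (t * x))"
      using exp_Euler[of "- complex_of_real (t * x)"]
      by (simp only: sin_minus cos_minus cos_of_real sin_of_real mult_minus_left mult_minus_right) simp
    then show ?thesis by (simp only:) (simp add: algebra_simps)
  qed
  ultimately show ?thesis by simp
qed

section \<open>The Poisson kernel and its Fourier transform\<close>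

definition poisson :: "real \<Rightarrow> real \<Rightarrow> real" where
  "poisson a t = a / (pi * (a\<^sup>2 + t\<^sup>2))"

text \<open>The Poisson kernel is a mixture of dilated Fejer kernels (Polya's representation of
  \<^term>\<open>exp (- a * \<bar>x\<bar>)\<close> as a mixture of tents), which yields its Fourier transform by Fubini.\<close>

lemma poisson_mixture:
  assumes "a > 0" "t \<noteq> 0"
  shows "has_bochner_integral lborel
    (\<lambda>s. indicator {0..} s * (a\<^sup>2 * s\<^sup>2 * exp (- a * s) * fejer (s * t))) (poisson a t)"
proof -
  define c where "c = pi * t\<^sup>2"
  have c: "c > 0" using assms by (simp add: c_def)
  have nz: "a\<^sup>2 + t\<^sup>2 > 0" using assms by (simp add: add_pos_nonneg)
  define f where "f = (\<lambda>s. a\<^sup>2 * exp (- a * s) * (1 - cos (s * t)) / c)"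
  \<comment> \<open>A primitive of f, which is the mixture integrand after s^2 has cancelled against
    \<open>fejer (s * t)\<close>. The second summand integrates the damped cosine.\<close>
  define G where "G = (\<lambda>s. - (a * exp (- a * s)
      + a\<^sup>2 * exp (- a * s) * (t * sin (s * t) - a * cos (s * t)) / (a\<^sup>2 + t\<^sup>2)) / c)"
  have "a\<^sup>2 * exp (- a * s) * (1 - cos (s * t)) =
      - (a * (- a * exp (- a * s)) + (a\<^sup>2 * (- a * exp (- a * s)) * (t * sin (s * t) - a * cos (s * t))
        + a\<^sup>2 * exp (- a * s) * (t * (t * cos (s * t)) + a * (t * sin (s * t)))) / (a\<^sup>2 + t\<^sup>2))" for s
  proof -
    have "(a\<^sup>2 * (- a * exp (- a * s)) * (t * sin (s * t) - a * cos (s * t))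
        + a\<^sup>2 * exp (- a * s) * (t * (t * cos (s * t)) + a * (t * sin (s * t))))
       = (a\<^sup>2 * exp (- a * s) * cos (s * t)) * (a\<^sup>2 + t\<^sup>2)"
      by (simp add: algebra_simps power2_eq_square)
    then show ?thesis using nz by (simp only: nonzero_mult_div_cancel_right[OF less_imp_neq[OF nz, symmetric]])
        (simp add: algebra_simps power2_eq_square)
  qed note key = this
  have D: "DERIV G s :> f s" for s
    unfolding G_def f_def key using nz c
    by (auto intro!: derivative_eq_intros simp del: mult_minus_left minus_mult_minus)
  have limexp: "((\<lambda>s. exp (- a * s)) \<longlongrightarrow> 0) at_top"
    using assms by real_asymp
  have lim2: "((\<lambda>s. exp (- a * s) * (t * sin (s * t) - a * cos (s * t))) \<longlongrightarrow> 0) at_top"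
  proof (rule Lim_null_comparison)
    show "\<forall>\<^sub>F s in at_top. norm (exp (- a * s) * (t * sin (s * t) - a * cos (s * t)))
         \<le> exp (- a * s) * (\<bar>t\<bar> + \<bar>a\<bar>)"
    proof (intro always_eventually allI)
      fix s
      have "\<bar>t * sin (s * t) - a * cos (s * t)\<bar> \<le> \<bar>t * sin (s * t)\<bar> + \<bar>a * cos (s * t)\<bar>"
        by simp
      also have "\<dots> \<le> \<bar>t\<bar> + \<bar>a\<bar>"
        by (intro add_mono) (auto simp: abs_mult intro!: mult_left_le)
      finally show "norm (exp (- a * s) * (t * sin (s * t) - a * cos (s * t)))
         \<le> exp (- a * s) * (\<bar>t\<bar> + \<bar>a\<bar>)" by (simp add: abs_mult)
    qed
    show "((\<lambda>s. exp (- a * s) * (\<bar>t\<bar> + \<bar>a\<bar>)) \<longlongrightarrow> 0) at_top"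
      using tendsto_mult_right[OF limexp, of "\<bar>t\<bar> + \<bar>a\<bar>"] by simp
  qed
  have "((\<lambda>s. - (a * exp (- a * s)
      + a\<^sup>2 * (exp (- a * s) * (t * sin (s * t) - a * cos (s * t))) / (a\<^sup>2 + t\<^sup>2)) / c) \<longlongrightarrow>
      - (a * 0 + a\<^sup>2 * 0 / (a\<^sup>2 + t\<^sup>2)) / c) at_top"
    using nz c by (intro tendsto_intros limexp lim2) auto
  then have lim: "(G \<longlongrightarrow> 0) at_top" by (simp add: G_def mult.assoc)
  have f0: "0 \<le> f s" for s using c by (simp add: f_def)
  have "(\<integral>\<^sup>+s. ennreal (f s) * indicator {0..} s \<partial>lborel) = ennreal (0 - G 0)"
    by (rule nn_integral_FTC_atLeast[OF _ D _ lim]) (auto simp only: f0, simp add: f_def)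
  also have "0 - G 0 = poisson a t"
  proof -
    have "0 - G 0 = (a - a^3 / (a\<^sup>2 + t\<^sup>2)) / c"
      by (simp add: G_def power2_eq_square power3_eq_cube) (simp add: diff_divide_distrib)
    also have "a - a^3 / (a\<^sup>2 + t\<^sup>2) = a * t\<^sup>2 / (a\<^sup>2 + t\<^sup>2)"
    proof -
      have "a = a * (a\<^sup>2 + t\<^sup>2) / (a\<^sup>2 + t\<^sup>2)" using nz by simp
      also have "\<dots> = a ^ 3 / (a\<^sup>2 + t\<^sup>2) + a * t\<^sup>2 / (a\<^sup>2 + t\<^sup>2)"
        by (simp add: distrib_left add_divide_distrib power2_eq_square power3_eq_cube)
      finally show ?thesis by linarith
    qed
    finally show ?thesis using assms nz by (simp add: poisson_def c_def)
  qed
  finally have "(\<integral>\<^sup>+s. ennreal (indicator {0..} s * f s) \<partial>lborel) = ennreal (poisson a t)"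
    by (subst (asm) nn_integral_cong[where v = "\<lambda>s. ennreal (indicator {0..} s * f s)"])
       (auto split: split_indicator)
  then have "has_bochner_integral lborel (\<lambda>s. indicator {0..} s * f s) (poisson a t)"
    by (intro has_bochner_integral_nn_integral)
       (use assms c in \<open>auto simp: f0 f_def poisson_def intro!: AE_I2 divide_nonneg_nonneg\<close>)
  moreover have "indicator {0..} s * f s =
      indicator {0..} s * (a\<^sup>2 * s\<^sup>2 * exp (- a * s) * fejer (s * t))" for s
    using assms by (cases "s = 0") (simp_all add: f_def fejer_def c_def power_mult_distrib)
  ultimately show ?thesis by simp
qed

text \<open>Taylor's formula at infinity: \<open>exp (- a * L)\<close> is the integral over s \<ge>
  L of (s - L) times the second derivative, and \<open>s * tent (x / s)\<close> is the positive part
  of s - |x|.\<close>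

lemma tent_mixture:
  assumes "a > 0"
  shows "has_bochner_integral lborel
    (\<lambda>s. indicator {0..} s * (a\<^sup>2 * s * exp (- a * s) * tent (x / s))) (exp (- a * \<bar>x\<bar>))"
proof -
  define L where "L = \<bar>x\<bar>"
  have L: "L \<ge> 0" by (simp add: L_def)
  define f where "f = (\<lambda>s. a\<^sup>2 * (s - L) * exp (- a * s))"
  have D: "DERIV (\<lambda>s. - (a * (s - L) + 1) * exp (- a * s)) s :> f s" for s
    unfolding f_def by (auto intro!: derivative_eq_intros simp: algebra_simps power2_eq_square)
  have lim: "((\<lambda>s. - (a * (s - L) + 1) * exp (- a * s)) \<longlongrightarrow> 0) at_top"
    using assms by real_asymp
  have f0: "0 \<le> f s" if "L \<le> s" for s using that by (simp add: f_def)
  have "(\<integral>\<^sup>+s. ennreal (f s) * indicator {L..} s \<partial>lborel) = ennreal (0 - (- (a * (L - L) + 1) * exp (- a * L)))"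
    by (rule nn_integral_FTC_atLeast[OF _ D f0 lim]) (auto simp: f_def)
  then have "(\<integral>\<^sup>+s. ennreal (indicator {L..} s * f s) \<partial>lborel) = ennreal (exp (- a * L))"
    by (subst (asm) nn_integral_cong[where v = "\<lambda>s. ennreal (indicator {L..} s * f s)"])
       (auto split: split_indicator)
  then have "has_bochner_integral lborel (\<lambda>s. indicator {L..} s * f s) (exp (- a * L))"
    by (intro has_bochner_integral_nn_integral)
       (auto intro!: AE_I2 f0 simp: f_def split: split_indicator)
  moreover have "indicator {L..} s * f s =
      indicator {0..} s * (a\<^sup>2 * s * exp (- a * s) * tent (x / s))" for s
    using L by (cases "s = 0"; cases "L \<le> s")
      (auto simp: f_def tent_def L_def max_def field_simps split: split_indicator)
  ultimately show ?thesis by (simp add: L_def)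
qed


lemma poisson_measurable [measurable]: "poisson a \<in> borel_measurable borel"
  unfolding poisson_def[abs_def] by measurable

lemma poisson_nonneg: "0 < a \<Longrightarrow> 0 \<le> poisson a t"
  by (simp add: poisson_def)

lemma has_integral_fejer_dilate_exp:
  assumes "s > 0"
  shows "has_bochner_integral lborel
     (\<lambda>t. complex_of_real (fejer (s * t)) * exp (- \<i> * complex_of_real (t * x))) (complex_of_real (tent (x / s) / s))"
  using lborel_has_bochner_integral_real_affine_iff[of s, THEN iffD1, OF _ has_integral_fejer_exp[of "x / s"], of 0] assms
  by (simp add: field_simps scaleR_conv_of_real)

lemma has_integral_poisson_exp:
  assumes "a > 0"
  shows "has_bochner_integral lborel
     (\<lambda>t. complex_of_real (poisson a t) * exp (- \<i> * complex_of_real (t * x))) (complex_of_real (exp (- a * \<bar>x\<bar>)))"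
proof -
  define w where "w = (\<lambda>s. indicator {0..} s * (a\<^sup>2 * s\<^sup>2 * exp (- a * s)))"
  define F where "F = (\<lambda>s t. complex_of_real (w s) *
     (complex_of_real (fejer (s * t)) * exp (- \<i> * complex_of_real (t * x))))"
  have w0: "w s = 0" if "s \<le> 0" for s using that by (auto simp: w_def split: split_indicator)
  have wn: "0 \<le> w s" for s by (auto simp: w_def)
  have [measurable]: "w \<in> borel_measurable borel" unfolding w_def by measurable
  have inner: "has_bochner_integral lborel (F s)
      (complex_of_real (indicator {0..} s * (a\<^sup>2 * s * exp (- a * s) * tent (x / s))))" for s
  proof (cases "s > 0")
    case True
    have "has_bochner_integral lborel (F s) (complex_of_real (w s) * complex_of_real (tent (x / s) / s))"
      unfolding F_def by (intro has_bochner_integral_mult_right has_integral_fejer_dilate_exp True)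
    moreover have "w s * (tent (x / s) / s) = indicator {0..} s * (a\<^sup>2 * s * exp (- a * s) * tent (x / s))"
      using True by (simp add: w_def power2_eq_square)
    ultimately show ?thesis by (metis of_real_mult)
  next
    case False
    then have "F s = (\<lambda>_. 0)" "indicator {0..} s * (a\<^sup>2 * s * exp (- a * s) * tent (x / s)) = 0"
      by (auto simp: F_def w0 split: split_indicator)
    then show ?thesis by (simp only: of_real_0) (simp add: has_bochner_integral_zero)
  qed
  \<comment> \<open>Fejer kernels have mass 1, so the inner norms reproduce the tent mixture at x =
    0. \<open>tent_mixture\<close> at 0 therefore supplies the joint integrability.\<close>
  have norm_inner: "(\<integral>t. norm (F s t) \<partial>lborel) =
      indicator {0..} s * (a\<^sup>2 * s * exp (- a * s) * tent (0 / s))" for s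
  proof (cases "s > 0")
    case True
    have "norm (F s t) = w s * fejer (s * t)" for t
      by (simp add: F_def norm_mult wn fejer_nonneg)
    moreover have "(\<integral>t. fejer (s * t) \<partial>lborel) = 1 / s"
      using lborel_has_bochner_integral_real_affine_iff[of s, THEN iffD1, OF _ has_integral_fejer, of 0] True
      by (simp add: has_bochner_integral_iff inverse_eq_divide)
    ultimately show ?thesis using True
      by (simp add: w_def power2_eq_square tent_def)
  next
    case False
    then show ?thesis by (auto simp: F_def w0 split: split_indicator)
  qed
  have int: "integrable (lborel \<Otimes>\<^sub>M lborel) (case_prod F)"
  proof (rule lborel_pair.Fubini_integrable)
    show "case_prod F \<in> borel_measurable (lborel \<Otimes>\<^sub>M lborel)" unfolding F_def by measurable
    show "integrable lborel (\<lambda>s. LINT t|lborel. norm (case_prod F (s, t)))"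
      using tent_mixture[OF assms, of 0] by (simp add: norm_inner has_bochner_integral_iff)
    show "AE s in lborel. integrable lborel (\<lambda>t. case_prod F (s, t))"
      using inner by (auto simp: has_bochner_integral_iff)
  qed
  have "(\<integral>t. (\<integral>s. F s t \<partial>lborel) \<partial>lborel) = (\<integral>s. (\<integral>t. F s t \<partial>lborel) \<partial>lborel)"
    by (rule lborel_pair.Fubini_integral[OF int])
  also have "\<dots> = (\<integral>s. complex_of_real (indicator {0..} s * (a\<^sup>2 * s * exp (- a * s) * tent (x / s))) \<partial>lborel)"
    using inner by (intro Bochner_Integration.integral_cong) (auto simp: has_bochner_integral_iff)
  also have "\<dots> = complex_of_real (exp (- a * \<bar>x\<bar>))"
    using has_bochner_integral_of_real[OF tent_mixture[OF assms, of x], where 'a = complex]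
    by (simp only: has_bochner_integral_iff)
  finally have "has_bochner_integral lborel (\<lambda>t. \<integral>s. F s t \<partial>lborel) (complex_of_real (exp (- a * \<bar>x\<bar>)))"
    using lborel_pair.integrable_snd[OF int] by (simp add: has_bochner_integral_iff)
  \<comment> \<open>The mixture formula excludes t = 0, where \<open>fejer\<close> vanishes; a
    single point is null.\<close>
  moreover have "AE t in lborel. (\<integral>s. F s t \<partial>lborel) = complex_of_real (poisson a t) * exp (- \<i> * complex_of_real (t * x))"
    using AE_lborel_singleton[of "0::real"]
  proof eventually_elim
    case (elim t)
    have "has_bochner_integral lborel (\<lambda>s. complex_of_real
          (indicator {0..} s * (a\<^sup>2 * s\<^sup>2 * exp (- a * s) * fejer (s * t))) * exp (- \<i> * complex_of_real (t * x)))
        (complex_of_real (poisson a t) * exp (- \<i> * complex_of_real (t * x)))"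
      by (intro has_bochner_integral_mult_left has_bochner_integral_of_real poisson_mixture assms elim)
    then show ?case
      by (simp add: has_bochner_integral_iff F_def w_def mult.assoc)
  qed
  ultimately show ?thesis
    using lborel_pair.integrable_snd[OF int]
    by (subst (asm) has_bochner_integral_cong_AE) (auto dest: borel_measurable_integrable)
qed

lemma has_integral_poisson:
  assumes "a > 0"
  shows "has_bochner_integral lborel (poisson a) 1"
  using has_bochner_integral_bounded_linear[OF bounded_linear_Re has_integral_poisson_exp[OF assms, of 0]]
  by simp

lemma integrable_poisson: "a > 0 \<Longrightarrow> integrable lborel (poisson a)"
  using has_integral_poisson by (rule integrable.intros)

section \<open>Iterated differences of the Poisson kernel\<close>

primrec poisson_diff :: "real \<Rightarrow> real \<Rightarrow> nat \<Rightarrow> real \<Rightarrow> real" where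
  "poisson_diff a h 0 t = poisson a t"
| "poisson_diff a h (Suc n) t = poisson_diff a h n (t + h) - poisson_diff a h n t"

lemma integrable_poisson_diff:
  assumes "a > 0"
  shows "integrable lborel (poisson_diff a h n)"
proof (induction n)
  case 0
  then show ?case using integrable_poisson[OF assms] by (simp add: poisson_def[abs_def])
next
  case (Suc n)
  then show ?case
    using lborel_integrable_real_affine[OF Suc, of 1 h] by (simp add: add.commute)
qed

text \<open>The Poisson kernel is the imaginary part of \<^term>\<open>1 / (pi * (t - \<i> * a))\<close>,
  whose iterated differences are explicit.\<close>

lemma poisson_diff_eq:
  assumes "a > 0"
  shows "poisson_diff a h n t =
    Im ((- 1) ^ n * fact n * complex_of_real h ^ n /
        (\<Prod>j\<le>n. complex_of_real (t + real j * h) - \<i> * complex_of_real a)) / pi"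
proof (induction n arbitrary: t)
  case 0
  show ?case
    by (simp add: poisson_def Im_divide)
next
  case (Suc n)
  define z where "z = (\<lambda>j::nat. complex_of_real (t + real j * h) - \<i> * complex_of_real a)"
  have nz: "z j \<noteq> 0" for j
    using assms by (auto simp: z_def complex_eq_iff)
  \<comment> \<open>The denominators for t and t + h share the factors z 1, ..., z n, so in the
    difference only z 0 - z (n + 1) survives in the numerator; it equals -(n + 1) h and advances
    both the factorial and the power of h.\<close>
  define q where "q = (\<Prod>j=1..n. z j)"
  define c where "c = (- 1) ^ n * fact n * complex_of_real h ^ n"
  have q: "q \<noteq> 0" using nz by (simp add: q_def)
  have p0: "(\<Prod>j\<le>n. z j) = z 0 * q"
    unfolding q_def by (simp add: prod.atMost_shift lessThan_Suc_atMost atLeastLessThanSuc_atLeastAtMost flip: prod.atLeast1_atMost_eq)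
  have p1: "(\<Prod>j\<le>n. z (Suc j)) = q * z (Suc n)"
    unfolding q_def by (simp add: prod.atLeast1_atMost_eq lessThan_Suc_atMost[symmetric])
  have p2: "(\<Prod>j\<le>Suc n. z j) = z 0 * q * z (Suc n)"
    using p0 by simp
  have shift: "complex_of_real (t + h + real j * h) - \<i> * complex_of_real a = z (Suc j)" for j
    by (simp add: z_def algebra_simps)
  have "poisson_diff a h (Suc n) t = Im (c / (q * z (Suc n)) - c / (z 0 * q)) / pi"
    unfolding poisson_diff.simps Suc.IH shift p1 c_def[symmetric] z_def[symmetric] p0
    by (simp add: diff_divide_distrib)
  also have "c / (q * z (Suc n)) - c / (z 0 * q) = c * (z 0 - z (Suc n)) / (z 0 * q * z (Suc n))"
    using nz q by (simp add: field_simps)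
  also have "z 0 - z (Suc n) = - (of_nat (Suc n) * complex_of_real h)"
    by (simp add: z_def algebra_simps)
  also have "c * - (of_nat (Suc n) * complex_of_real h) = (- 1) ^ Suc n * fact (Suc n) * complex_of_real h ^ Suc n"
    by (simp add: c_def algebra_simps)
  finally show ?case by (simp only: p2[symmetric]) (simp only: z_def)
qed

text \<open>The explicit quotient has n + 1 factors in the denominator, each of modulus at least a.
  Two of them are kept for integrability: by the arithmetic-geometric mean inequality their
  reciprocal product is at most an average of two Poisson kernels of mass 1. The other n - 1 are
  replaced by a. For n = 0 only one factor exists, so this case is separate.\<close>

lemma integral_poisson_diff_le:
  assumes "a > 0"
  shows "(\<integral>t. \<bar>poisson_diff a h n t\<bar> \<partial>lborel) \<le> fact n * (\<bar>h\<bar> / a) ^ n"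
proof (cases n)
  case 0
  have "(\<integral>t. \<bar>poisson_diff a h n t\<bar> \<partial>lborel) = (\<integral>t. poisson a t \<partial>lborel)"
    using assms by (simp add: 0 poisson_nonneg)
  then show ?thesis using has_integral_poisson[OF assms] by (simp add: has_bochner_integral_iff 0)
next
  case (Suc m)
  define z where "z = (\<lambda>t (j::nat). complex_of_real (t + real j * h) - \<i> * complex_of_real a)"
  define C where "C = fact n * \<bar>h\<bar> ^ n / a ^ n"
  have za: "a \<le> norm (z t j)" for t j
    using abs_Im_le_cmod[of "z t j"] assms by (simp add: z_def)
  have z2: "(norm (z t j))\<^sup>2 = a\<^sup>2 + (t + real j * h)\<^sup>2" for t j
    by (simp add: z_def cmod_power2)
  have bound: "\<bar>poisson_diff a h n t\<bar> \<le> C * ((poisson a t + poisson a (t + h)) / 2)" for t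
  proof -
    have pos: "norm (z t j) > 0" for j using za[of t j] assms by linarith
    have "\<bar>poisson_diff a h n t\<bar> \<le> norm ((- 1) ^ n * fact n * complex_of_real h ^ n / (\<Prod>j\<le>n. z t j)) / pi"
      unfolding poisson_diff_eq[OF assms] z_def by (simp add: divide_right_mono abs_Im_le_cmod)
    also have "\<dots> = fact n * \<bar>h\<bar> ^ n / (\<Prod>j\<le>n. norm (z t j)) / pi"
      by (simp add: norm_mult norm_divide norm_power prod_norm)
    also have "(\<Prod>j\<le>n. norm (z t j)) = norm (z t 0) * norm (z t 1) * (\<Prod>j<m. norm (z t (Suc (Suc j))))"
      by (simp add: Suc prod.atMost_Suc_shift lessThan_Suc_atMost[symmetric] prod.lessThan_Suc_shift del: prod.lessThan_Suc)
    also have "fact n * \<bar>h\<bar> ^ n / (norm (z t 0) * norm (z t 1) * (\<Prod>j<m. norm (z t (Suc (Suc j))))) / pi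
        \<le> fact n * \<bar>h\<bar> ^ n / (norm (z t 0) * norm (z t 1) * a ^ m) / pi"
    proof -
      have "a ^ m \<le> (\<Prod>j<m. norm (z t (Suc (Suc j))))"
        using prod_mono[of "{..<m}" "\<lambda>_. a" "\<lambda>j. norm (z t (Suc (Suc j)))"] za assms by simp
      then show ?thesis using pos assms
        by (intro divide_right_mono divide_left_mono mult_left_mono mult_pos_pos prod_pos) auto
    qed
    also have "\<dots> = C * (a / pi * (1 / (norm (z t 0) * norm (z t 1))))"
      using assms by (simp add: C_def Suc mult_ac del: fact_Suc)
    also have "\<dots> \<le> C * (a / pi * ((1 / (norm (z t 0))\<^sup>2 + 1 / (norm (z t 1))\<^sup>2) / 2))"
    proof (intro mult_left_mono)
      have "2 * (1 / norm (z t 0)) * (1 / norm (z t 1)) \<le> (1 / norm (z t 0))\<^sup>2 + (1 / norm (z t 1))\<^sup>2"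
        by (rule sum_squares_bound)
      then show "1 / (norm (z t 0) * norm (z t 1)) \<le> (1 / (norm (z t 0))\<^sup>2 + 1 / (norm (z t 1))\<^sup>2) / 2"
        by (simp add: power_divide)
    qed (use assms in \<open>auto simp: C_def\<close>)
    also have "a / pi * ((1 / (norm (z t 0))\<^sup>2 + 1 / (norm (z t 1))\<^sup>2) / 2) = (poisson a t + poisson a (t + h)) / 2"
      by (simp add: z2 poisson_def distrib_left add_divide_distrib mult_ac)
    finally show ?thesis .
  qed
  have int: "integrable lborel (\<lambda>t. poisson a (t + h))"
    using lborel_integrable_real_affine[OF integrable_poisson[OF assms], of 1 h] by (simp add: add.commute)
  have eq: "(\<integral>t. poisson a (t + h) \<partial>lborel) = 1"
    using lborel_integral_real_affine[of 1 "poisson a" h] has_integral_poisson[OF assms]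
    by (simp add: add.commute has_bochner_integral_iff)
  have "(\<integral>t. \<bar>poisson_diff a h n t\<bar> \<partial>lborel) \<le> (\<integral>t. C * ((poisson a t + poisson a (t + h)) / 2) \<partial>lborel)"
    using bound by (intro integral_mono integrable_abs integrable_poisson_diff assms
        integrable_mult_right integrable_divide Bochner_Integration.integrable_add integrable_poisson int) auto
  also have "\<dots> = C"
    using eq int integrable_poisson[OF assms] has_integral_poisson[OF assms]
    by (simp add: has_bochner_integral_iff)
  finally show ?thesis by (simp add: C_def power_divide)
qed

section \<open>Continuity of translations in L1\<close>

lemma integrable_translate:
  fixes f :: "'a::euclidean_space \<Rightarrow> 'b::{banach,second_countable_topology}"
  assumes "integrable lborel f"
  shows "integrable lborel (\<lambda>x. f (c + x))"
proof -
  have "integrable (distr lborel borel ((+) c)) f"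
    using assms by (simp add: lborel_distr_plus)
  then show ?thesis
    by (subst (asm) integrable_distr_eq) (use assms in \<open>auto dest: borel_measurable_integrable\<close>)
qed

lemma integral_translate:
  fixes f :: "'a::euclidean_space \<Rightarrow> 'b::{banach,second_countable_topology}"
  assumes "f \<in> borel_measurable borel"
  shows "(\<integral>x. f (c + x) \<partial>lborel) = (\<integral>x. f x \<partial>lborel)"
proof -
  have "(\<integral>x. f x \<partial>lborel) = (\<integral>x. f x \<partial>(distr lborel borel ((+) c)))"
    by (simp add: lborel_distr_plus)
  also have "\<dots> = (\<integral>x. f (c + x) \<partial>lborel)"
    using assms by (subst integral_distr) auto
  finally show ?thesis by simp
qed

lemma has_integral_dilate:
  fixes f :: "'a::euclidean_space \<Rightarrow> 'b::{banach,second_countable_topology}"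
  assumes f: "integrable lborel f" and c: "c > 0"
  shows "has_bochner_integral lborel (\<lambda>x. c ^ DIM('a) *\<^sub>R f (c *\<^sub>R x)) (integral\<^sup>L lborel f)"
proof -
  have m [measurable]: "f \<in> borel_measurable borel" using f by (auto dest: borel_measurable_integrable)
  have eq: "(lborel :: 'a measure) = density (distr lborel borel (\<lambda>x. c *\<^sub>R x)) (\<lambda>_. ennreal (c ^ DIM('a)))"
    using lborel_affine[of c "0::'a"] c by (simp add: ennreal_power)
  have "integrable (density (distr lborel borel (\<lambda>x. c *\<^sub>R x)) (\<lambda>_. ennreal (c ^ DIM('a)))) f"
    using f by (simp flip: eq)
  then have 1: "integrable lborel (\<lambda>x. c ^ DIM('a) *\<^sub>R f (c *\<^sub>R x))"
    by (subst (asm) integrable_density) (use c in \<open>auto simp: integrable_distr_eq\<close>)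
  have "integral\<^sup>L lborel f = (\<integral>x. f x \<partial>density (distr lborel borel (\<lambda>x. c *\<^sub>R x)) (\<lambda>_. ennreal (c ^ DIM('a))))"
    by (simp flip: eq)
  also have "\<dots> = (\<integral>x. c ^ DIM('a) *\<^sub>R f (c *\<^sub>R x) \<partial>lborel)"
    using c by (subst integral_density) (auto simp: integral_distr)
  finally show ?thesis using 1 by (simp add: has_bochner_integral_iff)
qed

text \<open>The L1 modulus of continuity of f.\<close>

definition transl_diff :: "('a::euclidean_space \<Rightarrow> 'b::{banach,second_countable_topology}) \<Rightarrow> 'a \<Rightarrow> real" where
  "transl_diff f s = (\<integral>t. norm (f (t - s) - f t) \<partial>lborel)"

lemma integrable_translate':
  fixes f :: "'a::euclidean_space \<Rightarrow> 'b::{banach,second_countable_topology}"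
  assumes "integrable lborel f"
  shows "integrable lborel (\<lambda>x. f (x - c))" "integrable lborel (\<lambda>x. f (x + c))"
  using integrable_translate[OF assms, of "- c"] integrable_translate[OF assms, of c]
  by (simp_all add: add.commute)

lemma integral_translate':
  fixes f :: "'a::euclidean_space \<Rightarrow> 'b::{banach,second_countable_topology}"
  assumes "f \<in> borel_measurable borel"
  shows "(\<integral>x. f (x - c) \<partial>lborel) = (\<integral>x. f x \<partial>lborel)" "(\<integral>x. f (x + c) \<partial>lborel) = (\<integral>x. f x \<partial>lborel)"
  using integral_translate[OF assms, of "- c"] integral_translate[OF assms, of c]
  by (simp_all add: add.commute)

lemma transl_diff_nonneg: "0 \<le> transl_diff f s"
  by (simp add: transl_diff_def)

lemma transl_diff_approx:
  assumes f: "integrable lborel f" and g: "integrable lborel g"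
  shows "transl_diff f s \<le> 2 * (\<integral>t. norm (f t - g t) \<partial>lborel) + transl_diff g s"
proof -
  have [measurable]: "f \<in> borel_measurable borel" "g \<in> borel_measurable borel"
    using f g by (auto dest: borel_measurable_integrable)
  have fg: "integrable lborel (\<lambda>t. norm (f t - g t))" using f g by auto
  have "transl_diff f s \<le> (\<integral>t. norm (f (t - s) - g (t - s)) + norm (f t - g t) + norm (g (t - s) - g t) \<partial>lborel)"
    unfolding transl_diff_def
  proof (rule integral_mono)
    fix t
    have "norm (f (t - s) - f t) = norm ((f (t - s) - g (t - s)) - (f t - g t) + (g (t - s) - g t))" by simp
    also have "\<dots> \<le> norm (f (t - s) - g (t - s)) + norm (f t - g t) + norm (g (t - s) - g t)"
      by (intro norm_triangle_le add_right_mono norm_triangle_ineq4)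
    finally show "norm (f (t - s) - f t) \<le> norm (f (t - s) - g (t - s)) + norm (f t - g t) + norm (g (t - s) - g t)" .
  qed (use f g integrable_translate'[OF f] integrable_translate'[OF g] in auto)
  also have "\<dots> = (\<integral>t. norm (f (t - s) - g (t - s)) \<partial>lborel) + (\<integral>t. norm (f t - g t) \<partial>lborel) + transl_diff g s"
    using f g integrable_translate'[OF f] integrable_translate'[OF g]
    unfolding transl_diff_def by (simp add: Bochner_Integration.integral_add)
  also have "(\<integral>t. norm (f (t - s) - g (t - s)) \<partial>lborel) = (\<integral>t. norm (f t - g t) \<partial>lborel)"
    by (rule integral_translate'(1)) simp
  finally show ?thesis by simp
qed

lemma transl_diff_le:
  assumes f: "integrable lborel f"
  shows "transl_diff f s \<le> 2 * (\<integral>t. norm (f t) \<partial>lborel)"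
  using transl_diff_approx[OF f, of "\<lambda>_. 0" s] by (simp add: transl_diff_def)

lemma transl_diff_tendsto_approx:
  assumes f: "integrable lborel f" and X: "X \<longlonglongrightarrow> 0"
    and approx: "\<And>e. e > 0 \<Longrightarrow> \<exists>g. integrable lborel g \<and> (\<lambda>n. transl_diff g (X n)) \<longlonglongrightarrow> 0
       \<and> (\<integral>t. norm (f t - g t) \<partial>lborel) < e"
  shows "(\<lambda>n. transl_diff f (X n)) \<longlonglongrightarrow> 0"
proof (rule LIMSEQ_I)
  fix r :: real assume "r > 0"
  then obtain g where g: "integrable lborel g" "(\<lambda>n. transl_diff g (X n)) \<longlonglongrightarrow> 0"
    "(\<integral>t. norm (f t - g t) \<partial>lborel) < r / 4"
    using approx[of "r / 4"] by auto
  from LIMSEQ_D[OF g(2), of "r / 2"] \<open>r > 0\<close>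
  obtain N where N: "\<And>n. n \<ge> N \<Longrightarrow> norm (transl_diff g (X n) - 0) < r / 2" by auto
  have "norm (transl_diff f (X n) - 0) < r" if "n \<ge> N" for n
    using N[OF that] transl_diff_approx[OF f g(1), of "X n"] g(3) transl_diff_nonneg[of f "X n"]
    by simp
  then show "\<exists>no. \<forall>n\<ge>no. norm (transl_diff f (X n) - 0) < r" by blast
qed

text \<open>A point of an open set stays in it under small shifts, so the positive part of
  \<open>?f t - ?f (t - X n)\<close> tends to 0 pointwise and is dominated by the indicator.
  Translation invariance gives the negative part the same integral, whence the factor 2.\<close>

lemma transl_diff_open_tendsto:
  fixes U :: "'a::euclidean_space set" and X :: "nat \<Rightarrow> 'a"
  assumes U: "open U" "emeasure lborel U < \<infinity>" and X: "X \<longlonglongrightarrow> 0"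
  shows "(\<lambda>n. transl_diff (indicator U :: 'a \<Rightarrow> real) (X n)) \<longlonglongrightarrow> 0"
proof -
  let ?f = "indicator U :: 'a \<Rightarrow> real"
  have [measurable]: "U \<in> sets borel" using U by simp
  have f: "integrable lborel ?f"
    using U by (simp add: integrable_indicator_iff)
  define d where "d = (\<lambda>n t. max 0 (?f t - ?f (t - X n)))"
  have fX: "integrable lborel (\<lambda>t. ?f (t - X n))" for n
    using integrable_translate'[OF f] by simp
  have d_int: "integrable lborel (d n)" for n
    unfolding d_def using f fX by (intro integrable_max) auto
  have eq: "transl_diff ?f (X n) = 2 * (\<integral>t. d n t \<partial>lborel)" for n
  proof -
    have "transl_diff ?f (X n) = (\<integral>t. (?f (t - X n) - ?f t) + 2 * d n t \<partial>lborel)"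
      unfolding transl_diff_def d_def
      by (intro Bochner_Integration.integral_cong) (auto simp: max_def)
    also have "\<dots> = (\<integral>t. ?f (t - X n) \<partial>lborel) - (\<integral>t. ?f t \<partial>lborel) + 2 * (\<integral>t. d n t \<partial>lborel)"
      using f fX d_int by simp
    also have "(\<integral>t. ?f (t - X n) \<partial>lborel) = (\<integral>t. ?f t \<partial>lborel)"
      by (rule integral_translate') simp
    finally show ?thesis by simp
  qed
  have "(\<lambda>n. \<integral>t. d n t \<partial>lborel) \<longlonglongrightarrow> (\<integral>t. (0::real) \<partial>(lborel :: 'a measure))"
  proof (rule integral_dominated_convergence[where w = ?f])
    show "AE t in lborel. (\<lambda>n. d n t) \<longlonglongrightarrow> 0"
    proof (intro AE_I2 tendsto_eventually)
      fix t
      have "(\<lambda>n. t - X n) \<longlonglongrightarrow> t" using tendsto_diff[OF tendsto_const X, of t] by simp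
      then show "\<forall>\<^sub>F n in sequentially. d n t = 0"
      proof (cases "t \<in> U")
        case True
        then have "\<forall>\<^sub>F n in sequentially. t - X n \<in> U"
          using \<open>(\<lambda>n. t - X n) \<longlonglongrightarrow> t\<close> U(1) by (metis topological_tendstoD)
        then show ?thesis by eventually_elim (auto simp: d_def)
      qed (auto simp: d_def split: split_indicator)
    qed
    show "AE t in lborel. norm (d n t) \<le> ?f t" for n
      by (auto simp: d_def split: split_indicator)
  qed (use f d_int in \<open>auto dest: borel_measurable_integrable\<close>)
  then show ?thesis
    using tendsto_mult_left[of "\<lambda>n. \<integral>t. d n t \<partial>lborel" 0 sequentially 2] by (simp add: eq)
qed

text \<open>A density argument: outer regularity passes from open to measurable sets, and
  \<open>transl_diff_approx\<close> controls the error of an approximation uniformly in the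
  shift.\<close>

lemma transl_diff_tendsto:
  fixes f :: "'a::euclidean_space \<Rightarrow> 'b::{banach,second_countable_topology}"
  assumes "integrable lborel f" and X: "X \<longlonglongrightarrow> 0"
  shows "(\<lambda>n. transl_diff f (X n)) \<longlonglongrightarrow> 0"
  using assms(1)
proof (induction rule: integrable_induct)
  case (base A c)
  then have A [measurable]: "A \<in> sets borel" by simp
  have intA: "integrable lborel (indicator A :: 'a \<Rightarrow> real)"
    using base by (simp add: integrable_indicator_iff)
  have "(\<lambda>n. transl_diff (indicator A :: 'a \<Rightarrow> real) (X n)) \<longlonglongrightarrow> 0"
  proof (rule transl_diff_tendsto_approx[OF intA X])
    fix e :: real assume "e > 0"
    from outer_regular_lborel[OF A this] obtain U where
      U: "open U" "A \<subseteq> U" "emeasure lborel (U - A) < e" by blast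
    have [measurable]: "U \<in> sets borel" using U by simp
    have UA: "emeasure lborel (U - A) < top"
      using U(3) by (rule less_trans) (rule ennreal_less_top)
    have "emeasure lborel U = emeasure lborel (A \<union> (U - A))"
      using U(2) by (simp add: Un_absorb1)
    also have "\<dots> \<le> emeasure lborel A + emeasure lborel (U - A)"
      by (rule emeasure_subadditive) auto
    also have "\<dots> < \<infinity>" using base(2) UA by (simp add: ennreal_add_less_top)
    finally have fin: "emeasure lborel U < \<infinity>" .
    have "(\<integral>t. norm (indicator A t - indicator U t :: real) \<partial>lborel) = (\<integral>t. indicator (U - A) t \<partial>lborel)"
      using U(2) by (intro Bochner_Integration.integral_cong) (auto split: split_indicator)
    also have "\<dots> = measure lborel (U - A)" by simp
    also have "\<dots> < e"
      using U(3) UA by (simp add: emeasure_eq_ennreal_measure ennreal_less_iff)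
    finally show "\<exists>g. integrable lborel g \<and> (\<lambda>n. transl_diff g (X n)) \<longlonglongrightarrow> 0
       \<and> (\<integral>t. norm (indicator A t - g t :: real) \<partial>lborel) < e"
      using transl_diff_open_tendsto[OF U(1) fin X] fin
      by (intro exI[of _ "indicator U"]) (simp add: integrable_indicator_iff)
  qed
  moreover have "transl_diff (\<lambda>x. indicator A x *\<^sub>R c) s = norm c * transl_diff (indicator A :: 'a \<Rightarrow> real) s" for s
  proof -
    have "norm (indicator A (t - s) *\<^sub>R c - indicator A t *\<^sub>R c) = norm c * norm (indicator A (t - s) - indicator A t :: real)" for t
      by (simp flip: scaleR_diff_left)
    then show ?thesis by (simp add: transl_diff_def)
  qed
  ultimately show ?case
    using tendsto_mult_left[of "\<lambda>n. transl_diff (indicator A :: 'a \<Rightarrow> real) (X n)" 0 sequentially "norm c"] by simp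
next
  case (add f g)
  note i = integrable_translate'(1)[OF add.hyps(1)] integrable_translate'(1)[OF add.hyps(2)] add.hyps
  have "transl_diff (\<lambda>x. f x + g x) s \<le> transl_diff f s + transl_diff g s" for s
  proof -
    have "transl_diff (\<lambda>x. f x + g x) s \<le> (\<integral>t. norm (f (t - s) - f t) + norm (g (t - s) - g t) \<partial>lborel)"
      unfolding transl_diff_def using i
      by (intro integral_mono) (auto simp: add_diff_add norm_triangle_ineq)
    also have "\<dots> = transl_diff f s + transl_diff g s"
      unfolding transl_diff_def using i by (intro Bochner_Integration.integral_add) auto
    finally show ?thesis .
  qed
  then have le: "norm (transl_diff (\<lambda>x. f x + g x) s) \<le> transl_diff f s + transl_diff g s" for s
    using transl_diff_nonneg[of "\<lambda>x. f x + g x" s] by simp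
  have "(\<lambda>n. transl_diff f (X n) + transl_diff g (X n)) \<longlonglongrightarrow> 0"
    using tendsto_add[OF add.IH] by simp
  with le show ?case
    by (rule Lim_null_comparison[OF always_eventually[OF allI]])
next
  case (lim f s)
  show ?case
  proof (rule transl_diff_tendsto_approx[OF lim.hyps(4) X])
    fix e :: real assume "e > 0"
    have "(\<lambda>i. \<integral>t. norm (f t - s i t) \<partial>lborel) \<longlonglongrightarrow> (\<integral>t. (0::real) \<partial>(lborel :: 'a measure))"
    proof (rule integral_dominated_convergence[where w = "\<lambda>t. 3 * norm (f t)"])
      show "AE t in lborel. (\<lambda>i. norm (f t - s i t)) \<longlonglongrightarrow> 0"
      proof (rule AE_I2)
        fix t
        have "(\<lambda>i. norm (f t - s i t)) \<longlonglongrightarrow> norm (f t - f t)"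
          by (intro tendsto_intros lim.hyps(2)) simp
        then show "(\<lambda>i. norm (f t - s i t)) \<longlonglongrightarrow> 0" by simp
      qed
      show "AE t in lborel. norm (norm (f t - s i t)) \<le> 3 * norm (f t)" for i
      proof (rule AE_I2)
        fix t
        have "norm (f t - s i t) \<le> norm (f t) + norm (s i t)" by (rule norm_triangle_ineq4)
        then show "norm (norm (f t - s i t)) \<le> 3 * norm (f t)" using lim.hyps(3)[of t i] by simp
      qed
    qed (use lim.hyps(1,4) in \<open>auto dest: borel_measurable_integrable\<close>)
    from LIMSEQ_D[OF this, of e] \<open>e > 0\<close> obtain i where "norm (\<integral>t. norm (f t - s i t) \<partial>lborel) < e"
      by auto
    then show "\<exists>g. integrable lborel g \<and> (\<lambda>n. transl_diff g (X n)) \<longlonglongrightarrow> 0 \<and> (\<integral>t. norm (f t - g t) \<partial>lborel) < e"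
      using lim.hyps(1) lim.IH by (intro exI[of _ "s i"]) auto
  qed
qed

section \<open>Fourier transform and convolution\<close>

text \<open>Lebesgue measure on \<open>real^'n\<close> is the image of a product measure indexed by
  basis vectors. The work is to reindex from basis vectors to coordinates, which \<open>idx\<close>
  does.\<close>

lemma has_integral_prod_vec:
  fixes f :: "'n::finite \<Rightarrow> real \<Rightarrow> 'b::{real_normed_field,banach,second_countable_topology}"
  assumes f: "\<And>k. integrable lborel (f k)"
  shows "has_bochner_integral lborel (\<lambda>t::real^'n. \<Prod>k\<in>UNIV. f k (t $ k)) (\<Prod>k\<in>UNIV. integral\<^sup>L lborel (f k))"
proof -
  interpret product_sigma_finite "\<lambda>_::real^'n. lborel :: real measure" ..
  have [measurable]: "f k \<in> borel_measurable borel" for k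
    using f[of k] by (auto dest: borel_measurable_integrable)
  define idx where "idx = (\<lambda>b::real^'n. THE k. b = axis k 1)"
  have idx [simp]: "idx (axis k 1) = k" for k
    by (auto simp: idx_def axis_eq_axis)
  have B: "(Basis :: (real^'n) set) = range (\<lambda>k. axis k 1)" by (auto simp: Basis_vec_def)
  have inj: "inj (\<lambda>k::'n. axis k (1::real))" by (auto simp: inj_def axis_eq_axis)
  define \<pi> where "\<pi> = (\<lambda>x. \<Sum>b\<in>(Basis :: (real^'n) set). x b *\<^sub>R b)"
  have comp: "\<pi> x $ k = x (axis k 1)" for x k
  proof -
    have "\<pi> x = (\<Sum>j\<in>UNIV. x (axis j 1) *\<^sub>R axis j 1)"
      unfolding \<pi>_def B by (subst sum.reindex[OF inj]) simp
    then show ?thesis by (simp add: axis_def if_distrib cong: if_cong)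
  qed
  have reidx: "(\<Prod>k\<in>UNIV. g k (x (axis k 1))) = (\<Prod>b\<in>Basis. g (idx b) (x b))"
    for g :: "'n \<Rightarrow> 'c \<Rightarrow> 'd::comm_monoid_mult" and x :: "real^'n \<Rightarrow> 'c"
    unfolding B by (simp add: prod.reindex[OF inj])
  have \<pi> [measurable]: "\<pi> \<in> measurable (Pi\<^sub>M Basis (\<lambda>_. lborel)) borel"
    unfolding \<pi>_def by (intro borel_measurable_sum borel_measurable_scaleR) (auto intro!: measurable_component_singleton)
  have lb: "(lborel :: (real^'n) measure) = distr (Pi\<^sub>M Basis (\<lambda>_. lborel)) borel \<pi>"
    unfolding \<pi>_def by (rule lborel_eq)
  have P [measurable]: "(\<lambda>t::real^'n. \<Prod>k\<in>UNIV. f k (t $ k)) \<in> borel_measurable borel"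
  proof (intro borel_measurable_prod)
    fix k
    have "(\<lambda>t::real^'n. t $ k) \<in> borel_measurable borel"
      by (intro borel_measurable_continuous_onI continuous_intros)
    then show "(\<lambda>t::real^'n. f k (t $ k)) \<in> borel_measurable borel"
      by (rule measurable_compose) simp
  qed
  have e: "(\<Prod>k\<in>UNIV. f k (\<pi> x $ k)) = (\<Prod>b\<in>Basis. f (idx b) (x b))" for x
    by (simp add: comp reidx)
  have "integrable (Pi\<^sub>M Basis (\<lambda>_. lborel)) (\<lambda>x. \<Prod>b\<in>(Basis :: (real^'n) set). f (idx b) (x b))"
    using f by (intro product_integrable_prod) auto
  moreover have "(\<integral>x. (\<Prod>b\<in>(Basis :: (real^'n) set). f (idx b) (x b)) \<partial>Pi\<^sub>M Basis (\<lambda>_. lborel))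
      = (\<Prod>b\<in>(Basis :: (real^'n) set). integral\<^sup>L lborel (f (idx b)))"
    using f by (intro product_integral_prod) auto
  moreover have "(\<Prod>b\<in>(Basis :: (real^'n) set). integral\<^sup>L lborel (f (idx b))) = (\<Prod>k\<in>UNIV. integral\<^sup>L lborel (f k))"
    using reidx[of "\<lambda>k _. integral\<^sup>L lborel (f k)"] by simp
  ultimately show ?thesis
    unfolding has_bochner_integral_iff
    by (subst (1 2) lb) (simp add: integrable_distr_eq integral_distr e)
qed

lemma measurable_exp_inner [measurable]:
  "(\<lambda>t::real^'n. exp (c * complex_of_real (t \<bullet> \<gamma>))) \<in> borel_measurable borel"
  by (intro borel_measurable_continuous_onI continuous_intros)

lemma L1fun_measurable: "L1fun f \<Longrightarrow> f \<in> borel_measurable borel"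
  unfolding L1fun_def by (auto dest: borel_measurable_integrable)

lemma norm_exp_i [simp]: "cmod (exp (\<i> * complex_of_real x)) = 1" "cmod (exp (- (\<i> * complex_of_real x))) = 1"
  by (simp_all add: norm_exp_eq_Re)

lemma L1fun_mult_unimodular:
  assumes f: "L1fun f" and e: "e \<in> borel_measurable borel" "\<And>t. cmod (e t) \<le> 1"
  shows "L1fun (\<lambda>t. f t * e t)"
  unfolding L1fun_def
proof (rule Bochner_Integration.integrable_bound)
  show "integrable lborel f" using f by (simp add: L1fun_def)
  show "(\<lambda>t. f t * e t) \<in> borel_measurable lborel"
    using e(1) L1fun_measurable[OF f] by simp
  show "AE t in lborel. norm (f t * e t) \<le> norm (f t)"
    using e(2) by (simp add: norm_mult mult_left_le)
qed

lemma L1fun_fourier_integrand: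
  "L1fun f \<Longrightarrow> integrable lborel (\<lambda>t. f t * exp (- \<i> * complex_of_real (t \<bullet> \<gamma>)))"
  using L1fun_mult_unimodular[of f "\<lambda>t. exp (- \<i> * complex_of_real (t \<bullet> \<gamma>))"]
  by (simp add: L1fun_def)

lemma L1fun_0 [simp]: "L1fun (\<lambda>_. 0)"
  by (simp add: L1fun_def)

lemma L1fun_add: "L1fun f \<Longrightarrow> L1fun g \<Longrightarrow> L1fun (\<lambda>t. f t + g t)"
  by (simp add: L1fun_def)

lemma L1fun_cmult: "L1fun f \<Longrightarrow> L1fun (\<lambda>t. c * f t)"
  by (simp add: L1fun_def)

lemma L1fun_diff: "L1fun f \<Longrightarrow> L1fun g \<Longrightarrow> L1fun (\<lambda>t. f t - g t)"
  by (simp add: L1fun_def)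

lemma L1fun_sum: "(\<And>i. i \<in> I \<Longrightarrow> L1fun (f i)) \<Longrightarrow> L1fun (\<lambda>t. \<Sum>i\<in>I. f i t)"
  by (simp add: L1fun_def)

lemma L1fun_translate: "L1fun f \<Longrightarrow> L1fun (\<lambda>t. f (t + s))"
  unfolding L1fun_def by (rule integrable_translate')

lemma fourier_diff: "L1fun f \<Longrightarrow> L1fun g \<Longrightarrow> fourier (\<lambda>t. f t - g t) \<gamma> = fourier f \<gamma> - fourier g \<gamma>"
  unfolding fourier_def using L1fun_fourier_integrand[of f \<gamma>] L1fun_fourier_integrand[of g \<gamma>]
  by (simp add: left_diff_distrib)

lemma fourier_cmult: "fourier (\<lambda>t. c * f t) \<gamma> = c * fourier f \<gamma>"
  unfolding fourier_def by (simp add: mult.assoc)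

lemma fourier_sum:
  "(\<And>i. i \<in> I \<Longrightarrow> L1fun (f i)) \<Longrightarrow> fourier (\<lambda>t. \<Sum>i\<in>I. f i t) \<gamma> = (\<Sum>i\<in>I. fourier (f i) \<gamma>)"
  unfolding fourier_def using L1fun_fourier_integrand[of _ \<gamma>]
  by (simp add: sum_distrib_right)

lemma L1norm_nonneg: "0 \<le> L1norm f"
  by (simp add: L1norm_def)

lemma continuous_on_fourier:
  assumes "L1fun f"
  shows "continuous_on UNIV (fourier f)"
proof (rule continuous_at_imp_continuous_on, safe)
  fix \<gamma>
  have [measurable]: "f \<in> borel_measurable borel" using assms by (rule L1fun_measurable)
  have "(fourier f \<longlongrightarrow> fourier f \<gamma>) (at \<gamma> within UNIV)"
    unfolding tendsto_at_iff_sequentially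
  proof (intro allI impI)
    fix X assume "X \<longlonglongrightarrow> \<gamma>"
    then show "(fourier f \<circ> X) \<longlonglongrightarrow> fourier f \<gamma>"
      unfolding fourier_def o_def using assms
      by (intro integral_dominated_convergence[where w = "\<lambda>t. cmod (f t)"])
         (auto simp: L1fun_def norm_mult intro!: AE_I2 tendsto_intros)
  qed
  then show "isCont (fourier f) \<gamma>" by (simp add: isCont_def)
qed

text \<open>The dilation is normalised to keep the L1 norm; on the transform side the profile is
  stretched by \<rho> and recentred at c. Small \<rho> gives a narrow frequency window, large \<rho>
  with c = 0 an approximate identity.\<close>

definition mod_dil :: "real \<Rightarrow> real^'n \<Rightarrow> (real^'n \<Rightarrow> complex) \<Rightarrow> real^'n \<Rightarrow> complex" where
  "mod_dil \<rho> c f = (\<lambda>t. exp (\<i> * complex_of_real (t \<bullet> c)) * (complex_of_real (\<rho> ^ CARD('n)) * f (\<rho> *\<^sub>R t)))"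

lemma mod_dil:
  fixes f :: "real^'n \<Rightarrow> complex"
  assumes f: "L1fun f" and \<rho>: "\<rho> > 0"
  shows L1fun_mod_dil: "L1fun (mod_dil \<rho> c f)"
    and fourier_mod_dil: "fourier (mod_dil \<rho> c f) \<gamma> = fourier f ((\<gamma> - c) /\<^sub>R \<rho>)"
    and L1norm_mod_dil: "L1norm (mod_dil \<rho> c f) = L1norm f"
proof -
  have [measurable]: "f \<in> borel_measurable borel" using f by (rule L1fun_measurable)
  have 1: "L1fun (\<lambda>t. complex_of_real (\<rho> ^ CARD('n)) * f (\<rho> *\<^sub>R t))"
    using has_integral_dilate[of f \<rho>] f \<rho> by (simp add: L1fun_def has_bochner_integral_iff scaleR_conv_of_real)
  show "L1fun (mod_dil \<rho> c f)"
    using L1fun_mult_unimodular[OF 1, of "\<lambda>t. exp (\<i> * complex_of_real (t \<bullet> c))"]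
    by (simp add: mod_dil_def mult.commute)
  have "fourier f ((\<gamma> - c) /\<^sub>R \<rho>) = (\<integral>t. \<rho> ^ CARD('n) *\<^sub>R (f (\<rho> *\<^sub>R t) * exp (- \<i> * complex_of_real ((\<rho> *\<^sub>R t) \<bullet> ((\<gamma> - c) /\<^sub>R \<rho>)))) \<partial>lborel)"
    using has_integral_dilate[OF L1fun_fourier_integrand[OF f, of "(\<gamma> - c) /\<^sub>R \<rho>"] \<rho>]
    unfolding fourier_def has_bochner_integral_iff by (simp only: DIM_cart DIM_real mult_1_right)
  also have "\<dots> = fourier (mod_dil \<rho> c f) \<gamma>"
    unfolding fourier_def mod_dil_def
  proof (intro Bochner_Integration.integral_cong refl)
    fix t :: "real^'n"
    have "exp (- \<i> * complex_of_real ((\<rho> *\<^sub>R t) \<bullet> ((\<gamma> - c) /\<^sub>R \<rho>)))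
        = exp (\<i> * complex_of_real (t \<bullet> c)) * exp (- \<i> * complex_of_real (t \<bullet> \<gamma>))"
    proof -
      have "(\<rho> *\<^sub>R t) \<bullet> ((\<gamma> - c) /\<^sub>R \<rho>) = t \<bullet> \<gamma> - t \<bullet> c"
        using \<rho> by (simp add: inner_diff_right field_simps)
      then show ?thesis by (simp only:) (simp add: algebra_simps flip: exp_add)
    qed
    then show "\<rho> ^ CARD('n) *\<^sub>R (f (\<rho> *\<^sub>R t) * exp (- \<i> * complex_of_real ((\<rho> *\<^sub>R t) \<bullet> ((\<gamma> - c) /\<^sub>R \<rho>)))) =
        exp (\<i> * complex_of_real (t \<bullet> c)) * (complex_of_real (\<rho> ^ CARD('n)) * f (\<rho> *\<^sub>R t)) *
         exp (- \<i> * complex_of_real (t \<bullet> \<gamma>))"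
      by (simp only: scaleR_conv_of_real mult_ac)
  qed
  finally show "fourier (mod_dil \<rho> c f) \<gamma> = fourier f ((\<gamma> - c) /\<^sub>R \<rho>)" by simp
  show "L1norm (mod_dil \<rho> c f) = L1norm f"
    using has_integral_dilate[of "\<lambda>t. cmod (f t)" \<rho>] f \<rho>
    by (simp add: L1norm_def mod_dil_def norm_mult norm_power has_bochner_integral_iff L1fun_def)
qed

text \<open>The bounded factor e is later the constant 1, for approximate identities, or the
  character exp (- i s . \<gamma>), for localization near the frequency \<gamma>.\<close>

lemma conv_integrable:
  assumes f: "L1fun f" and g: "L1fun g" and e: "e \<in> borel_measurable borel" "\<And>s. cmod (e s) \<le> 1"
  shows "integrable (lborel \<Otimes>\<^sub>M lborel) (\<lambda>(s, t). f s * (g (t - s) - e s * g t))"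
    and "integrable (lborel \<Otimes>\<^sub>M lborel) (\<lambda>(s, t). f s * g (t - s))"
    and "integrable (lborel \<Otimes>\<^sub>M lborel) (\<lambda>(s, t). f s * e s * g t)"
proof -
  have [measurable]: "f \<in> borel_measurable borel" "g \<in> borel_measurable borel" "e \<in> borel_measurable borel"
    using f g e by (auto simp: L1fun_measurable)
  have f': "integrable lborel f" and g': "integrable lborel g" using f g by (simp_all add: L1fun_def)
  show 1: "integrable (lborel \<Otimes>\<^sub>M lborel) (\<lambda>(s, t). f s * g (t - s))"
  proof (rule lborel_pair.Fubini_integrable)
    have "(\<integral>t. norm (f s * g (t - s)) \<partial>lborel) = norm (f s) * L1norm g" for s
      using integral_translate'(1)[of "\<lambda>t. norm (g t)" s] by (simp add: norm_mult L1norm_def)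
    then show "integrable lborel (\<lambda>s. LINT t|lborel. norm (case (s, t) of (s, t) \<Rightarrow> f s * g (t - s)))"
      using f' by simp
  qed (use integrable_translate'(1)[OF g'] in auto)
  show 2: "integrable (lborel \<Otimes>\<^sub>M lborel) (\<lambda>(s, t). f s * e s * g t)"
  proof (rule lborel_pair.Fubini_integrable)
    have "integrable lborel (\<lambda>s. f s * e s)"
      using L1fun_mult_unimodular[OF f e] by (simp add: L1fun_def)
    then have "integrable lborel (\<lambda>s. norm (f s * e s) * L1norm g)" by simp
    moreover have "(\<integral>t. norm (f s * e s * g t) \<partial>lborel) = norm (f s * e s) * L1norm g" for s
      unfolding norm_mult[of _ "g _"] L1norm_def by simp
    ultimately show "integrable lborel (\<lambda>s. LINT t|lborel. norm (case (s, t) of (s, t) \<Rightarrow> f s * e s * g t))"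
      by simp
  qed (use g' in auto)
  show "integrable (lborel \<Otimes>\<^sub>M lborel) (\<lambda>(s, t). f s * (g (t - s) - e s * g t))"
    using Bochner_Integration.integrable_diff[OF 1 2] by (simp add: case_prod_beta' algebra_simps)
qed

lemma L1fun_conv:
  assumes "L1fun f" "L1fun g"
  shows "L1fun (conv f g)"
  using lborel_pair.integrable_snd[OF conv_integrable(2)[OF assms, of "\<lambda>_. 0"]]
  by (simp add: L1fun_def conv_def)

lemma fourier_conv:
  assumes f: "L1fun f" and g: "L1fun g"
  shows "fourier (conv f g) \<gamma> = fourier f \<gamma> * fourier g \<gamma>"
proof -
  have [measurable]: "f \<in> borel_measurable borel" "g \<in> borel_measurable borel"
    using f g by (auto simp: L1fun_measurable)
  let ?E = "\<lambda>t. exp (- \<i> * complex_of_real (t \<bullet> \<gamma>))"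
  have E: "(f s * ?E s) * (g (t - s) * ?E (t - s)) = f s * g (t - s) * ?E t" for s t
    by (simp add: inner_diff_left algebra_simps flip: exp_add)
  have L: "L1fun (\<lambda>s. f s * ?E s)" "L1fun (\<lambda>s. g s * ?E s)"
    using L1fun_fourier_integrand f g by (auto simp: L1fun_def)
  have int: "integrable (lborel \<Otimes>\<^sub>M lborel) (\<lambda>(s, t). f s * g (t - s) * ?E t)"
    using conv_integrable(2)[OF L, of "\<lambda>_. 0"] by (simp only: E) simp
  have "fourier (conv f g) \<gamma> = (\<integral>t. (\<integral>s. f s * g (t - s) * ?E t \<partial>lborel) \<partial>lborel)"
    unfolding fourier_def conv_def by simp
  also have "\<dots> = (\<integral>s. (\<integral>t. f s * g (t - s) * ?E t \<partial>lborel) \<partial>lborel)"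
    by (rule lborel_pair.Fubini_integral[OF int])
  also have "\<dots> = (\<integral>s. (f s * ?E s) * (\<integral>t. g (t - s) * ?E (t - s) \<partial>lborel) \<partial>lborel)"
    by (simp only: E[symmetric]) simp
  also have "\<dots> = (\<integral>s. (f s * ?E s) * fourier g \<gamma> \<partial>lborel)"
    unfolding fourier_def
    using integral_translate'(1)[of "\<lambda>t. g t * ?E t"] by simp
  also have "\<dots> = fourier f \<gamma> * fourier g \<gamma>"
    by (simp add: fourier_def)
  finally show ?thesis .
qed

lemma L1norm_conv_diff_le:
  assumes f: "L1fun f" and g: "L1fun g" and e: "e \<in> borel_measurable borel" "\<And>s. cmod (e s) \<le> 1"
  shows "L1norm (\<lambda>t. conv f g t - (\<integral>s. f s * e s \<partial>lborel) * g t)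
      \<le> (\<integral>s. cmod (f s) * (\<integral>t. cmod (g (t - s) - e s * g t) \<partial>lborel) \<partial>lborel)"
proof -
  note int = conv_integrable[OF assms]
  let ?F = "\<lambda>s t. f s * (g (t - s) - e s * g t)"
  have n: "integrable (lborel \<Otimes>\<^sub>M lborel) (\<lambda>(s, t). cmod (?F s t))"
    using integrable_norm[OF int(1)] by (simp only: case_prod_beta' split_def)
  have ae: "AE t in lborel. conv f g t - (\<integral>s. f s * e s \<partial>lborel) * g t = (\<integral>s. ?F s t \<partial>lborel)"
    using lborel_pair.AE_integrable_snd[OF int(2)]
  proof eventually_elim
    case (elim t)
    have "integrable lborel (\<lambda>s. f s * e s)"
      using L1fun_mult_unimodular[OF f e] by (simp add: L1fun_def)
    then have "(\<integral>s. f s * g (t - s) - f s * e s * g t \<partial>lborel) = conv f g t - (\<integral>s. f s * e s \<partial>lborel) * g t"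
      unfolding conv_def using elim by (subst Bochner_Integration.integral_diff) auto
    then show ?case by (simp add: algebra_simps)
  qed
  have "L1fun (conv f g)" by (rule L1fun_conv[OF f g])
  then have m: "(\<lambda>t. conv f g t - (\<integral>s. f s * e s \<partial>lborel) * g t) \<in> borel_measurable borel"
    using g by (auto dest!: L1fun_measurable)
  have m2: "(\<lambda>t. \<integral>s. ?F s t \<partial>lborel) \<in> borel_measurable borel"
    using lborel_pair.integrable_snd[OF int(1)] by (auto dest: borel_measurable_integrable)
  have "L1norm (\<lambda>t. conv f g t - (\<integral>s. f s * e s \<partial>lborel) * g t) = (\<integral>t. cmod (\<integral>s. ?F s t \<partial>lborel) \<partial>lborel)"
    unfolding L1norm_def using ae m m2 by (intro integral_cong_AE) auto
  also have "\<dots> \<le> (\<integral>t. (\<integral>s. cmod (?F s t) \<partial>lborel) \<partial>lborel)"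
    using lborel_pair.integrable_snd[OF int(1)] lborel_pair.integrable_snd[OF n]
    by (intro integral_mono) (auto intro: integral_norm_bound)
  also have "\<dots> = (\<integral>s. (\<integral>t. cmod (?F s t) \<partial>lborel) \<partial>lborel)"
    by (rule lborel_pair.Fubini_integral[OF n])
  also have "\<dots> = (\<integral>s. cmod (f s) * (\<integral>t. cmod (g (t - s) - e s * g t) \<partial>lborel) \<partial>lborel)"
    by (simp add: norm_mult)
  finally show ?thesis .
qed

lemma transl_diff_measurable [measurable]:
  fixes f :: "'a::euclidean_space \<Rightarrow> 'b::{banach,second_countable_topology}"
  assumes [measurable]: "f \<in> borel_measurable borel"
  shows "transl_diff f \<in> borel_measurable borel"
  unfolding transl_diff_def by measurable

lemma weighted_transl_diff_tendsto:
  fixes g :: "real^'n \<Rightarrow> complex" and f :: "real^'n \<Rightarrow> complex"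
  assumes g: "L1fun g" and f: "L1fun f" and r: "r \<longlonglongrightarrow> 0"
  shows "(\<lambda>n. \<integral>s. cmod (g s) * transl_diff f (r n *\<^sub>R s) \<partial>lborel) \<longlonglongrightarrow> 0"
proof -
  have [measurable]: "f \<in> borel_measurable borel" "g \<in> borel_measurable borel"
    using f g by (auto simp: L1fun_measurable)
  have f': "integrable lborel f" using f by (simp add: L1fun_def)
  have "(\<lambda>n. \<integral>s. cmod (g s) * transl_diff f (r n *\<^sub>R s) \<partial>lborel) \<longlonglongrightarrow> (\<integral>s. (0::real) \<partial>(lborel :: (real^'n) measure))"
  proof (rule integral_dominated_convergence[where w = "\<lambda>s. cmod (g s) * (2 * L1norm f)"])
    show "AE s in lborel. (\<lambda>n. cmod (g s) * transl_diff f (r n *\<^sub>R s)) \<longlonglongrightarrow> 0"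
    proof (rule AE_I2)
      fix s :: "real^'n"
      have "(\<lambda>n. r n *\<^sub>R s) \<longlonglongrightarrow> 0" using tendsto_scaleR[OF r tendsto_const, of s] by simp
      from tendsto_mult_left[OF transl_diff_tendsto[OF f' this], of "cmod (g s)"]
      show "(\<lambda>n. cmod (g s) * transl_diff f (r n *\<^sub>R s)) \<longlonglongrightarrow> 0" by simp
    qed
    show "AE s in lborel. norm (cmod (g s) * transl_diff f (r n *\<^sub>R s)) \<le> cmod (g s) * (2 * L1norm f)" for n
      using transl_diff_le[OF f'] transl_diff_nonneg[of f]
      by (intro AE_I2) (auto simp: norm_mult L1norm_def intro!: mult_left_mono)
    show "integrable lborel (\<lambda>s. cmod (g s) * (2 * L1norm f))"
      using g by (simp add: L1fun_def)
  qed measurable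
  then show ?thesis by simp
qed

lemma conv_approx_identity:
  fixes a f :: "real^'n \<Rightarrow> complex"
  assumes a: "L1fun a" and f: "L1fun f"
  shows "(\<lambda>n. L1norm (\<lambda>t. conv (mod_dil (real (Suc n)) 0 a) f t - (\<integral>s. a s \<partial>lborel) * f t)) \<longlonglongrightarrow> 0"
proof (rule Lim_null_comparison)
  have [measurable]: "f \<in> borel_measurable borel" "a \<in> borel_measurable borel"
    using f a by (auto simp: L1fun_measurable)
  have f': "integrable lborel f" using f by (simp add: L1fun_def)
  show "(\<lambda>n. \<integral>s. cmod (a s) * transl_diff f (inverse (real (Suc n)) *\<^sub>R s) \<partial>lborel) \<longlonglongrightarrow> 0"
    by (intro weighted_transl_diff_tendsto a f LIMSEQ_inverse_real_of_nat)
  show "\<forall>\<^sub>F n in sequentially.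
     norm (L1norm (\<lambda>t. conv (mod_dil (real (Suc n)) 0 a) f t - (\<integral>s. a s \<partial>lborel) * f t))
     \<le> (\<integral>s. cmod (a s) * transl_diff f (inverse (real (Suc n)) *\<^sub>R s) \<partial>lborel)"
  proof (intro always_eventually allI)
    fix n
    define \<rho> where "\<rho> = real (Suc n)"
    have \<rho>: "\<rho> > 0" by (simp add: \<rho>_def)
    have dil: "mod_dil \<rho> 0 a s = \<rho> ^ CARD('n) *\<^sub>R a (\<rho> *\<^sub>R s)" for s
      by (simp add: mod_dil_def scaleR_conv_of_real)
    have I: "(\<integral>s. mod_dil \<rho> 0 a s * 1 \<partial>lborel) = (\<integral>s. a s \<partial>lborel)"
      using has_integral_dilate[of a \<rho>] a \<rho> by (simp add: dil L1fun_def has_bochner_integral_iff)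
    have "integrable lborel (\<lambda>s. cmod (a s) * transl_diff f (inverse \<rho> *\<^sub>R s))"
    proof (rule Bochner_Integration.integrable_bound)
      show "integrable lborel (\<lambda>s. cmod (a s) * (2 * L1norm f))"
        using a by (simp add: L1fun_def)
      show "AE s in lborel. norm (cmod (a s) * transl_diff f (inverse \<rho> *\<^sub>R s)) \<le> norm (cmod (a s) * (2 * L1norm f))"
        using transl_diff_le[OF f'] transl_diff_nonneg[of f]
        by (intro AE_I2) (auto simp: abs_mult L1norm_def intro!: mult_left_mono)
    qed measurable
    \<comment> \<open>Rescaling s trades a concentrating kernel with fixed shifts for a fixed weight
      with shrinking shifts.\<close>
    from has_integral_dilate[OF this \<rho>]
    have J: "(\<integral>s. cmod (mod_dil \<rho> 0 a s) * transl_diff f s \<partial>lborel)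
        = (\<integral>s. cmod (a s) * transl_diff f (inverse \<rho> *\<^sub>R s) \<partial>lborel)"
      using \<rho> by (simp add: dil has_bochner_integral_iff mult.assoc)
    have "L1norm (\<lambda>t. conv (mod_dil \<rho> 0 a) f t - (\<integral>s. a s \<partial>lborel) * f t)
       \<le> (\<integral>s. cmod (mod_dil \<rho> 0 a s) * transl_diff f s \<partial>lborel)"
      using L1norm_conv_diff_le[OF L1fun_mod_dil[OF a \<rho>, of 0] f, of "\<lambda>_. 1"] unfolding I
      by (simp add: transl_diff_def)
    then show "norm (L1norm (\<lambda>t. conv (mod_dil (real (Suc n)) 0 a) f t - (\<integral>s. a s \<partial>lborel) * f t))
     \<le> (\<integral>s. cmod (a s) * transl_diff f (inverse (real (Suc n)) *\<^sub>R s) \<partial>lborel)"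
      by (simp only: \<rho>_def[symmetric] J) (simp add: L1norm_nonneg)
  qed
qed

text \<open>In a frequency window shrinking to \<open>\<gamma>\<close>, convolution with \<open>g\<close> acts almost as the scalar \<open>fourier g \<gamma>\<close>.\<close>

lemma conv_localized:
  fixes g v :: "real^'n \<Rightarrow> complex"
  assumes g: "L1fun g" and v: "L1fun v"
  shows "(\<lambda>n. L1norm (\<lambda>t. conv g (mod_dil (inverse (real (Suc n))) \<gamma> v) t
      - fourier g \<gamma> * mod_dil (inverse (real (Suc n))) \<gamma> v t)) \<longlonglongrightarrow> 0"
proof (rule Lim_null_comparison)
  have [measurable]: "g \<in> borel_measurable borel" "v \<in> borel_measurable borel"
    using g v by (auto simp: L1fun_measurable)
  show "(\<lambda>n. \<integral>s. cmod (g s) * transl_diff v (inverse (real (Suc n)) *\<^sub>R s) \<partial>lborel) \<longlonglongrightarrow> 0"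
    by (intro weighted_transl_diff_tendsto g v LIMSEQ_inverse_real_of_nat)
  show "\<forall>\<^sub>F n in sequentially. norm (L1norm (\<lambda>t. conv g (mod_dil (inverse (real (Suc n))) \<gamma> v) t
      - fourier g \<gamma> * mod_dil (inverse (real (Suc n))) \<gamma> v t))
      \<le> (\<integral>s. cmod (g s) * transl_diff v (inverse (real (Suc n)) *\<^sub>R s) \<partial>lborel)"
  proof (intro always_eventually allI)
    fix n
    define \<rho> where "\<rho> = inverse (real (Suc n))"
    have \<rho>: "\<rho> > 0" by (simp add: \<rho>_def)
    let ?V = "mod_dil \<rho> \<gamma> v" and ?e = "\<lambda>s. exp (- \<i> * complex_of_real (s \<bullet> \<gamma>))"
    have D: "(\<integral>t. cmod (?V (t - s) - ?e s * ?V t) \<partial>lborel) = transl_diff v (\<rho> *\<^sub>R s)" for s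
    proof -
      have "cmod (?V (t - s) - ?e s * ?V t) = \<rho> ^ CARD('n) *\<^sub>R cmod (v (\<rho> *\<^sub>R t - \<rho> *\<^sub>R s) - v (\<rho> *\<^sub>R t))" for t
      proof -
        have "?V (t - s) - ?e s * ?V t = exp (\<i> * complex_of_real ((t - s) \<bullet> \<gamma>)) * complex_of_real (\<rho> ^ CARD('n))
            * (v (\<rho> *\<^sub>R t - \<rho> *\<^sub>R s) - v (\<rho> *\<^sub>R t))"
        proof -
          have "exp (\<i> * complex_of_real ((t - s) \<bullet> \<gamma>)) = ?e s * exp (\<i> * complex_of_real (t \<bullet> \<gamma>))"
            by (simp add: inner_diff_left algebra_simps flip: exp_add)
          then show ?thesis
            by (simp add: mod_dil_def scaleR_diff_right right_diff_distrib mult_ac)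
        qed
        then show ?thesis using \<rho> by (simp add: norm_mult norm_power)
      qed
      moreover have "integrable lborel (\<lambda>t. cmod (v (t - \<rho> *\<^sub>R s) - v t))"
        using v integrable_translate'(1)[of v] by (auto simp: L1fun_def)
      ultimately show ?thesis
        using has_integral_dilate[of "\<lambda>t. cmod (v (t - \<rho> *\<^sub>R s) - v t)" \<rho>] \<rho>
        by (simp add: transl_diff_def has_bochner_integral_iff)
    qed
    have "L1norm (\<lambda>t. conv g ?V t - fourier g \<gamma> * ?V t) \<le> (\<integral>s. cmod (g s) * transl_diff v (\<rho> *\<^sub>R s) \<partial>lborel)"
      using L1norm_conv_diff_le[OF g L1fun_mod_dil[OF v \<rho>, of \<gamma>], of ?e] unfolding D fourier_def[symmetric]
      by (simp add: fourier_def)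
    then show "norm (L1norm (\<lambda>t. conv g (mod_dil (inverse (real (Suc n))) \<gamma> v) t
      - fourier g \<gamma> * mod_dil (inverse (real (Suc n))) \<gamma> v t))
      \<le> (\<integral>s. cmod (g s) * transl_diff v (inverse (real (Suc n)) *\<^sub>R s) \<partial>lborel)"
      by (simp only: \<rho>_def[symmetric]) (simp add: L1norm_nonneg)
  qed
qed

lemma tent_eq_0_iff: "tent x = 0 \<longleftrightarrow> 1 \<le> \<bar>x\<bar>"
  by (auto simp: tent_def)

section \<open>Injectivity of the Fourier transform and lattice kernels\<close>

lemma has_integral_tent: "has_bochner_integral lborel tent 1"
proof -
  have r: "has_bochner_integral lborel (\<lambda>x. (1 - x) * indicator {0..1} x) (1 / 2 :: real)"
  proof -
    have "has_bochner_integral lborel (\<lambda>x. (1 - x) * indicator {0..1} x) ((1 - 1\<^sup>2 / 2) - (0 - 0\<^sup>2 / 2) :: real)"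
      by (rule has_bochner_integral_FTC_Icc_nonneg) (auto intro!: derivative_eq_intros)
    then show ?thesis by simp
  qed
  have "has_bochner_integral lborel (\<lambda>x. (1 + x) * indicator {0..1} (- x)) (1 / 2 :: real)"
    using lborel_has_bochner_integral_real_affine_iff[of "-1" "\<lambda>x::real. (1 - x) * indicator {0..1} x" "1/2" 0] r
    by simp
  from has_bochner_integral_add[OF r this]
  have 1: "has_bochner_integral lborel (\<lambda>x. (1 - x) * indicator {0..1} x + (1 + x) * indicator {0..1} (- x)) (1::real)"
    by simp
  moreover have "AE x in lborel. (1 - x) * indicator {0..1} x + (1 + x) * indicator {0..1} (- x) = tent x"
    using AE_lborel_singleton[of "0::real"]
    by eventually_elim (auto simp: tent_def split: split_indicator)
  ultimately show ?thesis
    using borel_measurable_has_bochner_integral[OF 1]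
    by (subst (asm) has_bochner_integral_cong_AE) (auto simp: tent_def[abs_def])
qed

lemma prod_vec:
  fixes f :: "'n::finite \<Rightarrow> real \<Rightarrow> complex"
  assumes f: "\<And>k. integrable lborel (f k)"
  shows L1fun_prod_vec: "L1fun (\<lambda>t::real^'n. \<Prod>k\<in>UNIV. f k (t $ k))"
    and fourier_prod_vec: "fourier (\<lambda>t::real^'n. \<Prod>k\<in>UNIV. f k (t $ k)) \<gamma> =
      (\<Prod>k\<in>UNIV. \<integral>x. f k x * exp (- \<i> * complex_of_real (x * \<gamma> $ k)) \<partial>lborel)"
    and L1norm_prod_vec: "L1norm (\<lambda>t::real^'n. \<Prod>k\<in>UNIV. f k (t $ k)) = (\<Prod>k\<in>UNIV. \<integral>x. cmod (f k x) \<partial>lborel)"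
proof -
  show "L1fun (\<lambda>t::real^'n. \<Prod>k\<in>UNIV. f k (t $ k))"
    using has_integral_prod_vec[of f, OF f] by (simp add: L1fun_def has_bochner_integral_iff)
  show "L1norm (\<lambda>t::real^'n. \<Prod>k\<in>UNIV. f k (t $ k)) = (\<Prod>k\<in>UNIV. \<integral>x. cmod (f k x) \<partial>lborel)"
    using has_integral_prod_vec[of "\<lambda>k x. cmod (f k x)"] f
    by (simp add: L1norm_def prod_norm has_bochner_integral_iff)
  define g where "g = (\<lambda>k x. f k x * exp (- \<i> * complex_of_real (x * \<gamma> $ k)))"
  have g: "integrable lborel (g k)" for k
  proof (rule Bochner_Integration.integrable_bound[OF f[of k]])
    have "(\<lambda>x. exp (- \<i> * complex_of_real (x * \<gamma> $ k))) \<in> borel_measurable borel"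
      by (intro borel_measurable_continuous_onI continuous_intros)
    then show "g k \<in> borel_measurable lborel"
      unfolding g_def using borel_measurable_integrable[OF f[of k]] by simp
    show "AE x in lborel. norm (g k x) \<le> norm (f k x)"
      by (simp add: g_def norm_mult flip: of_real_mult)
  qed
  have "(\<Prod>k\<in>UNIV. f k (t $ k)) * exp (- \<i> * complex_of_real (t \<bullet> \<gamma>)) = (\<Prod>k\<in>UNIV. g k (t $ k))" for t
    by (simp add: g_def prod.distrib inner_vec_def sum_distrib_left sum_negf[symmetric] exp_sum del: sum_negf)
  then show "fourier (\<lambda>t::real^'n. \<Prod>k\<in>UNIV. f k (t $ k)) \<gamma> =
      (\<Prod>k\<in>UNIV. \<integral>x. f k x * exp (- \<i> * complex_of_real (x * \<gamma> $ k)) \<partial>lborel)"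
    using has_integral_prod_vec[of g, OF g]
    by (simp add: fourier_def has_bochner_integral_iff) (simp add: g_def)
qed

definition fejer_vec :: "real^'n \<Rightarrow> complex" where
  "fejer_vec t = (\<Prod>k\<in>UNIV. complex_of_real (fejer (t $ k)))"

lemma L1fun_fejer_vec: "L1fun fejer_vec"
  unfolding fejer_vec_def[abs_def] by (intro L1fun_prod_vec integrable_of_real integrable_fejer)

lemma fourier_fejer_vec: "fourier fejer_vec \<gamma> = (\<Prod>k\<in>UNIV. complex_of_real (tent (\<gamma> $ k)))"
  unfolding fejer_vec_def[abs_def]
  by (subst fourier_prod_vec) (use has_integral_fejer_exp in \<open>auto simp: has_bochner_integral_iff integrable_fejer\<close>)

lemma L1norm_fejer_vec: "L1norm fejer_vec = 1"
  unfolding fejer_vec_def[abs_def]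
  by (subst L1norm_prod_vec)
     (use has_integral_fejer in \<open>auto simp: has_bochner_integral_iff integrable_fejer fejer_nonneg\<close>)

lemma fourier_mult_formula:
  assumes f: "L1fun f" and g: "L1fun g"
  shows "(\<integral>t. f t * fourier g t \<partial>lborel) = (\<integral>s. fourier f s * g s \<partial>lborel)"
proof -
  let ?E = "\<lambda>t s. exp (- \<i> * complex_of_real (s \<bullet> t))"
  have [measurable]: "f \<in> borel_measurable borel" "g \<in> borel_measurable borel"
    using f g by (auto simp: L1fun_measurable)
  have "integrable (lborel \<Otimes>\<^sub>M lborel) (\<lambda>(t, s). f t * 1 * g s)"
    by (rule conv_integrable(3)[OF f g]) auto
  then have int: "integrable (lborel \<Otimes>\<^sub>M lborel) (\<lambda>(t, s). f t * (g s * ?E t s))"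
  proof (rule Bochner_Integration.integrable_bound)
    have [measurable]: "(\<lambda>p::((real^'a) \<times> (real^'a)). ?E (fst p) (snd p)) \<in> borel_measurable (lborel \<Otimes>\<^sub>M lborel)"
      unfolding lborel_prod measurable_lborel2
      by (intro borel_measurable_continuous_onI continuous_intros)
    show "(\<lambda>(t, s). f t * (g s * ?E t s)) \<in> borel_measurable (lborel \<Otimes>\<^sub>M lborel)"
      unfolding split_def by measurable
  qed (auto simp: norm_mult)
  have "(\<integral>t. f t * fourier g t \<partial>lborel) = (\<integral>t. (\<integral>s. f t * (g s * ?E t s) \<partial>lborel) \<partial>lborel)"
    unfolding fourier_def by simp
  also have "\<dots> = (\<integral>s. (\<integral>t. f t * (g s * ?E t s) \<partial>lborel) \<partial>lborel)"
    by (rule lborel_pair.Fubini_integral[OF int, symmetric])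
  also have "\<dots> = (\<integral>s. fourier f s * g s \<partial>lborel)"
  proof (intro Bochner_Integration.integral_cong refl)
    fix s
    have "(\<integral>t. f t * (g s * ?E t s) \<partial>lborel) = (\<integral>t. f t * ?E s t * g s \<partial>lborel)"
      by (simp add: mult_ac inner_commute)
    then show "(\<integral>t. f t * (g s * ?E t s) \<partial>lborel) = fourier f s * g s"
      by (simp add: fourier_def)
  qed
  finally show ?thesis .
qed

lemma conv_shift:
  fixes f g :: "real^'n \<Rightarrow> complex"
  assumes f: "L1fun f" and g: "L1fun g"
  shows "conv f g t = (\<integral>s. g s * f (t - s) \<partial>lborel)"
proof -
  have [measurable]: "f \<in> borel_measurable borel" "g \<in> borel_measurable borel"
    using f g by (auto simp: L1fun_measurable)
  have lb: "(lborel :: (real^'n) measure) = distr lborel borel (\<lambda>x. t - x)"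
    using lborel_affine[of "-1" t] by (simp add: density_1)
  have "conv f g t = (\<integral>s. f s * g (t - s) \<partial>(distr lborel borel (\<lambda>x. t - x)))"
    unfolding conv_def by (simp flip: lb)
  also have "\<dots> = (\<integral>s. f (t - s) * g (t - (t - s)) \<partial>lborel)"
    by (subst integral_distr) auto
  finally show ?thesis by (simp add: mult.commute)
qed

text \<open>If the transform of \<open>f\<close> vanishes then, by the multiplication formula, \<open>f\<close> is orthogonal to
  all tents, i.e. its convolution with a tent-shaped approximate identity vanishes.\<close>

lemma fourier_eq_0:
  fixes f :: "real^'n \<Rightarrow> complex"
  assumes f: "L1fun f" and z: "\<And>\<gamma>. fourier f \<gamma> = 0"
  shows "L1norm f = 0"
proof -
  define \<kappa> :: "real^'n \<Rightarrow> complex" where "\<kappa> = (\<lambda>t. \<Prod>k\<in>UNIV. complex_of_real (tent (t $ k)))"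
  have \<kappa>: "L1fun \<kappa>"
    unfolding \<kappa>_def using has_integral_tent
    by (intro L1fun_prod_vec integrable_of_real) (auto simp: has_bochner_integral_iff)
  have I: "(\<integral>s. \<kappa> s \<partial>lborel) = 1"
    using has_integral_prod_vec[of "\<lambda>(k::'n) x. complex_of_real (tent x)"] has_integral_tent
    by (simp add: \<kappa>_def has_bochner_integral_iff)
  have c0: "conv (mod_dil \<rho> 0 \<kappa>) f t = 0" if \<rho>: "\<rho> > 0" for \<rho> t
  proof -
    \<comment> \<open>Chosen so that its transform at s is the tent kernel evaluated at t - s: the
      modulation by t moves the centre to t, and the dilation by \<open>inverse \<rho>\<close>
      narrows the tents to width 1 / \<rho>.\<close>
    define g where "g = (\<lambda>s. complex_of_real (\<rho> ^ CARD('n)) * mod_dil (inverse \<rho>) t fejer_vec s)"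
    have g: "L1fun g"
      unfolding g_def using \<rho> by (intro L1fun_cmult L1fun_mod_dil L1fun_fejer_vec) auto
    have "fourier g s = mod_dil \<rho> 0 \<kappa> (t - s)" for s
    proof -
      have "fourier g s = complex_of_real (\<rho> ^ CARD('n)) * (\<Prod>k\<in>UNIV. complex_of_real (tent (((s - t) /\<^sub>R inverse \<rho>) $ k)))"
        unfolding g_def fourier_cmult using \<rho> by (subst fourier_mod_dil) (auto simp: L1fun_fejer_vec fourier_fejer_vec)
      moreover have "tent (((s - t) /\<^sub>R inverse \<rho>) $ k) = tent ((\<rho> *\<^sub>R (t - s)) $ k)" for k
        by (simp add: tent_def abs_mult abs_minus_commute)
      ultimately show ?thesis unfolding mod_dil_def \<kappa>_def by simp
    qed
    then have "conv (mod_dil \<rho> 0 \<kappa>) f t = (\<integral>s. f s * fourier g s \<partial>lborel)"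
      using conv_shift[OF L1fun_mod_dil[OF \<kappa> \<rho>, of 0] f] by simp
    also have "\<dots> = (\<integral>s. fourier f s * g s \<partial>lborel)"
      by (rule fourier_mult_formula[OF f g])
    finally show ?thesis by (simp add: z)
  qed
  have "(\<lambda>n::nat. L1norm (\<lambda>t. - f t)) \<longlonglongrightarrow> 0"
    using conv_approx_identity[OF \<kappa> f] by (simp add: I c0)
  then show ?thesis
    by (simp add: LIMSEQ_const_iff L1norm_def)
qed

section \<open>A partition of unity in frequency indexed by the integer lattice\<close>

definition zvec :: "('n \<Rightarrow> int) \<Rightarrow> real^'n" where
  "zvec m = (\<chi> k. real_of_int (m k))"

definition lattice_box :: "nat \<Rightarrow> ('n::finite \<Rightarrow> int) set" where
  "lattice_box N = {m. \<forall>k. \<bar>m k\<bar> \<le> int N}"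

text \<open>Its transform is the product of tents centred at m, supported in m + [-1, 1]^n.
  Modulation leaves the L1 norm equal to 1 for every m.\<close>

definition cube_kernel :: "('n \<Rightarrow> int) \<Rightarrow> real^'n \<Rightarrow> complex" where
  "cube_kernel m = mod_dil 1 (zvec m) fejer_vec"

lemma lattice_box_eq: "lattice_box N = Pi\<^sub>E UNIV (\<lambda>_. {- int N..int N})"
  unfolding lattice_box_def PiE_UNIV_domain Pi_def by (auto simp: abs_le_iff minus_le_iff)

lemma finite_lattice_box [simp]: "finite (lattice_box N)"
  unfolding lattice_box_eq by (intro finite_PiE) auto

lemma card_lattice_box: "card (lattice_box N :: ('n::finite \<Rightarrow> int) set) = (2 * N + 1) ^ CARD('n)"
  unfolding lattice_box_eq by (subst card_PiE) (auto simp: nat_add_distrib nat_mult_distrib)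

lemma lattice_box_mono: "N \<le> N' \<Longrightarrow> lattice_box N \<subseteq> lattice_box N'"
  unfolding lattice_box_def by (safe, rule order_trans[where y = "int N"]) simp_all

lemma L1fun_cube_kernel: "L1fun (cube_kernel m)"
  unfolding cube_kernel_def by (intro L1fun_mod_dil L1fun_fejer_vec) auto

lemma L1norm_cube_kernel: "L1norm (cube_kernel m) = 1"
  unfolding cube_kernel_def by (subst L1norm_mod_dil) (auto simp: L1fun_fejer_vec L1norm_fejer_vec)

lemma fourier_cube_kernel:
  "fourier (cube_kernel m) \<gamma> = (\<Prod>k\<in>UNIV. complex_of_real (tent (\<gamma> $ k - real_of_int (m k))))"
  unfolding cube_kernel_def by (subst fourier_mod_dil) (auto simp: L1fun_fejer_vec fourier_fejer_vec zvec_def)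

lemma fourier_cube_kernel_eq_0_iff:
  "fourier (cube_kernel m) \<gamma> = 0 \<longleftrightarrow> (\<exists>k. 1 \<le> \<bar>\<gamma> $ k - real_of_int (m k)\<bar>)"
  by (auto simp: fourier_cube_kernel tent_eq_0_iff)

lemma sum_tent:
  assumes "\<bar>x\<bar> \<le> real N"
  shows "(\<Sum>j\<in>{- int N..int N}. tent (x - real_of_int j)) = 1"
proof -
  define l where "l = \<lfloor>x\<rfloor>"
  have l: "real_of_int l \<le> x" "x < real_of_int l + 1" by (simp_all add: l_def)
  have z: "tent (x - real_of_int j) = 0" if "j \<noteq> l" "j \<noteq> l + 1" for j
  proof -
    have "j \<le> l - 1 \<or> j \<ge> l + 2" using that by linarith
    then have "real_of_int j \<le> real_of_int l - 1 \<or> real_of_int j \<ge> real_of_int l + 2"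
      by (metis of_int_1 of_int_add of_int_diff of_int_le_iff of_int_numeral)
    then show ?thesis using l by (auto simp: tent_eq_0_iff)
  qed
  have lr: "- int N \<le> l" "l \<le> int N"
    using assms unfolding l_def by linarith+
  show ?thesis
  \<comment> \<open>Only the floor of x and its successor can contribute. At the right end the
    successor is out of range, but there x = l and the tent at l is already 1.\<close>
  proof (cases "l = int N")
    case True
    then have x: "x = real_of_int l" using assms l by simp
    have "(\<Sum>j\<in>{- int N..int N}. tent (x - real_of_int j)) = (\<Sum>j\<in>{l}. tent (x - real_of_int j))"
      using lr True by (intro sum.mono_neutral_right) (auto intro!: z)
    then show ?thesis by (simp add: x tent_def)
  next
    case False
    have "(\<Sum>j\<in>{- int N..int N}. tent (x - real_of_int j)) = (\<Sum>j\<in>{l, l + 1}. tent (x - real_of_int j))"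
      using lr False by (intro sum.mono_neutral_right) (auto intro!: z)
    then show ?thesis using l by (simp add: tent_def)
  qed
qed

text \<open>A Dirichlet kernel times a Fejer kernel. In frequency it is a product of trapezoids, 1
  on [-N, N]^n and 0 off (-N - 1, N + 1)^n. Its norm is unbounded in N, so it is not a bounded
  approximate identity.\<close>

definition box_kernel :: "nat \<Rightarrow> real^'n \<Rightarrow> complex" where
  "box_kernel N = (\<lambda>t. \<Sum>m\<in>lattice_box N. cube_kernel m t)"

lemma L1fun_box_kernel: "L1fun (box_kernel N)"
  unfolding box_kernel_def by (intro L1fun_sum L1fun_cube_kernel)

lemma fourier_box_kernel:
  "fourier (box_kernel N) \<gamma> = (\<Sum>m\<in>lattice_box N. fourier (cube_kernel m) \<gamma>)"
  unfolding box_kernel_def by (intro fourier_sum L1fun_cube_kernel)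

lemma fourier_box_kernel_eq_1:
  fixes \<gamma> :: "real^'n"
  assumes "\<And>k. \<bar>\<gamma> $ k\<bar> \<le> real N"
  shows "fourier (box_kernel N) \<gamma> = 1"
proof -
  have "fourier (box_kernel N) \<gamma> =
      complex_of_real (\<Sum>m\<in>Pi\<^sub>E UNIV (\<lambda>_. {- int N..int N}). \<Prod>k\<in>UNIV. tent (\<gamma> $ k - real_of_int (m k)))"
    unfolding fourier_box_kernel fourier_cube_kernel lattice_box_eq by simp
  also have "(\<Sum>m\<in>Pi\<^sub>E UNIV (\<lambda>_. {- int N..int N}). \<Prod>k\<in>UNIV. tent (\<gamma> $ k - real_of_int (m k)))
      = (\<Prod>k\<in>UNIV. \<Sum>j\<in>{- int N..int N}. tent (\<gamma> $ k - real_of_int j))"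
    by (subst prod_sum_PiE) auto
  also have "\<dots> = 1" using assms by (simp add: sum_tent)
  finally show ?thesis by simp
qed

lemma fourier_box_kernel_eq_0:
  assumes "\<bar>\<gamma> $ k\<bar> \<ge> real N + 1"
  shows "fourier (box_kernel N) \<gamma> = 0"
  unfolding fourier_box_kernel
proof (intro sum.neutral ballI)
  fix m :: "'a \<Rightarrow> int" assume "m \<in> lattice_box N"
  then have "\<bar>m k\<bar> \<le> int N" by (auto simp: lattice_box_def)
  then have "\<bar>real_of_int (m k)\<bar> \<le> real N"
    by (metis of_int_abs of_int_le_iff of_int_of_nat_eq)
  then show "fourier (cube_kernel m) \<gamma> = 0"
    unfolding fourier_cube_kernel_eq_0_iff using assms by (intro exI[of _ k]) linarith
qed

lemma bounded_vec_componentwise: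
  fixes S :: "(real^'n) set"
  assumes "\<And>x k. x \<in> S \<Longrightarrow> \<bar>x $ k\<bar> \<le> C"
  shows "bounded S"
proof (rule boundedI)
  fix x assume "x \<in> S"
  have "norm x \<le> (\<Sum>k\<in>UNIV. \<bar>x $ k\<bar>)" by (rule norm_le_l1_cart)
  also have "\<dots> \<le> (\<Sum>k\<in>(UNIV :: 'n set). C)"
    using assms[OF \<open>x \<in> S\<close>] by (intro sum_mono) auto
  finally show "norm x \<le> real CARD('n) * C" by simp
qed

lemma compact_fourier_supportI:
  assumes "\<And>\<gamma> k. fourier f \<gamma> \<noteq> 0 \<Longrightarrow> \<bar>\<gamma> $ k\<bar> \<le> C"
  shows "compact_fourier_support f"
  unfolding compact_fourier_support_def compact_closure
  using assms by (intro bounded_vec_componentwise) auto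

lemma compact_fourier_supportE:
  assumes "compact_fourier_support f"
  obtains N :: nat where "\<And>\<gamma> k. fourier f \<gamma> \<noteq> 0 \<Longrightarrow> \<bar>\<gamma> $ k\<bar> \<le> real N"
proof -
  have "bounded {\<gamma>. fourier f \<gamma> \<noteq> 0}"
    using assms by (simp add: compact_fourier_support_def compact_closure)
  then obtain C where C: "\<And>\<gamma>. fourier f \<gamma> \<noteq> 0 \<Longrightarrow> norm \<gamma> \<le> C" by (auto simp: bounded_iff)
  obtain N :: nat where "C \<le> real N" using real_arch_simple by blast
  moreover have "\<bar>\<gamma> $ k\<bar> \<le> norm \<gamma>" for \<gamma> :: "real^'a" and k by (rule component_le_norm_cart)
  ultimately show ?thesis
    using C by (intro that[of N]) (meson order_trans)
qed

section \<open>Poisson kernels in several variables\<close>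

definition poisson_vec :: "real^'n \<Rightarrow> real^'n \<Rightarrow> complex" where
  "poisson_vec \<alpha> t = (\<Prod>k\<in>UNIV. complex_of_real (poisson (\<alpha> $ k) (t $ k)))"

definition poisson_vec_diff :: "real^'n \<Rightarrow> 'n \<Rightarrow> real \<Rightarrow> nat \<Rightarrow> real^'n \<Rightarrow> complex" where
  "poisson_vec_diff \<alpha> k h n t =
    (\<Prod>j\<in>UNIV. complex_of_real (poisson_diff (\<alpha> $ j) h (if j = k then n else 0) (t $ j)))"

lemma poisson_vec_diff_0: "poisson_vec_diff \<alpha> k h 0 = poisson_vec \<alpha>"
  by (simp add: poisson_vec_diff_def poisson_vec_def fun_eq_iff)

lemma poisson_vec_diff_Suc:
  "poisson_vec_diff \<alpha> k h (Suc n) t = poisson_vec_diff \<alpha> k h n (t + axis k h) - poisson_vec_diff \<alpha> k h n t"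
proof -
  define q where "q = (\<Prod>j\<in>UNIV - {k}. complex_of_real (poisson_diff (\<alpha> $ j) h 0 (t $ j)))"
  have *: "poisson_vec_diff \<alpha> k h n s = complex_of_real (poisson_diff (\<alpha> $ k) h n (s $ k)) * q"
    if "\<And>j. j \<noteq> k \<Longrightarrow> s $ j = t $ j" for s n
    unfolding poisson_vec_diff_def q_def using that
    by (subst prod.remove[of UNIV k]) (auto intro!: prod.cong)
  show ?thesis
    using *[of t "Suc n"] *[of t n] *[of "t + axis k h" n]
    by (simp add: axis_def left_diff_distrib)
qed

lemma poisson_vec_diff:
  fixes \<alpha> :: "real^'n"
  assumes "\<And>k. \<alpha> $ k > 0"
  shows L1fun_poisson_vec_diff: "L1fun (poisson_vec_diff \<alpha> k h n)"
    and L1norm_poisson_vec_diff: "L1norm (poisson_vec_diff \<alpha> k h n) \<le> fact n * (\<bar>h\<bar> / \<alpha> $ k) ^ n"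
proof -
  show "L1fun (poisson_vec_diff \<alpha> k h n)"
    unfolding poisson_vec_diff_def[abs_def]
    by (intro L1fun_prod_vec integrable_of_real integrable_poisson_diff assms)
  have "L1norm (poisson_vec_diff \<alpha> k h n) =
      (\<Prod>j\<in>UNIV. \<integral>x. \<bar>poisson_diff (\<alpha> $ j) h (if j = k then n else 0) x\<bar> \<partial>lborel)"
    unfolding poisson_vec_diff_def[abs_def]
    by (subst L1norm_prod_vec) (intro integrable_of_real integrable_poisson_diff assms, simp)
  also have "\<dots> \<le> (\<Prod>j\<in>UNIV. if j = k then fact n * (\<bar>h\<bar> / \<alpha> $ k) ^ n else 1)"
  proof (intro prod_mono conjI)
    fix j
    show "(\<integral>x. \<bar>poisson_diff (\<alpha> $ j) h (if j = k then n else 0) x\<bar> \<partial>lborel)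
       \<le> (if j = k then fact n * (\<bar>h\<bar> / \<alpha> $ k) ^ n else 1)"
      using integral_poisson_diff_le[OF assms[of j], of h "if j = k then n else 0"] by auto
  qed auto
  also have "\<dots> = fact n * (\<bar>h\<bar> / \<alpha> $ k) ^ n" by simp
  finally show "L1norm (poisson_vec_diff \<alpha> k h n) \<le> fact n * (\<bar>h\<bar> / \<alpha> $ k) ^ n" .
qed

lemma fourier_poisson_vec:
  fixes \<alpha> :: "real^'n"
  assumes "\<And>k. \<alpha> $ k > 0"
  shows "fourier (poisson_vec \<alpha>) \<gamma> = inverse (h_alpha \<alpha> \<gamma>)"
proof -
  have "fourier (poisson_vec \<alpha>) \<gamma> = (\<Prod>k\<in>UNIV. complex_of_real (exp (- \<alpha> $ k * \<bar>\<gamma> $ k\<bar>)))"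
    unfolding poisson_vec_def[abs_def]
    using has_integral_poisson_exp[OF assms] integrable_poisson[OF assms]
    by (subst fourier_prod_vec) (auto simp: has_bochner_integral_iff)
  also have "\<dots> = inverse (h_alpha \<alpha> \<gamma>)"
    by (simp add: h_alpha_def exp_sum exp_minus prod_inversef[unfolded comp_def])
  finally show ?thesis .
qed

section \<open>Modules over L1 and spectral localization\<close>

lemma scaleC_minus_one: "(-1) *\<^sub>C x = - (x :: 'a::complex_vector)"
  using scaleC_of_real[of "-1" x] by simp

lemma scaleC_zero_left [simp]: "0 *\<^sub>C x = (0 :: 'a::complex_vector)"
  using scaleC_of_real[of 0 x] by simp

locale l1_module =
  fixes M :: "'m::{complex_normed_vector,banach} set"
    and T :: "real^'n \<Rightarrow> 'm \<Rightarrow> 'm"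
    and act :: "(real^'n \<Rightarrow> complex) \<Rightarrow> 'm \<Rightarrow> 'm"
  assumes L1_module: "L1_module M T act"
begin

lemma space_axioms:
  "closed M" "0 \<in> M" "\<forall>x\<in>M. \<forall>y\<in>M. x + y \<in> M" "\<forall>c. \<forall>x\<in>M. c *\<^sub>C x \<in> M"
  "\<forall>t. \<forall>x\<in>M. T t x \<in> M" "\<forall>x\<in>M. T 0 x = x" "\<forall>s t. \<forall>x\<in>M. T (s + t) x = T s (T t x)"
  "\<forall>t. \<forall>x\<in>M. \<forall>y\<in>M. T t (x + y) = T t x + T t y" "\<forall>t c. \<forall>x\<in>M. T t (c *\<^sub>C x) = c *\<^sub>C T t x"
  "\<forall>t. \<forall>x\<in>M. norm (T t x) = norm x"
  "\<forall>x\<in>M. (\<forall>f. L1fun f \<longrightarrow> act f x = 0) \<longrightarrow> x = 0"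
  using L1_module unfolding L1_module_def by - (elim conjE; assumption)+

lemma M_closed: "closed M" and M_0: "0 \<in> M"
  and M_add: "x \<in> M \<Longrightarrow> y \<in> M \<Longrightarrow> x + y \<in> M" and M_scaleC: "x \<in> M \<Longrightarrow> c *\<^sub>C x \<in> M"
  using space_axioms(1-4) by auto

lemma T_in: "x \<in> M \<Longrightarrow> T t x \<in> M" and T_0: "x \<in> M \<Longrightarrow> T 0 x = x"
  and T_T: "x \<in> M \<Longrightarrow> T (s + t) x = T s (T t x)"
  and T_add: "x \<in> M \<Longrightarrow> y \<in> M \<Longrightarrow> T t (x + y) = T t x + T t y"
  and T_scaleC: "x \<in> M \<Longrightarrow> T t (c *\<^sub>C x) = c *\<^sub>C T t x"
  and T_norm: "x \<in> M \<Longrightarrow> norm (T t x) = norm x"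
  using space_axioms(5-10) by simp_all

lemma nondegenerate: "x \<in> M \<Longrightarrow> (\<And>f. L1fun f \<Longrightarrow> act f x = 0) \<Longrightarrow> x = 0"
  using space_axioms(11) by blast

lemma act_axioms:
  assumes "L1fun f" "L1fun g" "x \<in> M" "y \<in> M"
  shows "act f x \<in> M" "act (\<lambda>s. f s + g s) x = act f x + act g x" "act (\<lambda>s. c * f s) x = c *\<^sub>C act f x"
    "act f (x + y) = act f x + act f y" "act f (c *\<^sub>C x) = c *\<^sub>C act f x"
    "act (conv f g) x = act f (act g x)" "norm (act f x) \<le> L1norm f * norm x"
    "T t (act f x) = act (\<lambda>s. f (s + t)) x" "T t (act f x) = act f (T t x)"
proof -
  have "\<forall>f g. L1fun f \<longrightarrow> L1fun g \<longrightarrow> (\<forall>x\<in>M. \<forall>y\<in>M. \<forall>c.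
        act f x \<in> M \<and>
        act (\<lambda>s. f s + g s) x = act f x + act g x \<and>
        act (\<lambda>s. c * f s) x = c *\<^sub>C act f x \<and>
        act f (x + y) = act f x + act f y \<and>
        act f (c *\<^sub>C x) = c *\<^sub>C act f x \<and>
        act (conv f g) x = act f (act g x) \<and>
        norm (act f x) \<le> L1norm f * norm x \<and>
        (\<forall>t. T t (act f x) = act (\<lambda>s. f (s + t)) x \<and> T t (act f x) = act f (T t x)))"
    using L1_module unfolding L1_module_def by (elim conjE)
  from this[rule_format, OF assms]
  show "act f x \<in> M" "act (\<lambda>s. f s + g s) x = act f x + act g x" "act (\<lambda>s. c * f s) x = c *\<^sub>C act f x"
    "act f (x + y) = act f x + act f y" "act f (c *\<^sub>C x) = c *\<^sub>C act f x"
    "act (conv f g) x = act f (act g x)" "norm (act f x) \<le> L1norm f * norm x"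
    "T t (act f x) = act (\<lambda>s. f (s + t)) x" "T t (act f x) = act f (T t x)"
    by blast+
qed

lemma act_in: "L1fun f \<Longrightarrow> x \<in> M \<Longrightarrow> act f x \<in> M"
  and act_fun_cmult: "L1fun f \<Longrightarrow> x \<in> M \<Longrightarrow> act (\<lambda>s. c * f s) x = c *\<^sub>C act f x"
  and act_norm: "L1fun f \<Longrightarrow> x \<in> M \<Longrightarrow> norm (act f x) \<le> L1norm f * norm x"
  and T_act: "L1fun f \<Longrightarrow> x \<in> M \<Longrightarrow> T t (act f x) = act (\<lambda>s. f (s + t)) x"
  and T_act_commute: "L1fun f \<Longrightarrow> x \<in> M \<Longrightarrow> T t (act f x) = act f (T t x)"
  using act_axioms[of f f x x] by blast+

lemma act_fun_add: "L1fun f \<Longrightarrow> L1fun g \<Longrightarrow> x \<in> M \<Longrightarrow> act (\<lambda>s. f s + g s) x = act f x + act g x"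
  and act_conv: "L1fun f \<Longrightarrow> L1fun g \<Longrightarrow> x \<in> M \<Longrightarrow> act (conv f g) x = act f (act g x)"
  using act_axioms[of f g x x] by blast+

lemma act_add: "L1fun f \<Longrightarrow> x \<in> M \<Longrightarrow> y \<in> M \<Longrightarrow> act f (x + y) = act f x + act f y"
  and act_scaleC: "L1fun f \<Longrightarrow> x \<in> M \<Longrightarrow> act f (c *\<^sub>C x) = c *\<^sub>C act f x"
  using act_axioms[of f f x y] act_axioms[of f f x x] by blast+

lemma M_minus: "x \<in> M \<Longrightarrow> - x \<in> M"
  using M_scaleC[of x "-1"] by (simp add: scaleC_minus_one)

lemma M_diff: "x \<in> M \<Longrightarrow> y \<in> M \<Longrightarrow> x - y \<in> M"
  using M_add[of x "- y"] M_minus[of y] by simp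

lemma M_sum: "(\<And>i. i \<in> I \<Longrightarrow> x i \<in> M) \<Longrightarrow> (\<Sum>i\<in>I. x i) \<in> M"
  by (induction I rule: infinite_finite_induct) (auto simp: M_0 M_add)

lemma T_diff: "x \<in> M \<Longrightarrow> y \<in> M \<Longrightarrow> T t (x - y) = T t x - T t y"
  using T_add[of x "- y" t] T_scaleC[of y t "-1"] M_minus[of y] by (simp add: scaleC_minus_one)

lemma act_diff: "L1fun f \<Longrightarrow> x \<in> M \<Longrightarrow> y \<in> M \<Longrightarrow> act f (x - y) = act f x - act f y"
  using act_add[of f x "- y"] act_scaleC[of f y "-1"] M_minus[of y] by (simp add: scaleC_minus_one)

lemma act_0 [simp]: "L1fun f \<Longrightarrow> act f 0 = 0"
  using act_diff[of f 0 0] M_0 by simp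

lemma act_sum: "L1fun f \<Longrightarrow> (\<And>i. i \<in> I \<Longrightarrow> x i \<in> M) \<Longrightarrow> act f (\<Sum>i\<in>I. x i) = (\<Sum>i\<in>I. act f (x i))"
  by (induction I rule: infinite_finite_induct) (auto simp: act_add M_sum)

lemma act_fun_diff:
  assumes "L1fun f" "L1fun g" "x \<in> M"
  shows "act (\<lambda>s. f s - g s) x = act f x - act g x"
  using act_fun_add[OF assms(1) L1fun_cmult[OF assms(2), of "-1"] assms(3)]
    act_fun_cmult[OF assms(2,3), of "-1"] by (simp add: scaleC_minus_one)

lemma act_fun_sum:
  assumes "\<And>i. i \<in> I \<Longrightarrow> L1fun (f i)" "x \<in> M"
  shows "act (\<lambda>t. \<Sum>i\<in>I. f i t) x = (\<Sum>i\<in>I. act (f i) x)"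
proof -
  have z: "act (\<lambda>_. 0) x = 0"
    using act_fun_cmult[OF L1fun_0 assms(2), of 0] by simp
  show ?thesis
    using assms(1)
    by (induction I rule: infinite_finite_induct) (auto simp: z act_fun_add L1fun_sum assms(2))
qed

text \<open>Injectivity of the Fourier transform gives the difference norm 0, and the module
  inequality then kills its action. From here on, identities between actions are verified on
  transforms.\<close>

lemma act_cong:
  assumes f: "L1fun f" and g: "L1fun g" and x: "x \<in> M" and eq: "\<And>\<gamma>. fourier f \<gamma> = fourier g \<gamma>"
  shows "act f x = act g x"
proof -
  have "L1norm (\<lambda>t. f t - g t) = 0"
    by (rule fourier_eq_0) (simp_all add: L1fun_diff f g fourier_diff eq)
  then have "norm (act (\<lambda>t. f t - g t) x) \<le> 0"
    using act_norm[OF L1fun_diff[OF f g] x] by simp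
  then show ?thesis by (simp add: act_fun_diff f g x)
qed

lemma act_mult:
  assumes "L1fun f" "L1fun g" "L1fun k" "x \<in> M" "\<And>\<gamma>. fourier f \<gamma> * fourier g \<gamma> = fourier k \<gamma>"
  shows "act f (act g x) = act k x"
  unfolding act_conv[OF assms(1,2,4), symmetric]
  by (rule act_cong) (simp_all add: assms L1fun_conv fourier_conv)

lemma act_commute:
  assumes "L1fun f" "L1fun g" "x \<in> M"
  shows "act f (act g x) = act g (act f x)"
  using act_mult[OF assms(1,2) L1fun_conv[OF assms(2,1)] assms(3)] act_conv[OF assms(2,1,3)]
  by (simp add: fourier_conv assms mult.commute)

lemma act_orthogonal:
  assumes "L1fun f" "L1fun g" "x \<in> M" "\<And>\<gamma>. fourier f \<gamma> * fourier g \<gamma> = 0"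
  shows "act f (act g x) = 0"
proof -
  have "fourier (\<lambda>_. 0) \<gamma> = 0" for \<gamma> :: "real^'n" by (simp add: fourier_def)
  then have "act f (act g x) = act (\<lambda>_. 0) x"
    by (intro act_mult) (simp_all add: assms)
  also have "\<dots> = 0"
    using act_fun_cmult[OF L1fun_0 assms(3), of 0] by simp
  finally show ?thesis .
qed

lemma act_tendsto:
  assumes f: "L1fun f" and "X \<longlonglongrightarrow> x" "\<And>n. X n \<in> M" "x \<in> M"
  shows "(\<lambda>n. act f (X n)) \<longlonglongrightarrow> act f x"
proof -
  have "(\<lambda>n. L1norm f * norm (X n - x)) \<longlonglongrightarrow> L1norm f * 0"
    using assms(2) by (intro tendsto_mult_left) (simp add: tendsto_norm_zero_iff LIM_zero_iff)
  then have lim: "(\<lambda>n. L1norm f * norm (X n - x)) \<longlonglongrightarrow> 0" by simp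
  have "norm (act f (X n) - act f x) \<le> L1norm f * norm (X n - x)" for n
    using act_norm[OF f M_diff[of "X n" x]] assms by (simp add: act_diff)
  from Lim_null_comparison[OF always_eventually[OF allI[OF this]] lim]
  have "(\<lambda>n. act f (X n) - act f x) \<longlonglongrightarrow> 0" .
  then show ?thesis by (simp add: LIM_zero_iff)
qed

text \<open>Convolution with dilated Fejer kernels approximates any integrable f by functions with
  compactly supported transform, so these suffice in the non-degeneracy axiom.\<close>

lemma separation:
  assumes x: "x \<in> M" and z: "\<And>f. L1fun f \<Longrightarrow> compact_fourier_support f \<Longrightarrow> act f x = 0"
  shows "x = 0"
proof (rule nondegenerate[OF x])
  fix f :: "real^'n \<Rightarrow> complex" assume f: "L1fun f"
  define K :: "nat \<Rightarrow> real^'n \<Rightarrow> complex" where "K = (\<lambda>n. mod_dil (real (Suc n)) 0 fejer_vec)"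
  have K: "L1fun (K n)" for n
    unfolding K_def by (intro L1fun_mod_dil L1fun_fejer_vec) simp
  have I: "integral\<^sup>L lborel (fejer_vec :: real^'n \<Rightarrow> complex) = 1"
    using fourier_fejer_vec[of "0 :: real^'n"] by (simp add: fourier_def tent_def)
  have lim: "(\<lambda>n. L1norm (\<lambda>t. conv (K n) f t - f t)) \<longlonglongrightarrow> 0"
    using conv_approx_identity[OF L1fun_fejer_vec f] by (simp add: I K_def)
  have "compact_fourier_support (conv (K n) f)" for n
  proof (rule compact_fourier_supportI[where C = "real (Suc n)"])
    fix \<gamma> k assume "fourier (conv (K n) f) \<gamma> \<noteq> 0"
    then have "fourier (K n) \<gamma> \<noteq> 0" by (simp add: fourier_conv K f)
    then have "tent (\<gamma> $ k / real (Suc n)) \<noteq> 0"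
      unfolding K_def by (subst (asm) fourier_mod_dil) (auto simp: L1fun_fejer_vec fourier_fejer_vec divide_inverse mult.commute)
    then show "\<bar>\<gamma> $ k\<bar> \<le> real (Suc n)"
      by (simp add: tent_eq_0_iff divide_simps)
  qed
  then have "act (conv (K n) f) x = 0" for n
    by (intro z L1fun_conv K f)
  then have "norm (act f x) \<le> L1norm (\<lambda>t. conv (K n) f t - f t) * norm x" for n
    using act_norm[OF L1fun_diff[OF L1fun_conv[OF K f] f] x, of n] by (simp add: act_fun_diff L1fun_conv K f x)
  moreover have "(\<lambda>n. L1norm (\<lambda>t. conv (K n) f t - f t) * norm x) \<longlonglongrightarrow> 0"
    using tendsto_mult_right[OF lim, of "norm x"] by simp
  ultimately have "norm (act f x) \<le> 0"
    by (intro LIMSEQ_le_const) auto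
  then show "act f x = 0" by simp
qed

text \<open>If \<open>g x = 0\<close> and \<open>fourier g \<gamma> = c \<noteq> 0\<close>, then on elements with spectrum close to \<open>\<gamma>\<close> the
  action of \<open>g\<close> differs from the scalar \<open>c\<close> by less than \<open>|c|\<close> in norm, and is therefore injective.\<close>

lemma act_vanish_local:
  assumes x: "x \<in> M" and \<gamma>: "\<gamma> \<notin> beurling_spectrum act x"
  obtains \<epsilon> where "\<epsilon> > 0" "\<And>u. L1fun u \<Longrightarrow> (\<And>\<mu> k. fourier u \<mu> \<noteq> 0 \<Longrightarrow> \<bar>\<mu> $ k - \<gamma> $ k\<bar> \<le> \<epsilon>) \<Longrightarrow> act u x = 0"
proof -
  from \<gamma> obtain g where g: "L1fun g" "act g x = 0" "fourier g \<gamma> \<noteq> 0"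
    by (auto simp: beurling_spectrum_def)
  \<comment> \<open>In frequency \<open>?V n\<close> is 1 on the cube of half-width 1 / (n + 1)
    about \<gamma>, so it acts as the identity on elements obtained from kernels living
    there.\<close>
  let ?V = "\<lambda>n. mod_dil (inverse (real (Suc n))) \<gamma> (box_kernel 1)"
  let ?q = "\<lambda>n t. conv g (?V n) t - fourier g \<gamma> * ?V n t"
  have "(\<lambda>n. L1norm (?q n)) \<longlonglongrightarrow> 0"
    by (rule conv_localized[OF g(1) L1fun_box_kernel])
  from LIMSEQ_D[OF this, of "cmod (fourier g \<gamma>)"] g(3) obtain n where
    n: "L1norm (?q n) < cmod (fourier g \<gamma>)" by (auto simp: L1norm_nonneg)
  define \<epsilon> where "\<epsilon> = inverse (real (Suc n))"
  define V where "V = mod_dil \<epsilon> \<gamma> (box_kernel 1)"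
  define q where "q = (\<lambda>t. conv g V t - fourier g \<gamma> * V t)"
  have \<epsilon>: "\<epsilon> > 0" by (simp add: \<epsilon>_def)
  have V: "L1fun V" unfolding V_def by (intro L1fun_mod_dil L1fun_box_kernel \<epsilon>)
  have V1: "fourier V \<mu> = 1" if "\<And>k. \<bar>\<mu> $ k - \<gamma> $ k\<bar> \<le> \<epsilon>" for \<mu>
    unfolding V_def using \<epsilon> that
    by (subst fourier_mod_dil[OF L1fun_box_kernel \<epsilon>], intro fourier_box_kernel_eq_1) (simp add: abs_mult field_simps)
  have q: "L1fun q" unfolding q_def by (intro L1fun_diff L1fun_conv L1fun_cmult g(1) V)
  have nq: "L1norm q < cmod (fourier g \<gamma>)" using n by (simp add: q_def V_def \<epsilon>_def)
  show ?thesis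
  proof (rule that[OF \<epsilon>])
    fix u assume u: "L1fun u" and supp: "\<And>\<mu> k. fourier u \<mu> \<noteq> 0 \<Longrightarrow> \<bar>\<mu> $ k - \<gamma> $ k\<bar> \<le> \<epsilon>"
    define y where "y = act u x"
    have y: "y \<in> M" by (simp add: y_def act_in u x)
    have Vy: "act V y = y"
      unfolding y_def
    proof (rule act_mult[OF V u u x])
      fix \<mu> show "fourier V \<mu> * fourier u \<mu> = fourier u \<mu>"
        using V1[of \<mu>] supp[of \<mu>] by (cases "fourier u \<mu> = 0") auto
    qed
    have "act g y = 0"
      unfolding y_def by (simp add: act_commute[OF g(1) u x] g(2) u)
    then have "act q y = - (fourier g \<gamma> *\<^sub>C y)"
      unfolding q_def using y V g(1)
      by (simp add: act_fun_diff L1fun_conv L1fun_cmult act_fun_cmult act_conv Vy)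
    then have "cmod (fourier g \<gamma>) * norm y \<le> L1norm q * norm y"
      using act_norm[OF q y] by (simp add: norm_scaleC)
    with nq have "norm y = 0" by (metis mult_right_le_imp_le norm_ge_zero not_le order_le_less)
    then show "act u x = 0" by (simp add: y_def)
  qed
qed

text \<open>The local vanishing near each point off the spectrum is patched together by compactness:
  f is cut by a fine lattice partition of unity into finitely many pieces, each of which lives where
  one local statement applies.\<close>

lemma act_vanish:
  assumes x: "x \<in> M" and f: "L1fun f" "compact_fourier_support f"
    and U: "open U" "beurling_spectrum act x \<subseteq> U" "\<And>\<gamma>. \<gamma> \<in> U \<Longrightarrow> fourier f \<gamma> = 0"
  shows "act f x = 0"
proof -
  define C where "C = closure {\<gamma>. fourier f \<gamma> \<noteq> 0}"
  have C: "compact C" using f(2) by (simp add: C_def compact_fourier_support_def)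
  have "U \<inter> {\<gamma>. fourier f \<gamma> \<noteq> 0} = {}" using U(3) by auto
  then have "U \<inter> C = {}" unfolding C_def using open_Int_closure_eq_empty[OF U(1)] by blast
  then have CS: "\<gamma> \<notin> beurling_spectrum act x" if "\<gamma> \<in> C" for \<gamma>
    using U(2) that by blast
  have "\<exists>\<epsilon>>0. \<forall>u. L1fun u \<longrightarrow> (\<forall>\<mu> k. fourier u \<mu> \<noteq> 0 \<longrightarrow> \<bar>\<mu> $ k - \<gamma> $ k\<bar> \<le> \<epsilon>) \<longrightarrow> act u x = 0" if "\<gamma> \<in> C" for \<gamma>
    using act_vanish_local[OF x CS[OF that]] by metis
  then obtain \<epsilon> where \<epsilon>: "\<And>\<gamma>. \<gamma> \<in> C \<Longrightarrow> \<epsilon> \<gamma> > 0"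
    "\<And>\<gamma> u. \<gamma> \<in> C \<Longrightarrow> L1fun u \<Longrightarrow> (\<And>\<mu> k. fourier u \<mu> \<noteq> 0 \<Longrightarrow> \<bar>\<mu> $ k - \<gamma> $ k\<bar> \<le> \<epsilon> \<gamma>) \<Longrightarrow> act u x = 0"
    by metis
  \<comment> \<open>A Lebesgue number of the cover: one radius that works about every point of
    C.\<close>
  obtain e where e: "e > 0" "\<forall>\<gamma>\<in>C. \<exists>G\<in>(\<lambda>\<gamma>. ball \<gamma> (\<epsilon> \<gamma>)) ` C. ball \<gamma> e \<subseteq> G"
  proof (rule Heine_Borel_lemma[OF C, of "(\<lambda>\<gamma>. ball \<gamma> (\<epsilon> \<gamma>)) ` C"])
    show "C \<subseteq> \<Union> ((\<lambda>\<gamma>. ball \<gamma> (\<epsilon> \<gamma>)) ` C)" using \<epsilon>(1) by force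
  qed auto
  have vanish: "act u x = 0" if "L1fun u" "\<gamma> \<in> C" "\<And>\<mu>. fourier u \<mu> \<noteq> 0 \<Longrightarrow> dist \<gamma> \<mu> < e" for u \<gamma>
  proof -
    from e(2) that(2) obtain \<gamma>' where \<gamma>': "\<gamma>' \<in> C" "ball \<gamma> e \<subseteq> ball \<gamma>' (\<epsilon> \<gamma>')" by blast
    show ?thesis
    proof (rule \<epsilon>(2)[OF \<gamma>'(1) that(1)])
      fix \<mu> k assume "fourier u \<mu> \<noteq> 0"
      then have "\<mu> \<in> ball \<gamma>' (\<epsilon> \<gamma>')" using that(3) \<gamma>'(2) by (meson mem_ball subsetD)
      then have "norm (\<mu> - \<gamma>') < \<epsilon> \<gamma>'" by (simp add: dist_norm norm_minus_commute)
      then show "\<bar>\<mu> $ k - \<gamma>' $ k\<bar> \<le> \<epsilon> \<gamma>'"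
        using component_le_norm_cart[of "\<mu> - \<gamma>'" k] by simp
    qed
  qed
  \<comment> \<open>Two points of one rescaled cube differ by at most 2 \<delta> in each coordinate,
    hence by at most e / 2 in the l1 norm.\<close>
  define \<delta> where "\<delta> = e / (4 * real CARD('n))"
  have \<delta>: "\<delta> > 0" using e(1) by (simp add: \<delta>_def)
  obtain N0 where N0: "\<And>\<gamma> k. fourier f \<gamma> \<noteq> 0 \<Longrightarrow> \<bar>\<gamma> $ k\<bar> \<le> real N0"
    using compact_fourier_supportE[OF f(2)] by blast
  obtain N :: nat where N: "real N0 / \<delta> \<le> real N" using real_arch_simple by blast
  define u where "u = (\<lambda>m. mod_dil \<delta> 0 (cube_kernel m) :: real^'n \<Rightarrow> complex)"
  have u: "L1fun (u m)" for m unfolding u_def by (intro L1fun_mod_dil L1fun_cube_kernel \<delta>)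
  have fu: "fourier (u m) \<gamma> = fourier (cube_kernel m) (\<gamma> /\<^sub>R \<delta>)" for m \<gamma>
    unfolding u_def by (subst fourier_mod_dil) (auto simp: L1fun_cube_kernel \<delta>)
  have "act f x = act (\<lambda>t. \<Sum>m\<in>lattice_box N. conv (u m) f t) x"
  proof (rule act_cong[OF f(1) _ x])
    show "L1fun (\<lambda>t. \<Sum>m\<in>lattice_box N. conv (u m) f t)"
      by (intro L1fun_sum L1fun_conv u f(1))
    fix \<gamma>
    have "fourier (\<lambda>t. \<Sum>m\<in>lattice_box N. conv (u m) f t) \<gamma> = fourier (box_kernel N) (\<gamma> /\<^sub>R \<delta>) * fourier f \<gamma>"
      by (simp add: fourier_sum L1fun_conv u f(1) fourier_conv fu fourier_box_kernel sum_distrib_right)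
    also have "\<dots> = fourier f \<gamma>"
    proof (cases "fourier f \<gamma> = 0")
      case False
      have "\<bar>(\<gamma> /\<^sub>R \<delta>) $ k\<bar> \<le> real N" for k
      proof -
        have "\<bar>(\<gamma> /\<^sub>R \<delta>) $ k\<bar> = \<bar>\<gamma> $ k\<bar> / \<delta>" using \<delta> by (simp add: abs_mult divide_inverse mult.commute)
        also have "\<dots> \<le> real N0 / \<delta>" using N0[OF False] \<delta> by (intro divide_right_mono) auto
        finally show ?thesis using N by simp
      qed
      then show ?thesis by (simp add: fourier_box_kernel_eq_1)
    qed simp
    finally show "fourier f \<gamma> = fourier (\<lambda>t. \<Sum>m\<in>lattice_box N. conv (u m) f t) \<gamma>" by simp
  qed
  also have "\<dots> = (\<Sum>m\<in>lattice_box N. act (conv (u m) f) x)"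
    by (intro act_fun_sum L1fun_conv u f(1) x)
  also have "\<dots> = 0"
  proof (intro sum.neutral ballI)
    fix m :: "'n \<Rightarrow> int"
    show "act (conv (u m) f) x = 0"
    proof (cases "\<exists>\<gamma>. fourier (u m) \<gamma> * fourier f \<gamma> \<noteq> 0")
      case True
      then obtain \<gamma> where \<gamma>: "fourier (u m) \<gamma> \<noteq> 0" "fourier f \<gamma> \<noteq> 0" by auto
      show ?thesis
      proof (rule vanish[OF L1fun_conv[OF u f(1)], of \<gamma>])
        show "\<gamma> \<in> C" using \<gamma>(2) by (auto simp: C_def intro: closure_subset[THEN subsetD])
        fix \<mu> assume "fourier (conv (u m) f) \<mu> \<noteq> 0"
        then have \<mu>: "fourier (u m) \<mu> \<noteq> 0" by (simp add: fourier_conv u f(1))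
        have "\<bar>\<gamma> $ k - \<mu> $ k\<bar> \<le> 2 * \<delta>" for k
        proof -
          have "\<bar>(\<gamma> /\<^sub>R \<delta>) $ k - real_of_int (m k)\<bar> < 1" "\<bar>(\<mu> /\<^sub>R \<delta>) $ k - real_of_int (m k)\<bar> < 1"
            using \<gamma>(1) \<mu> by (auto simp: fu fourier_cube_kernel_eq_0_iff not_le)
          then have "\<bar>(\<gamma> $ k - \<mu> $ k) / \<delta>\<bar> \<le> 2"
            by (simp add: divide_inverse mult.commute right_diff_distrib)
          then show ?thesis using \<delta> by (simp add: abs_divide divide_simps mult.commute)
        qed
        then have "(\<Sum>k\<in>UNIV. \<bar>(\<gamma> - \<mu>) $ k\<bar>) \<le> (\<Sum>k\<in>(UNIV::'n set). 2 * \<delta>)"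
          by (intro sum_mono) simp
        also have "\<dots> < e" using e(1) by (simp add: \<delta>_def)
        finally show "dist \<gamma> \<mu> < e"
          using norm_le_l1_cart[of "\<gamma> - \<mu>"] by (simp add: dist_norm)
      qed
    next
      case False
      then show ?thesis
        by (subst act_conv[OF u f(1) x], intro act_orthogonal u f(1) x) simp
    qed
  qed
  finally show ?thesis .
qed

text \<open>For f with compactly supported transform, f - f * \<phi> has a compactly supported
  transform that vanishes near the spectrum, so it annihilates x. Thus every such f sees x and
  \<phi> x as equal, and \<open>separation\<close> concludes.\<close>

lemma act_spectral_unit:
  assumes x: "x \<in> M" and \<phi>: "L1fun \<phi>"
    and U: "open U" "beurling_spectrum act x \<subseteq> U" "\<And>\<gamma>. \<gamma> \<in> U \<Longrightarrow> fourier \<phi> \<gamma> = 1"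
  shows "act \<phi> x = x"
proof -
  have "x - act \<phi> x = 0"
  proof (rule separation)
    show "x - act \<phi> x \<in> M" by (intro M_diff act_in x \<phi>)
    fix f :: "real^'n \<Rightarrow> complex" assume f: "L1fun f" "compact_fourier_support f"
    obtain N where N: "\<And>\<gamma> k. fourier f \<gamma> \<noteq> 0 \<Longrightarrow> \<bar>\<gamma> $ k\<bar> \<le> real N"
      using compact_fourier_supportE[OF f(2)] by blast
    let ?g = "\<lambda>t. f t - conv f \<phi> t"
    have F: "fourier ?g \<gamma> = fourier f \<gamma> * (1 - fourier \<phi> \<gamma>)" for \<gamma>
      by (simp add: fourier_diff f(1) L1fun_conv \<phi> fourier_conv right_diff_distrib)
    have "act ?g x = 0"
    proof (rule act_vanish[OF x _ _ U(1,2)])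
      show "compact_fourier_support ?g"
        by (rule compact_fourier_supportI[where C = "real N"]) (auto simp: F intro: N)
    qed (auto simp: F U(3) L1fun_diff f(1) L1fun_conv \<phi>)
    then show "act f (x - act \<phi> x) = 0"
      by (simp add: act_fun_diff act_diff act_in act_conv L1fun_conv f(1) \<phi> x)
  qed
  then show ?thesis by simp
qed

text \<open>On the graph the Poisson kernel undoes the weight exactly, and its action is bounded, so
  the relation between the two components survives the closure.\<close>

lemma fc_domain_poisson:
  assumes \<alpha>: "\<And>k. \<alpha> $ k > 0" and A: "A \<in> fc_domain M act (h_alpha \<alpha>)"
  obtains y where "y \<in> M" "A = act (poisson_vec \<alpha>) y"
proof -
  have P: "L1fun (poisson_vec \<alpha>)"
    using L1fun_poisson_vec_diff[OF \<alpha>, where n = 0] by (simp add: poisson_vec_diff_0)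
  from A obtain y where "(A, y) \<in> closure (fc_graph M act (h_alpha \<alpha>))"
    by (auto simp: fc_domain_def split: if_splits)
  then obtain p where p: "\<And>n. p n \<in> fc_graph M act (h_alpha \<alpha>)" "p \<longlonglongrightarrow> (A, y)"
    by (auto simp: closure_sequential)
  have lim: "(\<lambda>n. fst (p n)) \<longlonglongrightarrow> A" "(\<lambda>n. snd (p n)) \<longlonglongrightarrow> y"
    using tendsto_fst[OF p(2)] tendsto_snd[OF p(2)] by auto
  have graph: "snd (p n) \<in> M \<and> fst (p n) = act (poisson_vec \<alpha>) (snd (p n))" for n
  proof -
    from p(1)[of n] obtain x \<phi> \<psi> U where pn: "p n = (x, act \<psi> x)" and x: "x \<in> M"
      and \<phi>: "L1fun \<phi>" and U: "open U" "beurling_spectrum act x \<subseteq> U" "\<forall>\<gamma>\<in>U. fourier \<phi> \<gamma> = 1"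
      and \<psi>: "L1fun \<psi>" "fourier \<psi> = (\<lambda>\<gamma>. h_alpha \<alpha> \<gamma> * fourier \<phi> \<gamma>)"
      unfolding fc_graph_def by blast
    have "act (poisson_vec \<alpha>) (act \<psi> x) = act \<phi> x"
      by (rule act_mult[OF P \<psi>(1) \<phi> x]) (simp add: fourier_poisson_vec[OF \<alpha>] \<psi>(2) h_alpha_def)
    also have "\<dots> = x" using U by (intro act_spectral_unit[OF x \<phi> U(1,2)]) auto
    finally show ?thesis by (simp add: pn act_in \<psi>(1) x)
  qed
  have y: "y \<in> M"
    using graph by (intro closed_sequentially[OF M_closed _ lim(2)]) blast
  have "(\<lambda>n. act (poisson_vec \<alpha>) (snd (p n))) \<longlonglongrightarrow> act (poisson_vec \<alpha>) y"
    using graph by (intro act_tendsto P lim(2) y) auto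
  moreover have "(\<lambda>n. act (poisson_vec \<alpha>) (snd (p n))) = (\<lambda>n. fst (p n))"
    using graph by simp
  ultimately have "A = act (poisson_vec \<alpha>) y"
    using lim(1) LIMSEQ_unique by metis
  with y show ?thesis using that by blast
qed

end

section \<open>Finite differences and exponential decay\<close>

text \<open>Differences are taken of sampled orbits, as sequences in j. The identity T(t)A T(t)B = 1
  then becomes one between operator sequences, to which a Leibniz rule for bilinear maps applies
  directly.\<close>

definition fdiff :: "(nat \<Rightarrow> 'a::ab_group_add) \<Rightarrow> nat \<Rightarrow> 'a" where
  "fdiff f = (\<lambda>j. f (Suc j) - f j)"

lemma fdiff_funpow_Suc: "(fdiff ^^ Suc n) f j = (fdiff ^^ n) f (Suc j) - (fdiff ^^ n) f j"
  by (simp add: fdiff_def)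

lemma fdiff_funpow_add: "(fdiff ^^ n) (\<lambda>j. f j + g j) j = (fdiff ^^ n) f j + (fdiff ^^ n) g j"
proof (induction n arbitrary: j)
  case (Suc n)
  show ?case unfolding fdiff_funpow_Suc Suc by simp
qed simp

lemma fdiff_funpow_shift: "(fdiff ^^ n) (\<lambda>j. f (Suc j)) j = (fdiff ^^ n) f (Suc j)"
proof (induction n arbitrary: j)
  case (Suc n)
  show ?case unfolding fdiff_funpow_Suc Suc ..
qed simp

lemma fdiff_const: "(fdiff ^^ Suc n) (\<lambda>_. c) j = 0"
  by (induction n arbitrary: j) (simp_all add: fdiff_def)

text \<open>The shift j + i in the second factor comes from the asymmetric rule for one difference
  of a product, f j * fdiff g j + fdiff f j * g (j + 1). It is why the bounds below are stated for
  all j.\<close>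

lemma (in bounded_bilinear) fdiff_Leibniz:
  "(fdiff ^^ n) (\<lambda>j. prod (f j) (g j)) j =
    (\<Sum>i\<le>n. real (n choose i) *\<^sub>R prod ((fdiff ^^ i) f j) ((fdiff ^^ (n - i)) g (j + i)))"
proof (induction n arbitrary: f g j)
  case (Suc n)
  define a where "a = (\<lambda>i. prod ((fdiff ^^ i) f j) ((fdiff ^^ (Suc n - i)) g (j + i)))"
  have "fdiff (\<lambda>j. prod (f j) (g j)) = (\<lambda>j. prod (fdiff f j) (g (Suc j)) + prod (f j) (fdiff g j))"
    by (simp add: fdiff_def fun_eq_iff diff_left diff_right)
  then have "(fdiff ^^ Suc n) (\<lambda>j. prod (f j) (g j)) j =
      (fdiff ^^ n) (\<lambda>j. prod (fdiff f j) (g (Suc j))) j + (fdiff ^^ n) (\<lambda>j. prod (f j) (fdiff g j)) j"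
    by (simp add: funpow_Suc_right fdiff_funpow_add del: funpow.simps)
  also have "(fdiff ^^ n) (\<lambda>j. prod (fdiff f j) (g (Suc j))) j = (\<Sum>i\<le>n. real (n choose i) *\<^sub>R a (Suc i))"
    unfolding Suc.IH a_def fdiff_funpow_shift
    by (intro sum.cong refl) (simp add: funpow_Suc_right del: funpow.simps)
  also have "(fdiff ^^ n) (\<lambda>j. prod (f j) (fdiff g j)) j = (\<Sum>i\<le>n. real (n choose i) *\<^sub>R a i)"
    unfolding Suc.IH a_def
  proof (intro sum.cong refl)
    fix i assume "i \<in> {..n}"
    then have "(fdiff ^^ (n - i)) (fdiff g) = (fdiff ^^ (Suc n - i)) g"
      by (simp add: Suc_diff_le funpow_Suc_right del: funpow.simps)
    then show "real (n choose i) *\<^sub>R prod ((fdiff ^^ i) f j) ((fdiff ^^ (n - i)) (fdiff g) (j + i)) =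
      real (n choose i) *\<^sub>R prod ((fdiff ^^ i) f j) ((fdiff ^^ (Suc n - i)) g (j + i))" by simp
  qed
  also have "(\<Sum>i\<le>n. real (n choose i) *\<^sub>R a i) = (\<Sum>i\<le>Suc n. real (n choose i) *\<^sub>R a i)"
    by simp
  also have "\<dots> = a 0 + (\<Sum>i\<le>n. real (n choose Suc i) *\<^sub>R a (Suc i))"
    by (subst sum.atMost_Suc_shift) simp
  also have "(\<Sum>i\<le>n. real (n choose i) *\<^sub>R a (Suc i)) + (a 0 + (\<Sum>i\<le>n. real (n choose Suc i) *\<^sub>R a (Suc i)))
     = a 0 + (\<Sum>i\<le>n. real (Suc n choose Suc i) *\<^sub>R a (Suc i))"
    by (simp add: sum.distrib scaleR_add_left)
  also have "\<dots> = (\<Sum>i\<le>Suc n. real (Suc n choose i) *\<^sub>R a i)"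
    by (subst sum.atMost_Suc_shift) simp
  finally show ?case unfolding a_def .
qed simp

section \<open>Factorial bounds for the inverse and the resulting exponential decay\<close>

lemma geometric_remainder:
  fixes b :: real
  shows "b * (\<Sum>i=1..n. (1 + b) ^ (n - i)) = (1 + b) ^ n - 1"
proof (induction n)
  case (Suc n)
  have "(\<Sum>i=1..Suc n. (1 + b) ^ (Suc n - i)) = (1 + b) * (\<Sum>i=1..n. (1 + b) ^ (n - i)) + 1"
    by (simp add: sum_distrib_left Suc_diff_le)
  then have "b * (\<Sum>i=1..Suc n. (1 + b) ^ (Suc n - i)) = (1 + b) * (b * (\<Sum>i=1..n. (1 + b) ^ (n - i))) + b"
    by (simp only:) (simp add: algebra_simps)
  then show ?case unfolding Suc by (simp add: algebra_simps)
qed simp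

text \<open>In the Leibniz expansion of the constant A j B j = 1 the term with the full difference
  on B is isolated by multiplying by B j from the left; the rest involves lower differences of B.
  Binomial coefficient and factorials combine to n!, and the remaining geometric sum closes the
  induction precisely because the base s = 1 + b Y satisfies b Y (s^(n-1) + ... + 1) = s^n -
  1.\<close>

lemma inverse_fdiff_bound:
  fixes A :: "nat \<Rightarrow> 'x::real_normed_vector \<Rightarrow>\<^sub>L 'y::real_normed_vector" and B :: "nat \<Rightarrow> 'y \<Rightarrow>\<^sub>L 'x"
  assumes inv: "\<And>j. A j o\<^sub>L B j = id_blinfun" "\<And>j. B j o\<^sub>L A j = id_blinfun"
    and B: "\<And>j. norm (B j) \<le> b"
    and A: "\<And>n j. norm ((fdiff ^^ n) A j) \<le> Y * fact n * r ^ n"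
    and nonneg: "0 \<le> Y" "0 \<le> r"
  shows "norm ((fdiff ^^ n) B j) \<le> b * fact n * (r * (1 + b * Y)) ^ n"
proof (induction n arbitrary: j rule: less_induct)
  case (less n)
  have b: "0 \<le> b" using B[of 0] norm_ge_zero[of "B 0"] by linarith
  show ?case
  proof (cases n)
    case 0
    then show ?thesis using B by simp
  next
    case (Suc n')
    let ?t = "\<lambda>i. real (n choose i) *\<^sub>R ((fdiff ^^ i) A j o\<^sub>L (fdiff ^^ (n - i)) B (j + i))"
    define s where "s = 1 + b * Y"
    have s: "0 \<le> s" using b nonneg by (simp add: s_def)
    have "0 = (fdiff ^^ n) (\<lambda>j. A j o\<^sub>L B j) j"
      unfolding inv Suc by (rule fdiff_const[symmetric])
    also have "\<dots> = (\<Sum>i\<le>n. ?t i)"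
      by (rule bounded_bilinear.fdiff_Leibniz[OF bounded_bilinear_blinfun_compose])
    also have "\<dots> = (A j o\<^sub>L (fdiff ^^ n) B j) + (\<Sum>i=1..n. ?t i)"
      unfolding atMost_atLeast0 by (subst sum.atLeast_Suc_atMost) simp_all
    finally have "A j o\<^sub>L (fdiff ^^ n) B j = - (\<Sum>i=1..n. ?t i)"
      by (simp add: eq_neg_iff_add_eq_0)
    then have "B j o\<^sub>L (A j o\<^sub>L (fdiff ^^ n) B j) = B j o\<^sub>L (- (\<Sum>i=1..n. ?t i))" by simp
    moreover have "B j o\<^sub>L (A j o\<^sub>L (fdiff ^^ n) B j) = (B j o\<^sub>L A j) o\<^sub>L (fdiff ^^ n) B j"
      by (rule blinfun_eqI) simp
    moreover have "id_blinfun o\<^sub>L (fdiff ^^ n) B j = (fdiff ^^ n) B j"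
      by (rule blinfun_eqI) simp
    ultimately have eq: "(fdiff ^^ n) B j = B j o\<^sub>L (- (\<Sum>i=1..n. ?t i))"
      by (simp only: inv)
    have "norm ((fdiff ^^ n) B j) \<le> norm (B j) * norm (- (\<Sum>i=1..n. ?t i))"
      by (rule order_trans[OF eq_refl[OF arg_cong[OF eq, of norm]] norm_blinfun_compose])
    also have "\<dots> \<le> b * norm (\<Sum>i=1..n. ?t i)"
      unfolding norm_minus_cancel by (intro mult_right_mono B norm_ge_zero)
    finally have "norm ((fdiff ^^ n) B j) \<le> b * norm (\<Sum>i=1..n. ?t i)" .
    also have "b * norm (\<Sum>i=1..n. ?t i) \<le> b * (\<Sum>i=1..n. Y * b * fact n * r ^ n * s ^ (n - i))"
    proof (rule mult_left_mono[OF sum_norm_le b])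
      fix i assume i: "i \<in> {1..n}"
      have "norm (?t i) \<le> real (n choose i) * (norm ((fdiff ^^ i) A j) * norm ((fdiff ^^ (n - i)) B (j + i)))"
        by (simp add: norm_blinfun_compose mult_left_mono)
      also have "\<dots> \<le> real (n choose i) * ((Y * fact i * r ^ i) * (b * fact (n - i) * (r * s) ^ (n - i)))"
        using A[of i j] less.IH[of "n - i" "j + i"] i nonneg
        by (intro mult_left_mono mult_mono) (auto simp: s_def)
      also have "\<dots> = Y * b * (real (n choose i) * fact i * fact (n - i)) * (r ^ i * r ^ (n - i)) * s ^ (n - i)"
        by (simp add: power_mult_distrib mult_ac)
      also have "real (n choose i) * fact i * fact (n - i) = fact n"
        using i by (simp add: binomial_fact)
      also have "r ^ i * r ^ (n - i) = r ^ n"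
        using i by (simp flip: power_add)
      finally show "norm (?t i) \<le> Y * b * fact n * r ^ n * s ^ (n - i)" .
    qed
    also have "(\<Sum>i=1..n. Y * b * fact n * r ^ n * s ^ (n - i)) = fact n * r ^ n * (b * Y * (\<Sum>i=1..n. s ^ (n - i)))"
      by (simp add: sum_distrib_left mult_ac)
    also have "b * Y * (\<Sum>i=1..n. s ^ (n - i)) = s ^ n - 1"
      unfolding s_def by (rule geometric_remainder)
    also have "b * (fact n * r ^ n * (s ^ n - 1)) \<le> b * (fact n * r ^ n * s ^ n)"
      using b nonneg by (intro mult_left_mono) auto
    finally show ?thesis
      using b by (simp add: s_def power_mult_distrib mult_ac mult_left_mono)
  qed
qed

lemma exp_decay_from_factorial:
  fixes x b c N :: real
  assumes x: "\<And>n. x \<le> b * fact n * (c / N) ^ n" and pos: "b \<ge> 0" "c > 0" "N > 0"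
  shows "x \<le> b * exp 1 * exp (- N / (exp 1 * c))"
proof -
  \<comment> \<open>Since n! \<le> n^n, the bound is at most b (n c / N)^n, and n \<le> N / (e c)
    makes the base at most 1 / e. Rounding down costs the factor \<open>exp 1\<close>.\<close>
  define n where "n = nat \<lfloor>N / (exp 1 * c)\<rfloor>"
  have n: "real n \<le> N / (exp 1 * c)" "N / (exp 1 * c) \<le> real n + 1"
    using pos by (simp_all add: n_def)
  have "x \<le> b * (fact n * (c / N) ^ n)" using x[of n] by (simp add: mult.assoc)
  also have "\<dots> \<le> b * (real n ^ n * (c / N) ^ n)"
    using pos fact_le_power[of n, where 'a = real] by (intro mult_left_mono mult_right_mono) auto
  also have "\<dots> = b * (real n * (c / N)) ^ n" by (simp only: power_mult_distrib)
  also have "\<dots> \<le> b * (exp (- 1)) ^ n"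
  proof (intro mult_left_mono power_mono)
    have "real n * (c / N) \<le> N / (exp 1 * c) * (c / N)"
      using n(1) pos by (intro mult_right_mono) auto
    also have "\<dots> = exp (- 1)" using pos by (simp add: exp_minus field_simps)
    finally show "real n * (c / N) \<le> exp (- 1)" .
  qed (use pos in auto)
  also have "exp (- 1) ^ n = exp (- real n)" by (simp flip: exp_of_nat_mult)
  also have "b * exp (- real n) \<le> b * exp (1 - N / (exp 1 * c))"
    using n(2) pos by (intro mult_left_mono) auto
  also have "\<dots> = b * exp 1 * exp (- N / (exp 1 * c))" by (simp add: exp_diff exp_minus divide_inverse)
  finally show ?thesis .
qed

section \<open>Decay of the components in spectral cubes\<close>

lemma transl_diff_uniformly_small:
  fixes f :: "'a::euclidean_space \<Rightarrow> 'b::{banach,second_countable_topology}"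
  assumes f: "integrable lborel f" and e: "e > 0"
  shows "\<exists>d>0. \<forall>s. norm s < d \<longrightarrow> transl_diff f s < e"
proof (rule ccontr)
  assume "\<not> ?thesis"
  then have "\<forall>n::nat. \<exists>s. norm s < inverse (real (Suc n)) \<and> \<not> transl_diff f s < e"
    by (metis inverse_positive_iff_positive of_nat_0_less_iff zero_less_Suc)
  then obtain s where s: "\<And>n::nat. norm (s n) < inverse (real (Suc n))" "\<And>n. \<not> transl_diff f (s n) < e"
    by metis
  have "s \<longlonglongrightarrow> 0"
    using s(1) by (intro Lim_null_comparison[OF _ LIMSEQ_inverse_real_of_nat] always_eventually allI) (metis less_imp_le)
  from LIMSEQ_D[OF transl_diff_tendsto[OF f this] e] s(2) transl_diff_nonneg[of f] show False
    by (metis abs_of_nonneg diff_zero le_refl real_norm_def)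
qed

lemma norm_axis: "norm (axis k c :: real^'n) = \<bar>c\<bar>"
  by (simp add: norm_eq_sqrt_inner inner_axis_axis)

context l1_module
begin

lemma fdiff_orbit:
  assumes x: "x \<in> M"
  shows "(fdiff ^^ n) (\<lambda>j. T (real j *\<^sub>R e) x) j \<in> M"
    and "T e ((fdiff ^^ n) (\<lambda>j. T (real j *\<^sub>R e) x) j) = (fdiff ^^ n) (\<lambda>j. T (real j *\<^sub>R e) x) (Suc j)"
proof -
  have "(fdiff ^^ n) (\<lambda>j. T (real j *\<^sub>R e) x) j \<in> M \<and>
     T e ((fdiff ^^ n) (\<lambda>j. T (real j *\<^sub>R e) x) j) = (fdiff ^^ n) (\<lambda>j. T (real j *\<^sub>R e) x) (Suc j)"
  proof (induction n arbitrary: j)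
    case 0
    have "e + real j *\<^sub>R e = real (Suc j) *\<^sub>R e" by (simp add: scaleR_add_left)
    then show ?case using T_T[OF x, of e "real j *\<^sub>R e"] by (simp add: T_in x)
  next
    case (Suc n)
    then show ?case unfolding fdiff_funpow_Suc by (simp add: M_diff T_diff)
  qed
  then show "(fdiff ^^ n) (\<lambda>j. T (real j *\<^sub>R e) x) j \<in> M"
    "T e ((fdiff ^^ n) (\<lambda>j. T (real j *\<^sub>R e) x) j) = (fdiff ^^ n) (\<lambda>j. T (real j *\<^sub>R e) x) (Suc j)" by auto
qed

text \<open>Translation of the element moves onto the kernel, so differencing the orbit amounts to
  differencing the Poisson kernel, whose norms are already known.\<close>

lemma fdiff_orbit_poisson:
  assumes \<alpha>: "\<And>k. \<alpha> $ k > 0" and y: "y \<in> M"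
  shows "norm ((fdiff ^^ n) (\<lambda>j. T (real j *\<^sub>R axis k h) (act (poisson_vec \<alpha>) y)) j)
    \<le> norm y * fact n * (\<bar>h\<bar> / \<alpha> $ k) ^ n"
proof -
  let ?e = "axis k h :: real^'n" and ?D = "poisson_vec_diff \<alpha> k h"
  have D: "L1fun (?D n)" for n by (rule L1fun_poisson_vec_diff[OF \<alpha>])
  have eq: "(fdiff ^^ n) (\<lambda>j. T (real j *\<^sub>R ?e) (act (poisson_vec \<alpha>) y)) j
      = act (\<lambda>t. ?D n (t + real j *\<^sub>R ?e)) y" for n j
  proof (induction n arbitrary: j)
    case 0
    show ?case using T_act[OF D[of 0] y] by (simp add: poisson_vec_diff_0)
  next
    case (Suc n)
    have "?D n (t + real (Suc j) *\<^sub>R ?e) = ?D n (t + real j *\<^sub>R ?e + ?e)" for t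
      by (simp add: scaleR_add_left add_ac)
    then show ?case
      unfolding fdiff_funpow_Suc Suc poisson_vec_diff_Suc
      using act_fun_diff[OF L1fun_translate[OF D[of n], of "real (Suc j) *\<^sub>R ?e"] L1fun_translate[OF D[of n], of "real j *\<^sub>R ?e"] y]
      by simp
  qed
  have [measurable]: "?D n \<in> borel_measurable borel" using D by (rule L1fun_measurable)
  have "L1norm (\<lambda>t. ?D n (t + real j *\<^sub>R ?e)) = L1norm (?D n)"
    unfolding L1norm_def using integral_translate'(2)[of "\<lambda>t. cmod (?D n t)" "real j *\<^sub>R ?e"] by simp
  then have "norm (act (\<lambda>t. ?D n (t + real j *\<^sub>R ?e)) y) \<le> L1norm (?D n) * norm y"
    using act_norm[OF L1fun_translate[OF D] y, of n "real j *\<^sub>R ?e"] by simp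
  also have "\<dots> \<le> fact n * (\<bar>h\<bar> / \<alpha> $ k) ^ n * norm y"
    by (intro mult_right_mono L1norm_poisson_vec_diff \<alpha>) auto
  finally show ?thesis unfolding eq by (simp add: mult_ac)
qed

text \<open>On the spectral cube around \<open>m\<close>, translation by \<open>pi / m k\<close> in direction \<open>k\<close> is close to \<open>-1\<close>,
  so the corresponding difference operator is expanding.\<close>

lemma act_cube_expanding:
  fixes m :: "'n \<Rightarrow> int"
  assumes g: "g \<in> M" and m: "m k \<noteq> 0"
    and small: "transl_diff (box_kernel 1) (- axis k (pi / real_of_int (m k)) :: real^'n) \<le> 1"
  shows "norm (act (cube_kernel m) g) \<le> norm (act (cube_kernel m) (T (axis k (pi / real_of_int (m k))) g - g))"
proof -
  define e :: "real^'n" where "e = axis k (pi / real_of_int (m k))"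
  define V where "V = mod_dil 1 (zvec m) (box_kernel 1)"
  define x where "x = act (cube_kernel m) g"
  have x: "x \<in> M" by (simp add: x_def act_in L1fun_cube_kernel g)
  have V: "L1fun V" unfolding V_def by (intro L1fun_mod_dil L1fun_box_kernel) simp
  have Vx: "act V x = x"
    unfolding x_def
  proof (rule act_mult[OF V L1fun_cube_kernel L1fun_cube_kernel g])
    fix \<gamma>
    show "fourier V \<gamma> * fourier (cube_kernel m) \<gamma> = fourier (cube_kernel m) \<gamma>"
    proof (cases "fourier (cube_kernel m) \<gamma> = 0")
      case False
      then have "\<bar>\<gamma> $ k - real_of_int (m k)\<bar> \<le> 1" for k
        by (auto simp: fourier_cube_kernel_eq_0_iff not_le less_imp_le)
      then have "fourier V \<gamma> = 1"
        unfolding V_def by (subst fourier_mod_dil[OF L1fun_box_kernel], simp, intro fourier_box_kernel_eq_1) (simp add: zvec_def)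
      then show ?thesis by simp
    qed simp
  qed
  have em: "e \<bullet> zvec m = pi"
    using m by (simp add: e_def zvec_def inner_axis')
  \<comment> \<open>Since e . m = pi, the character changes sign under the shift by e. The sum is
    therefore a modulated translation difference of \<open>box_kernel 1\<close>, which is small for
    a short step.\<close>
  have Vshift: "V (t + e) + V t = exp (\<i> * complex_of_real (t \<bullet> zvec m)) * (box_kernel 1 t - box_kernel 1 (t + e))" for t
    by (simp add: V_def mod_dil_def inner_add_left em distrib_left exp_add right_diff_distrib mult.commute[of _ pi])
  have "L1norm (\<lambda>t. V (t + e) + V t) = transl_diff (box_kernel 1) (- e)"
    unfolding L1norm_def transl_diff_def Vshift by (simp add: norm_mult norm_minus_commute)
  also have "\<dots> \<le> 1" using small by (simp add: e_def)
  finally have le: "L1norm (\<lambda>t. V (t + e) + V t) \<le> 1" .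
  have Tx: "T e x = act (\<lambda>t. V (t + e)) x"
    using T_act[OF V x, of e] by (simp add: Vx)
  \<comment> \<open>With T e x + x of norm at most that of x, writing 2 x = (T e x + x) - (T e x -
    x) leaves at least norm x for T e x - x.\<close>
  have "norm (T e x + x) = norm (act (\<lambda>t. V (t + e) + V t) x)"
    by (simp add: act_fun_add L1fun_translate V x Tx Vx)
  also have "\<dots> \<le> 1 * norm x"
    by (rule order_trans[OF act_norm[OF _ x]]) (intro L1fun_add L1fun_translate V mult_right_mono le norm_ge_zero)+
  finally have 1: "norm (T e x + x) \<le> norm x" by simp
  have "2 *\<^sub>R x = (T e x + x) - (T e x - x)" by (simp add: scaleR_2)
  then have "2 * norm x = norm ((T e x + x) - (T e x - x))"
    by (metis abs_numeral norm_scaleR)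
  also have "\<dots> \<le> norm (T e x + x) + norm (T e x - x)" by (rule norm_triangle_ineq4)
  finally have "norm x \<le> norm (T e x - x)" using 1 by simp
  also have "T e x - x = act (cube_kernel m) (T e g - g)"
    using T_act_commute[OF L1fun_cube_kernel g, of e m]
    by (simp add: x_def act_diff L1fun_cube_kernel T_in g)
  finally show ?thesis by (simp add: x_def e_def)
qed

lemma act_cube_fdiff:
  fixes m :: "'n \<Rightarrow> int"
  assumes x: "x \<in> M" and m: "m k \<noteq> 0"
    and small: "transl_diff (box_kernel 1) (- axis k (pi / real_of_int (m k)) :: real^'n) \<le> 1"
  shows "norm (act (cube_kernel m) x) \<le> norm ((fdiff ^^ n) (\<lambda>j. T (real j *\<^sub>R axis k (pi / real_of_int (m k))) x) 0)"
proof -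
  let ?D = "\<lambda>n. (fdiff ^^ n) (\<lambda>j. T (real j *\<^sub>R axis k (pi / real_of_int (m k))) x) 0"
  have D: "?D n \<in> M" for n by (rule fdiff_orbit[OF x])
  have "norm (act (cube_kernel m) x) \<le> norm (act (cube_kernel m) (?D n))"
  proof (induction n)
    case 0
    then show ?case by (simp add: T_0 x)
  next
    case (Suc n)
    also have "norm (act (cube_kernel m) (?D n)) \<le> norm (act (cube_kernel m) (T (axis k (pi / real_of_int (m k))) (?D n) - ?D n))"
      using D m small by (rule act_cube_expanding)
    also have "T (axis k (pi / real_of_int (m k))) (?D n) - ?D n = ?D (Suc n)"
      unfolding fdiff_orbit(2)[OF x] fdiff_funpow_Suc ..
    finally show ?case .
  qed
  also have "\<dots> \<le> norm (?D n)"
    using act_norm[OF L1fun_cube_kernel D, of m] by (simp add: L1norm_cube_kernel)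
  finally show ?thesis .
qed

lemma act_cube_exp_decay:
  assumes x: "x \<in> M" and c: "c > 0"
    and D: "\<And>k h n. norm ((fdiff ^^ n) (\<lambda>j. T (real j *\<^sub>R axis k h) x) 0) \<le> norm x * fact n * (\<bar>h\<bar> * c) ^ n"
  obtains C \<theta> where "C \<ge> 0" "0 < \<theta>" "\<theta> < 1"
    "\<And>(m::'n \<Rightarrow> int) k. norm (act (cube_kernel m) x) \<le> C * \<theta> ^ nat \<bar>m k\<bar>"
proof -
  obtain d where d: "d > 0" "\<And>s::real^'n. norm s < d \<Longrightarrow> transl_diff (box_kernel 1) s < 1"
    using transl_diff_uniformly_small[of "box_kernel 1 :: real^'n \<Rightarrow> complex" 1] L1fun_box_kernel[of 1]
    unfolding L1fun_def by auto
  obtain N0 :: nat where N0: "pi / d < real N0" using reals_Archimedean2 by blast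
  \<comment> \<open>The step pi / |m k| makes the difference bound n! (pi c / |m k|)^n; this is the
    rate that \<open>exp_decay_from_factorial\<close> then yields.\<close>
  define \<theta> where "\<theta> = exp (- 1 / (exp 1 * (pi * c)))"
  have \<theta>: "0 < \<theta>" "\<theta> < 1" using c by (simp_all add: \<theta>_def)
  \<comment> \<open>\<open>exp 1\<close> is the loss in the decay lemma. The other summand covers |m
    k| < N0, where the step may be too long for the expansion argument and the trivial norm bound is
    used.\<close>
  define C where "C = norm x * (exp 1 + 1 / \<theta> ^ N0)"
  have C: "C \<ge> 0" using \<theta> by (simp add: C_def)
  have "norm (act (cube_kernel m) x) \<le> C * \<theta> ^ nat \<bar>m k\<bar>" for m :: "'n \<Rightarrow> int" and k
  proof (cases "N0 \<le> nat \<bar>m k\<bar>")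
    case True
    define N where "N = real (nat \<bar>m k\<bar>)"
    have N: "N = \<bar>real_of_int (m k)\<bar>" by (simp add: N_def)
    have "real N0 \<le> N" using True by (simp add: N_def)
    with N0 have dN: "pi / d < N" by simp
    then have Npos: "N > 0" using d(1) by (smt (verit) divide_pos_pos pi_gt_zero)
    then have m: "m k \<noteq> 0" using N by auto
    have "norm (- axis k (pi / real_of_int (m k)) :: real^'n) < d"
      using dN d(1) Npos by (simp add: norm_axis N[symmetric] field_simps)
    then have small: "transl_diff (box_kernel 1) (- axis k (pi / real_of_int (m k)) :: real^'n) \<le> 1"
      using d(2) by (simp add: less_imp_le)
    have "norm (act (cube_kernel m) x) \<le> norm x * fact n * (pi * c / N) ^ n" for n
      using order_trans[OF act_cube_fdiff[where m = m and k = k, OF x m small] D[of n k "pi / real_of_int (m k)"]]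
      by (simp add: N[symmetric])
    then have "norm (act (cube_kernel m) x) \<le> norm x * exp 1 * exp (- N / (exp 1 * (pi * c)))"
      using c Npos by (intro exp_decay_from_factorial) auto
    also have "exp (- N / (exp 1 * (pi * c))) = \<theta> ^ nat \<bar>m k\<bar>"
      by (simp add: \<theta>_def N_def flip: exp_of_nat_mult)
    also have "norm x * exp 1 * \<theta> ^ nat \<bar>m k\<bar> \<le> C * \<theta> ^ nat \<bar>m k\<bar>"
      using \<theta> by (intro mult_right_mono) (auto simp: C_def distrib_left)
    finally show ?thesis .
  next
    case False
    have "norm (act (cube_kernel m) x) \<le> norm x * 1"
      using act_norm[OF L1fun_cube_kernel x, of m] by (simp add: L1norm_cube_kernel)
    also have "\<dots> \<le> norm x * (1 / \<theta> ^ N0 * \<theta> ^ nat \<bar>m k\<bar>)"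
    proof (intro mult_left_mono)
      have "\<theta> ^ N0 \<le> \<theta> ^ nat \<bar>m k\<bar>" using \<theta> False by (intro power_decreasing) auto
      then show "1 \<le> 1 / \<theta> ^ N0 * \<theta> ^ nat \<bar>m k\<bar>" using \<theta> by (simp add: field_simps)
    qed simp
    also have "\<dots> = norm x * (1 / \<theta> ^ N0) * \<theta> ^ nat \<bar>m k\<bar>" by simp
    also have "\<dots> \<le> C * \<theta> ^ nat \<bar>m k\<bar>"
      unfolding C_def using \<theta> by (intro mult_right_mono mult_left_mono) auto
    finally show ?thesis .
  qed
  with C \<theta> that show ?thesis by blast
qed

end

section \<open>Membership in the domain of the functional calculus\<close>

lemma convergent_summable_increments:
  fixes a :: "nat \<Rightarrow> 'a::banach"
  assumes b: "summable b" and le: "\<And>n. norm (a (Suc n) - a n) \<le> b n"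
  shows "convergent a"
proof -
  have "summable (\<lambda>n. a (Suc n) - a n)"
    by (rule summable_comparison_test[OF _ b]) (use le in auto)
  then have "(\<lambda>n. \<Sum>i<n. a (Suc i) - a i) \<longlonglongrightarrow> (\<Sum>n. a (Suc n) - a n)"
    by (rule summable_LIMSEQ)
  then have "(\<lambda>n. a n - a 0) \<longlonglongrightarrow> (\<Sum>n. a (Suc n) - a n)"
    by (simp add: sum_lessThan_telescope)
  from tendsto_add[OF this tendsto_const[of "a 0"]] show ?thesis
    by (auto simp: convergent_def)
qed

lemma summable_poly_geometric:
  fixes r :: real
  assumes r: "0 < r" "r < 1"
  shows "summable (\<lambda>n. (2 * real n + 3) ^ d * r ^ n)"
proof -
  \<comment> \<open>Half of the geometric decay absorbs the polynomial, the other half is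
    summed.\<close>
  define s where "s = sqrt r"
  have s: "0 < s" "s < 1" and r': "r = s * s" using r by (auto simp: s_def)
  have "(\<lambda>n. (2 * real n + 3) ^ d * s ^ n) \<longlonglongrightarrow> 0"
    using s by real_asymp
  then have "Bseq (\<lambda>n. (2 * real n + 3) ^ d * s ^ n)"
    by (intro convergent_imp_Bseq) (auto simp: convergent_def)
  then obtain K where K: "K > 0" "\<And>n. norm ((2 * real n + 3) ^ d * s ^ n) \<le> K"
    by (auto elim!: BseqE)
  have "summable (\<lambda>n. K * s ^ n)" using s by (intro summable_mult summable_geometric) auto
  then show ?thesis
  proof (rule summable_comparison_test[rotated], intro exI allI impI)
    fix n
    have "norm ((2 * real n + 3) ^ d * r ^ n) = norm ((2 * real n + 3) ^ d * s ^ n) * s ^ n"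
      using s by (simp add: r' power_mult_distrib abs_mult)
    also have "\<dots> \<le> K * s ^ n" using K s by (intro mult_right_mono) auto
    finally show "norm ((2 * real n + 3) ^ d * r ^ n) \<le> K * s ^ n" .
  qed
qed

text \<open>A point of the shell between consecutive boxes has a coordinate of modulus N + 1; as
  decay is assumed in every coordinate, that one can be used. The shell has at most (2 N + 3)^n
  points, the size of the larger box.\<close>

lemma convergent_lattice_sums:
  fixes y :: "('n::finite \<Rightarrow> int) \<Rightarrow> 'a::banach"
  assumes C: "C \<ge> 0" and r: "0 < r" "r < 1" and y: "\<And>m k. norm (y m) \<le> C * r ^ nat \<bar>m k\<bar>"
  shows "convergent (\<lambda>N. \<Sum>m\<in>lattice_box N. y m)"
proof (rule convergent_summable_increments)
  show "summable (\<lambda>n. C * r * ((2 * real n + 3) ^ CARD('n) * r ^ n))"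
    by (intro summable_mult summable_poly_geometric r)
  fix N
  let ?S = "lattice_box (Suc N) - lattice_box N :: ('n \<Rightarrow> int) set"
  have sub: "lattice_box N \<subseteq> (lattice_box (Suc N) :: ('n \<Rightarrow> int) set)" by (rule lattice_box_mono) simp
  have "(\<Sum>m\<in>lattice_box (Suc N). y m) - (\<Sum>m\<in>lattice_box N. y m) = (\<Sum>m\<in>?S. y m)"
    using sum_diff[OF finite_lattice_box sub, of y] by simp
  also have "norm \<dots> \<le> (\<Sum>m\<in>?S. C * r ^ Suc N)"
  proof (rule sum_norm_le)
    fix m assume m: "m \<in> ?S"
    then obtain k where k: "\<not> \<bar>m k\<bar> \<le> int N" by (auto simp: lattice_box_def)
    have "\<bar>m k\<bar> \<le> int (Suc N)" using m by (auto simp: lattice_box_def)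
    with k have "nat \<bar>m k\<bar> = Suc N" by linarith
    with y[of m k] show "norm (y m) \<le> C * r ^ Suc N" by simp
  qed
  also have "\<dots> = real (card ?S) * (C * r ^ Suc N)" by simp
  also have "\<dots> \<le> real (card (lattice_box (Suc N) :: ('n \<Rightarrow> int) set)) * (C * r ^ Suc N)"
    using C r by (intro mult_right_mono of_nat_mono card_mono) auto
  also have "\<dots> = C * r * ((2 * real N + 3) ^ CARD('n) * r ^ N)"
    by (simp add: card_lattice_box algebra_simps)
  finally show "norm ((\<Sum>m\<in>lattice_box (Suc N). y m) - (\<Sum>m\<in>lattice_box N. y m))
     \<le> C * r * ((2 * real N + 3) ^ CARD('n) * r ^ N)" .
qed

section \<open>Dilated weights and the graph of the functional calculus\<close>

lemma h_alpha_dilate: "h_alpha \<alpha> (\<gamma> /\<^sub>R q) = h_alpha (\<alpha> /\<^sub>R q) \<gamma>" if "q > 0"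
  using that by (simp add: h_alpha_def abs_mult mult_ac)

lemma h_alpha_power: "h_alpha \<alpha> \<gamma> ^ p = h_alpha (real p *\<^sub>R \<alpha>) \<gamma>"
  by (simp add: h_alpha_def sum_distrib_left mult_ac flip: exp_of_nat_mult of_real_power)

text \<open>The test function is dilated, multiplied by h, and dilated back. This is how the
  admissibility of the weight of \<alpha> passes to that of \<alpha> / q.\<close>

lemma fc_admissible_dilate:
  fixes h :: "real^'n \<Rightarrow> complex"
  assumes h: "fc_admissible h" and q: "q > 0"
  shows "fc_admissible (\<lambda>\<gamma>. h (\<gamma> /\<^sub>R q))"
  unfolding fc_admissible_def
proof (intro allI impI, elim conjE)
  fix \<phi> :: "real^'n \<Rightarrow> complex" assume \<phi>: "L1fun \<phi>" "compact_fourier_support \<phi>"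
  define \<phi>' where "\<phi>' = mod_dil (inverse q) 0 \<phi>"
  have \<phi>': "L1fun \<phi>'" unfolding \<phi>'_def using q by (intro L1fun_mod_dil \<phi>) auto
  have F: "fourier \<phi>' \<gamma> = fourier \<phi> (q *\<^sub>R \<gamma>)" for \<gamma>
    unfolding \<phi>'_def using q by (subst fourier_mod_dil[OF \<phi>(1)]) auto
  obtain N where N: "\<And>\<gamma> k. fourier \<phi> \<gamma> \<noteq> 0 \<Longrightarrow> \<bar>\<gamma> $ k\<bar> \<le> real N"
    using compact_fourier_supportE[OF \<phi>(2)] by blast
  have "compact_fourier_support \<phi>'"
  proof (rule compact_fourier_supportI[where C = "real N / q"])
    fix \<gamma> k assume "fourier \<phi>' \<gamma> \<noteq> 0"
    from N[OF this[unfolded F], of k] show "\<bar>\<gamma> $ k\<bar> \<le> real N / q"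
      using q by (simp add: abs_mult field_simps)
  qed
  with h \<phi>' obtain \<psi>' where \<psi>': "L1fun \<psi>'" "fourier \<psi>' = (\<lambda>\<gamma>. h \<gamma> * fourier \<phi>' \<gamma>)"
    unfolding fc_admissible_def by blast
  have "fourier (mod_dil q 0 \<psi>') \<gamma> = h (\<gamma> /\<^sub>R q) * fourier \<phi> \<gamma>" for \<gamma>
    using q by (subst fourier_mod_dil[OF \<psi>'(1) q]) (simp add: \<psi>'(2) F)
  then show "\<exists>\<psi>. L1fun \<psi> \<and> fourier \<psi> = (\<lambda>\<gamma>. h (\<gamma> /\<^sub>R q) * fourier \<phi> \<gamma>)"
    by (intro exI[of _ "mod_dil q 0 \<psi>'"]) (auto simp: L1fun_mod_dil[OF \<psi>'(1) q])
qed

lemma compact_fourier_support_box_kernel: "compact_fourier_support (box_kernel N)"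
proof (rule compact_fourier_supportI[where C = "real N + 1"])
  fix \<gamma> :: "real^'a" and k assume "fourier (box_kernel N) \<gamma> \<noteq> 0"
  then show "\<bar>\<gamma> $ k\<bar> \<le> real N + 1"
    using fourier_box_kernel_eq_0[of N \<gamma> k] by linarith
qed

context l1_module
begin

lemma closed_beurling_spectrum: "closed (beurling_spectrum act x)"
proof -
  have "beurling_spectrum act x = (\<Inter>f\<in>{f. L1fun f \<and> act f x = 0}. {\<gamma>. fourier f \<gamma> = 0})"
    by (auto simp: beurling_spectrum_def)
  also have "closed \<dots>"
    by (intro closed_INT ballI closed_Collect_eq) (auto intro: continuous_on_fourier)
  finally show ?thesis .
qed

lemma beurling_spectrum_box:
  assumes x: "x \<in> M" and \<gamma>: "\<gamma> \<in> beurling_spectrum act (act (box_kernel N) x)"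
  shows "\<bar>\<gamma> $ k\<bar> \<le> real N + 1"
proof (rule ccontr)
  assume k: "\<not> ?thesis"
  \<comment> \<open>The tent bump of half-width \<delta> about \<gamma> stays off the frequency
    support of the box kernel, so it annihilates the element, yet its transform at \<gamma> is
    1.\<close>
  define \<delta> where "\<delta> = \<bar>\<gamma> $ k\<bar> - (real N + 1)"
  have \<delta>: "\<delta> > 0" using k by (simp add: \<delta>_def)
  define f where "f = mod_dil \<delta> \<gamma> fejer_vec"
  have f: "L1fun f" unfolding f_def by (intro L1fun_mod_dil L1fun_fejer_vec \<delta>)
  have F: "fourier f \<mu> = (\<Prod>k\<in>UNIV. complex_of_real (tent ((\<mu> $ k - \<gamma> $ k) / \<delta>)))" for \<mu>
    unfolding f_def by (subst fourier_mod_dil[OF L1fun_fejer_vec \<delta>]) (simp add: fourier_fejer_vec divide_inverse mult.commute)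
  have "act f (act (box_kernel N) x) = 0"
  proof (rule act_orthogonal[OF f L1fun_box_kernel x])
    fix \<mu>
    show "fourier f \<mu> * fourier (box_kernel N) \<mu> = 0"
    proof (cases "fourier f \<mu> = 0")
      case False
      then have "tent ((\<mu> $ k - \<gamma> $ k) / \<delta>) \<noteq> 0" by (simp add: F)
      then have "\<bar>\<mu> $ k - \<gamma> $ k\<bar> < \<delta>" using \<delta> by (simp add: tent_eq_0_iff abs_divide)
      then have "\<bar>\<mu> $ k\<bar> \<ge> real N + 1" by (simp add: \<delta>_def)
      then show ?thesis by (simp add: fourier_box_kernel_eq_0)
    qed simp
  qed
  with \<gamma> f have "fourier f \<gamma> = 0" by (auto simp: beurling_spectrum_def)
  then show False by (simp add: F tent_def)
qed

lemma box_kernel_in_fc_graph: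
  assumes x: "x \<in> M" and \<psi>: "L1fun \<psi>" "fourier \<psi> = (\<lambda>\<gamma>. h \<gamma> * fourier (box_kernel (N + 2)) \<gamma>)"
  shows "(act (box_kernel N) x, act \<psi> (act (box_kernel N) x)) \<in> fc_graph M act h"
proof -
  let ?z = "act (box_kernel N) x"
  \<comment> \<open>The spectrum lies in the closed cube of half-width N + 1; the cutoff must be 1
    on an open set around it, so the next larger box kernel, of index N + 2, is taken.\<close>
  define U where "U = {\<gamma>::real^'n. \<forall>k. \<bar>\<gamma> $ k\<bar> < real N + 2}"
  have "U = (\<Inter>k. {\<gamma>. \<bar>\<gamma> $ k\<bar> < real N + 2})" by (auto simp: U_def)
  also have "open \<dots>" by (intro open_INT ballI finite open_Collect_less continuous_intros)
  finally have "open U" .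
  moreover have "beurling_spectrum act ?z \<subseteq> U"
  proof
    fix \<gamma> assume "\<gamma> \<in> beurling_spectrum act ?z"
    from beurling_spectrum_box[OF x this] have "\<bar>\<gamma> $ k\<bar> < real N + 2" for k
      by (rule le_less_trans) simp
    then show "\<gamma> \<in> U" by (simp add: U_def)
  qed
  moreover have "\<forall>\<gamma>\<in>U. fourier (box_kernel (N + 2)) \<gamma> = 1"
    by (auto simp: U_def add.commute intro!: fourier_box_kernel_eq_1 less_imp_le)
  moreover have "compact (beurling_spectrum act ?z)"
    unfolding compact_eq_bounded_closed
    by (intro conjI closed_beurling_spectrum bounded_vec_componentwise[where C = "real N + 1"] beurling_spectrum_box[OF x])
  ultimately show ?thesis
    unfolding fc_graph_def
    using \<psi> x L1fun_box_kernel compact_fourier_support_box_kernel[of "N + 2"] act_in[OF L1fun_box_kernel x]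
    by blast
qed

text \<open>Only the agreement of v with the p-th power of D on the frequency support of u counts.
  The bound is thus in terms of L1norm D and not of the norm of v, which may be far larger.\<close>

lemma act_dilated_power:
  assumes D: "L1fun D" and u: "L1fun u" and x: "x \<in> M"
    and v: "L1fun v" "\<And>\<gamma>. fourier u \<gamma> \<noteq> 0 \<Longrightarrow> fourier v \<gamma> = fourier D \<gamma> ^ p"
  shows "norm (act v (act u x)) \<le> L1norm D ^ p * norm (act u x)"
proof -
  have act_in': "(act D ^^ j) (act u x) \<in> M" for j
    by (induction j) (auto intro: act_in D u x)
  have le: "norm ((act D ^^ j) (act u x)) \<le> L1norm D ^ j * norm (act u x)" for j
  proof (induction j)
    case (Suc j)
    have "norm ((act D ^^ Suc j) (act u x)) \<le> L1norm D * norm ((act D ^^ j) (act u x))"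
      using act_norm[OF D act_in'[of j]] by simp
    also have "\<dots> \<le> L1norm D * (L1norm D ^ j * norm (act u x))"
      by (intro mult_left_mono Suc L1norm_nonneg)
    finally show ?case by (simp add: mult.assoc)
  qed simp
  have "\<exists>f. L1fun f \<and> (act D ^^ j) (act u x) = act f x \<and> (\<forall>\<gamma>. fourier f \<gamma> = fourier D \<gamma> ^ j * fourier u \<gamma>)" for j
  proof (induction j)
    case 0
    then show ?case using u by auto
  next
    case (Suc j)
    then obtain f where f: "L1fun f" "(act D ^^ j) (act u x) = act f x" "\<forall>\<gamma>. fourier f \<gamma> = fourier D \<gamma> ^ j * fourier u \<gamma>"
      by auto
    then show ?case
      by (intro exI[of _ "conv D f"]) (simp add: L1fun_conv D act_conv x fourier_conv mult.assoc)
  qed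
  then obtain f where f: "L1fun f" "(act D ^^ p) (act u x) = act f x" "\<And>\<gamma>. fourier f \<gamma> = fourier D \<gamma> ^ p * fourier u \<gamma>"
    by meson
  have "act v (act u x) = act f x"
  proof (rule act_mult[OF v(1) u f(1) x])
    fix \<gamma> show "fourier v \<gamma> * fourier u \<gamma> = fourier f \<gamma>"
      using v(2)[of \<gamma>] by (cases "fourier u \<gamma> = 0") (auto simp: f(3))
  qed
  with le[of p] f(2) show ?thesis by simp
qed

text \<open>The box kernels are unbounded in norm, so convergence is taken as a hypothesis and later
  comes from the decay of the cube components. The limit is identified by testing with f of compact
  frequency support, on which large box kernels are invisible.\<close>

lemma act_box_kernel_limit:
  assumes x: "x \<in> M" and lim: "(\<lambda>N. act (box_kernel N) x) \<longlonglongrightarrow> z"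
  shows "z = x"
proof -
  have zN: "act (box_kernel N) x \<in> M" for N by (intro act_in L1fun_box_kernel x)
  have z: "z \<in> M" by (rule closed_sequentially[OF M_closed _ lim]) (rule zN)
  have "z - x = 0"
  proof (rule separation)
    show "z - x \<in> M" by (intro M_diff z x)
    fix f :: "real^'n \<Rightarrow> complex" assume f: "L1fun f" "compact_fourier_support f"
    obtain N0 where N0: "\<And>\<gamma> k. fourier f \<gamma> \<noteq> 0 \<Longrightarrow> \<bar>\<gamma> $ k\<bar> \<le> real N0"
      using compact_fourier_supportE[OF f(2)] by blast
    have "act f (act (box_kernel N) x) = act f x" if "N \<ge> N0" for N
    proof (rule act_mult[OF f(1) L1fun_box_kernel f(1) x])
      fix \<gamma> show "fourier f \<gamma> * fourier (box_kernel N) \<gamma> = fourier f \<gamma>"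
      proof (cases "fourier f \<gamma> = 0")
        case False
        have "\<bar>\<gamma> $ k\<bar> \<le> real N" for k using N0[OF False, of k] that by linarith
        then show ?thesis by (simp add: fourier_box_kernel_eq_1)
      qed simp
    qed
    then have "(\<lambda>N. act f (act (box_kernel N) x)) \<longlonglongrightarrow> act f x"
      by (intro tendsto_eventually) (auto simp: eventually_sequentially)
    moreover have "(\<lambda>N. act f (act (box_kernel N) x)) \<longlonglongrightarrow> act f z"
      by (intro act_tendsto f(1) lim zN z)
    ultimately have "act f z = act f x" by (metis LIMSEQ_unique)
    then show "act f (z - x) = 0" by (simp add: act_diff f(1) z x)
  qed
  then show ?thesis by simp
qed

text \<open>The value of the functional calculus at x is assembled as a lattice sum over the cube
  components. Box truncations of x paired with partial lattice sums lie in the graph, and both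
  converge, which is exactly what the closure asks for.\<close>

lemma fc_domain_of_decay:
  fixes \<alpha> :: "real^'n"
  assumes \<alpha>: "\<And>k. \<alpha> $ k > 0" and adm: "fc_admissible (h_alpha \<alpha>)" and x: "x \<in> M"
    and C: "C \<ge> 0" and \<theta>: "0 < \<theta>" "\<theta> < 1"
    and decay: "\<And>m k. norm (act (cube_kernel m) x) \<le> C * \<theta> ^ nat \<bar>m k\<bar>"
  shows "\<exists>\<beta>::real^'n. (\<forall>k. \<beta> $ k > 0) \<and> x \<in> fc_domain M act (h_alpha \<beta>)"
proof -
  obtain \<psi>0 where \<psi>0: "L1fun \<psi>0" "fourier \<psi>0 = (\<lambda>\<gamma>. h_alpha \<alpha> \<gamma> * fourier (box_kernel 1) \<gamma>)"
    using adm L1fun_box_kernel compact_fourier_support_box_kernel unfolding fc_admissible_def by blast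
  \<comment> \<open>Half of the decay pays for the weight: a growth by s per unit of distance still
    leaves the ratio s \<theta> = sqrt \<theta> < 1.\<close>
  define s where "s = 1 / sqrt \<theta>"
  have s: "s > 1" and s\<theta>: "s * \<theta> = sqrt \<theta>"
    using \<theta> by (simp_all add: s_def real_div_sqrt)
  have r: "0 < sqrt \<theta>" "sqrt \<theta> < 1" using \<theta> by auto
  \<comment> \<open>One application of \<psi>0 serves q units of distance, so q is taken large
    enough for its norm to be at most s^q. The successor below secures q > 0.\<close>
  obtain q0 where q0: "L1norm \<psi>0 < s ^ q0" using real_arch_pow[OF s] by blast
  define q where "q = Suc q0"
  have q: "q > 0" by (simp add: q_def)
  have Q: "L1norm \<psi>0 \<le> s ^ q"
  proof -
    have "s ^ q0 \<le> s ^ q" using s by (intro power_increasing) (auto simp: q_def)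
    with q0 show ?thesis by simp
  qed
  define \<beta> where "\<beta> = \<alpha> /\<^sub>R real q"
  have \<beta>: "\<beta> $ k > 0" for k using \<alpha> q by (simp add: \<beta>_def)
  have h\<beta>: "h_alpha \<beta> = (\<lambda>\<gamma>. h_alpha \<alpha> (\<gamma> /\<^sub>R real q))"
    using q by (simp add: \<beta>_def h_alpha_dilate fun_eq_iff)
  have adm\<beta>: "fc_admissible (h_alpha \<beta>)"
    unfolding h\<beta> using q by (intro fc_admissible_dilate adm) simp
  then have "\<exists>\<psi>. L1fun \<psi> \<and> fourier \<psi> = (\<lambda>\<gamma>. h_alpha \<beta> \<gamma> * fourier (box_kernel (N + 2)) \<gamma>)" for N
    using L1fun_box_kernel compact_fourier_support_box_kernel unfolding fc_admissible_def by blast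
  then obtain \<psi> where \<psi>: "\<And>N. L1fun (\<psi> N)"
    "\<And>N. fourier (\<psi> N) = (\<lambda>\<gamma>. h_alpha \<beta> \<gamma> * fourier (box_kernel (N + 2)) \<gamma>)"
    by metis
  define nn :: "('n \<Rightarrow> int) \<Rightarrow> nat" where "nn = (\<lambda>m. nat (Max (range (\<lambda>k. \<bar>m k\<bar>))))"
  have nn_ge: "nat \<bar>m k\<bar> \<le> nn m" for m k
    unfolding nn_def by (intro nat_mono Max_ge) auto
  have nn_attained: "\<exists>k. nn m = nat \<bar>m k\<bar>" for m
  proof -
    have "Max (range (\<lambda>k. \<bar>m k\<bar>)) \<in> range (\<lambda>k. \<bar>m k\<bar>)" by (intro Max_in) auto
    then obtain k where "Max (range (\<lambda>k. \<bar>m k\<bar>)) = \<bar>m k\<bar>" by blast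
    then show ?thesis by (auto simp: nn_def)
  qed
  have nn_box: "m \<in> lattice_box N \<longleftrightarrow> nn m \<le> N" for m N
  proof
    assume "m \<in> lattice_box N"
    with nn_attained[of m] show "nn m \<le> N" by (auto simp: lattice_box_def nat_le_iff)
  next
    assume le: "nn m \<le> N"
    show "m \<in> lattice_box N"
      unfolding lattice_box_def
    proof (clarsimp)
      fix k show "\<bar>m k\<bar> \<le> int N" using nn_ge[of m k] le by linarith
    qed
  qed
  have supp: "\<bar>\<gamma> $ k\<bar> \<le> real (nn m) + 1" if "fourier (cube_kernel m) \<gamma> \<noteq> 0" for m \<gamma> k
  proof -
    have "\<bar>\<gamma> $ k - real_of_int (m k)\<bar> < 1" using that by (auto simp: fourier_cube_kernel_eq_0_iff not_le)
    moreover have "\<bar>real_of_int (m k)\<bar> \<le> real (nn m)"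
      using nn_ge[of m k] by linarith
    ultimately show ?thesis by linarith
  qed
  have \<psi>h: "fourier (\<psi> N) \<gamma> = h_alpha \<beta> \<gamma>" if "fourier (cube_kernel m) \<gamma> \<noteq> 0" "nn m \<le> N" for m N \<gamma>
  proof -
    have "\<bar>\<gamma> $ k\<bar> \<le> real (N + 2)" for k using supp[OF that(1), of k] that(2) by simp
    then show ?thesis by (simp add: \<psi>(2) fourier_box_kernel_eq_1)
  qed
  \<comment> \<open>The weighted component at m. The cutoff is immaterial once N \<ge> nn m: the
    cube lies in the box of half-width nn m + 1, where all these \<psi> N have the weight itself as
    transform.\<close>
  define Y where "Y = (\<lambda>m. act (\<psi> (nn m)) (act (cube_kernel m) x))"
  have Y: "act (\<psi> N) (act (cube_kernel m) x) = Y m" if "nn m \<le> N" for m N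
    unfolding Y_def act_conv[OF \<psi>(1) L1fun_cube_kernel x, symmetric]
  proof (rule act_cong[OF _ _ x])
    fix \<gamma>
    show "fourier (conv (\<psi> N) (cube_kernel m)) \<gamma> = fourier (conv (\<psi> (nn m)) (cube_kernel m)) \<gamma>"
      using \<psi>h[of m \<gamma> N] \<psi>h[of m \<gamma> "nn m"] that
      by (cases "fourier (cube_kernel m) \<gamma> = 0") (auto simp: fourier_conv \<psi>(1) L1fun_cube_kernel)
  qed (intro L1fun_conv \<psi>(1) L1fun_cube_kernel)+
  have Ybound: "norm (Y m) \<le> (C * s ^ (q + 1)) * sqrt \<theta> ^ nn m" for m
  proof -
    \<comment> \<open>On the cube at \<open>m\<close> the weight is the \<open>p\<close>-th power of a dilate of the fixed transform of \<open>\<psi>0\<close>.\<close>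
    define p where "p = nn m div q + 1"
    \<comment> \<open>The lower bound puts the cube, shrunk by p q, inside the unit box where the
      transform of \<psi>0 is the weight of \<alpha>. The upper bound turns the cost (s^q)^p into at
      most s^(nn m + q).\<close>
    have pq: "nn m + 1 \<le> p * q" "p * q \<le> nn m + q"
    proof -
      have "p * q = nn m div q * q + q" by (simp add: p_def)
      then show "nn m + 1 \<le> p * q" "p * q \<le> nn m + q"
        using div_mult_mod_eq[of "nn m" q] mod_less_divisor[OF q, of "nn m"] by linarith+
    qed
    have pos: "real (p * q) > 0" using pq(1) by linarith
    define D where "D = mod_dil (real (p * q)) 0 \<psi>0"
    have D: "L1fun D" unfolding D_def by (rule L1fun_mod_dil[OF \<psi>0(1) pos])
    have "norm (Y m) \<le> L1norm D ^ p * norm (act (cube_kernel m) x)"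
      unfolding Y_def
    proof (rule act_dilated_power[OF D L1fun_cube_kernel x \<psi>(1)])
      fix \<gamma> :: "real^'n" assume nz: "fourier (cube_kernel m) \<gamma> \<noteq> 0"
      have "\<bar>(\<gamma> /\<^sub>R real (p * q)) $ k\<bar> \<le> real 1" for k
      proof -
        have "\<bar>\<gamma> $ k\<bar> \<le> real (p * q)" using supp[OF nz, of k] pq(1) by linarith
        then show ?thesis using pos by (simp add: abs_mult field_simps)
      qed
      then have "fourier (box_kernel 1) (\<gamma> /\<^sub>R real (p * q)) = 1" by (rule fourier_box_kernel_eq_1)
      then have "fourier D \<gamma> = h_alpha (\<alpha> /\<^sub>R real (p * q)) \<gamma>"
        unfolding D_def fourier_mod_dil[OF \<psi>0(1) pos] \<psi>0(2)
        by (simp only: diff_zero mult_1_right h_alpha_dilate[OF pos])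
      then have "fourier D \<gamma> ^ p = h_alpha (real p *\<^sub>R (\<alpha> /\<^sub>R real (p * q))) \<gamma>"
        by (simp only: h_alpha_power)
      also have "real p *\<^sub>R (\<alpha> /\<^sub>R real (p * q)) = \<beta>"
      proof -
        have "p > 0" by (simp add: p_def)
        then show ?thesis by (simp add: \<beta>_def)
      qed
      finally show "fourier (\<psi> (nn m)) \<gamma> = fourier D \<gamma> ^ p" using \<psi>h[OF nz] by simp
    qed
    also have "L1norm D = L1norm \<psi>0" unfolding D_def by (rule L1norm_mod_dil[OF \<psi>0(1) pos])
    also have "L1norm \<psi>0 ^ p * norm (act (cube_kernel m) x) \<le> s ^ (nn m + q) * (C * \<theta> ^ nn m)"
    proof (intro mult_mono)
      have "L1norm \<psi>0 ^ p \<le> (s ^ q) ^ p" by (intro power_mono Q L1norm_nonneg)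
      also have "\<dots> = s ^ (p * q)" by (simp add: mult.commute flip: power_mult)
      also have "\<dots> \<le> s ^ (nn m + q)" using pq(2) s by (intro power_increasing) auto
      finally show "L1norm \<psi>0 ^ p \<le> s ^ (nn m + q)" .
      show "norm (act (cube_kernel m) x) \<le> C * \<theta> ^ nn m"
        using nn_attained[of m] decay[of m] by auto
    qed (use s in auto)
    also have "\<dots> = C * s ^ q * (s * \<theta>) ^ nn m"
      by (simp add: power_add power_mult_distrib)
    also have "\<dots> \<le> C * s ^ (q + 1) * sqrt \<theta> ^ nn m"
      unfolding s\<theta> using C s r by (intro mult_right_mono mult_left_mono power_increasing) auto
    finally show ?thesis .
  qed
  have "convergent (\<lambda>N. \<Sum>m\<in>lattice_box N. Y m)"
  proof (rule convergent_lattice_sums[OF _ r])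
    show "0 \<le> C * s ^ (q + 1)" using C s by simp
    fix m k
    have "sqrt \<theta> ^ nn m \<le> sqrt \<theta> ^ nat \<bar>m k\<bar>"
      using r nn_ge by (intro power_decreasing) auto
    with C s show "norm (Y m) \<le> C * s ^ (q + 1) * sqrt \<theta> ^ nat \<bar>m k\<bar>"
      by (intro order_trans[OF Ybound] mult_left_mono) auto
  qed
  then obtain w where w: "(\<lambda>N. \<Sum>m\<in>lattice_box N. Y m) \<longlonglongrightarrow> w" by (auto simp: convergent_def)
  have box: "act (box_kernel N) x = (\<Sum>m\<in>lattice_box N. act (cube_kernel m) x)" for N
    unfolding box_kernel_def by (intro act_fun_sum L1fun_cube_kernel x)
  have "convergent (\<lambda>N. act (box_kernel N) x)"
    unfolding box by (rule convergent_lattice_sums[OF C \<theta> decay])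
  then have z: "(\<lambda>N. act (box_kernel N) x) \<longlonglongrightarrow> x"
    using act_box_kernel_limit[OF x] by (auto simp: convergent_def)
  have "act (\<psi> N) (act (box_kernel N) x) = (\<Sum>m\<in>lattice_box N. Y m)" for N
    unfolding box
    by (subst act_sum) (auto simp: \<psi>(1) act_in L1fun_cube_kernel x nn_box Y intro!: sum.cong)
  then have g: "(act (box_kernel N) x, \<Sum>m\<in>lattice_box N. Y m) \<in> fc_graph M act (h_alpha \<beta>)" for N
    using box_kernel_in_fc_graph[OF x \<psi>(1,2), of N] by simp
  have "(x, w) \<in> closure (fc_graph M act (h_alpha \<beta>))"
    unfolding closure_sequential
    by (intro exI[of _ "\<lambda>N. (act (box_kernel N) x, \<Sum>m\<in>lattice_box N. Y m)"] conjI allI g tendsto_Pair[OF z w])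
  then have "x \<in> fc_domain M act (h_alpha \<beta>)" by (auto simp: fc_domain_def adm\<beta>)
  with \<beta> show ?thesis by blast
qed

end

section \<open>Transfer of continuity and decay from A to its inverse\<close>

theorem mainTheorem10:
  fixes Txy :: "real^'n \<Rightarrow> ('x::{complex_normed_vector,banach} \<Rightarrow>\<^sub>L 'y::{complex_normed_vector,banach})
                  \<Rightarrow> ('x \<Rightarrow>\<^sub>L 'y)"
    and axy :: "(real^'n \<Rightarrow> complex) \<Rightarrow> ('x \<Rightarrow>\<^sub>L 'y) \<Rightarrow> ('x \<Rightarrow>\<^sub>L 'y)"
    and Tyx :: "real^'n \<Rightarrow> ('y \<Rightarrow>\<^sub>L 'x) \<Rightarrow> ('y \<Rightarrow>\<^sub>L 'x)"
    and ayx :: "(real^'n \<Rightarrow> complex) \<Rightarrow> ('y \<Rightarrow>\<^sub>L 'x) \<Rightarrow> ('y \<Rightarrow>\<^sub>L 'x)"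
    and Txx :: "real^'n \<Rightarrow> ('x \<Rightarrow>\<^sub>L 'x) \<Rightarrow> ('x \<Rightarrow>\<^sub>L 'x)"
    and axx :: "(real^'n \<Rightarrow> complex) \<Rightarrow> ('x \<Rightarrow>\<^sub>L 'x) \<Rightarrow> ('x \<Rightarrow>\<^sub>L 'x)"
    and Tyy :: "real^'n \<Rightarrow> ('y \<Rightarrow>\<^sub>L 'y) \<Rightarrow> ('y \<Rightarrow>\<^sub>L 'y)"
    and ayy :: "(real^'n \<Rightarrow> complex) \<Rightarrow> ('y \<Rightarrow>\<^sub>L 'y) \<Rightarrow> ('y \<Rightarrow>\<^sub>L 'y)"
    and \<alpha> :: "real^'n"
    and A :: "'x \<Rightarrow>\<^sub>L 'y"
    and B :: "'y \<Rightarrow>\<^sub>L 'x"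
  assumes setting: "operator_setting Txy axy Tyx ayx Txx axx Tyy ayy"
    and alpha_pos: "\<forall>k. \<alpha> $ k > 0"
    and A_op: "A \<in> clin_ops"
    and A_cont: "T_continuous Txy A"
    and A_dom: "A \<in> fc_domain clin_ops axy (h_alpha \<alpha>)"
    and B_op: "B \<in> clin_ops"
    and AB_inv: "mutually_inverse A B"
  shows "\<exists>\<beta>::real^'n. (\<forall>k. \<beta> $ k > 0) \<and> T_continuous Tyx B \<and>
           B \<in> fc_domain clin_ops ayx (h_alpha \<beta>)"
proof -
  have "L1_module clin_ops Txy axy" and "L1_module clin_ops Tyx ayx"
    and coupled: "\<forall>A\<in>clin_ops. \<forall>B\<in>clin_ops. mutually_inverse A B \<longleftrightarrow> (\<forall>t. mutually_inverse (Txy t A) (Tyx t B))"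
    using setting unfolding operator_setting_def by - (elim conjE; assumption)+
  then interpret XY: l1_module clin_ops Txy axy + YX: l1_module clin_ops Tyx ayx
    by unfold_locales
  have \<alpha>: "\<alpha> $ k > 0" for k using alpha_pos by simp
  have inv: "Txy t A o\<^sub>L Tyx t B = id_blinfun" "Tyx t B o\<^sub>L Txy t A = id_blinfun" for t
    using coupled A_op B_op AB_inv by (auto simp: mutually_inverse_def)
  have id: "id_blinfun o\<^sub>L C = C" "C o\<^sub>L id_blinfun = C" for C :: "'y \<Rightarrow>\<^sub>L 'x"
    by (auto intro: blinfun_eqI)

  have "T_continuous Tyx B"
    unfolding T_continuous_def continuous_on_def
  proof safe
    fix s :: "real^'n"
    \<comment> \<open>The resolvent-type identity for inverses; as the representation is isometric,
      both outer factors have norm \<open>norm B\<close> for all t.\<close>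
    have eq: "Tyx t B - Tyx s B = Tyx t B o\<^sub>L ((Txy s A - Txy t A) o\<^sub>L Tyx s B)" for t
    proof -
      have "Tyx t B o\<^sub>L ((Txy s A - Txy t A) o\<^sub>L Tyx s B)
          = (Tyx t B o\<^sub>L (Txy s A o\<^sub>L Tyx s B)) - ((Tyx t B o\<^sub>L Txy t A) o\<^sub>L Tyx s B)"
        by (rule blinfun_eqI) (simp add: blinfun.diff_left blinfun.diff_right)
      then show ?thesis by (simp add: inv id)
    qed
    have "norm (Tyx t B - Tyx s B) \<le> norm B * (norm (Txy t A - Txy s A) * norm B)" for t
    proof -
      have "norm (Tyx t B - Tyx s B) \<le> norm (Tyx t B) * (norm (Txy s A - Txy t A) * norm (Tyx s B))"
        unfolding eq by (intro order_trans[OF norm_blinfun_compose] mult_left_mono norm_blinfun_compose norm_ge_zero)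
      then show ?thesis by (simp add: YX.T_norm B_op norm_minus_commute)
    qed
    moreover have "((\<lambda>t. norm B * (norm (Txy t A - Txy s A) * norm B)) \<longlongrightarrow> 0) (at s within UNIV)"
    proof -
      have "((\<lambda>t. Txy t A) \<longlongrightarrow> Txy s A) (at s within UNIV)"
        using A_cont by (simp add: T_continuous_def continuous_on_def)
      then have "((\<lambda>t. norm B * (norm (Txy t A - Txy s A) * norm B)) \<longlongrightarrow> norm B * (norm (Txy s A - Txy s A) * norm B)) (at s within UNIV)"
        by (intro tendsto_intros)
      then show ?thesis by simp
    qed
    ultimately have "((\<lambda>t. Tyx t B - Tyx s B) \<longlongrightarrow> 0) (at s within UNIV)"
      by (rule Lim_null_comparison[OF always_eventually[OF allI]])
    then show "((\<lambda>t. Tyx t B) \<longlongrightarrow> Tyx s B) (at s within UNIV)" by (simp add: LIM_zero_iff)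
  qed

  moreover have "\<exists>\<beta>::real^'n. (\<forall>k. \<beta> $ k > 0) \<and> B \<in> fc_domain clin_ops ayx (h_alpha \<beta>)"
  proof -
    obtain y where y: "y \<in> clin_ops" "A = axy (poisson_vec \<alpha>) y"
      using XY.fc_domain_poisson[OF \<alpha> A_dom] by blast
    \<comment> \<open>The smallest coordinate makes one constant serve all directions k.\<close>
    define a where "a = Min (range (($) \<alpha>))"
    have a: "a > 0" "a \<le> \<alpha> $ k" for k
      using \<alpha> by (auto simp: a_def)
    \<comment> \<open>The base \<open>r * (1 + b * Y)\<close> of \<open>inverse_fdiff_bound\<close>
      with r = |h| / a, b = norm B and Y = norm y, divided by |h|.\<close>
    define c where "c = (1 + norm B * norm y) / a"
    have c: "c > 0" unfolding c_def using a(1) by (intro divide_pos_pos add_pos_nonneg) auto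
    have "norm ((fdiff ^^ n) (\<lambda>j. Tyx (real j *\<^sub>R axis k h) B) 0) \<le> norm B * fact n * (\<bar>h\<bar> * c) ^ n" for k h n
    proof -
      have "norm ((fdiff ^^ n) (\<lambda>j. Txy (real j *\<^sub>R axis k h) A) j) \<le> norm y * fact n * (\<bar>h\<bar> / a) ^ n" for n j
      proof -
        have "norm ((fdiff ^^ n) (\<lambda>j. Txy (real j *\<^sub>R axis k h) A) j) \<le> norm y * fact n * (\<bar>h\<bar> / \<alpha> $ k) ^ n"
          unfolding y(2) by (rule XY.fdiff_orbit_poisson[OF \<alpha> y(1)])
        also have "\<dots> \<le> norm y * fact n * (\<bar>h\<bar> / a) ^ n"
          using a \<alpha> less_imp_le[OF \<alpha>[of k]] by (intro mult_left_mono power_mono divide_left_mono) auto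
        finally show ?thesis .
      qed
      then have "norm ((fdiff ^^ n) (\<lambda>j. Tyx (real j *\<^sub>R axis k h) B) 0)
          \<le> norm B * fact n * (\<bar>h\<bar> / a * (1 + norm B * norm y)) ^ n"
        using a(1) by (intro inverse_fdiff_bound[where A = "\<lambda>j. Txy (real j *\<^sub>R axis k h) A"] inv)
          (auto simp: YX.T_norm B_op)
      then show ?thesis by (simp add: c_def)
    qed
    from YX.act_cube_exp_decay[OF B_op c this]
    obtain C \<theta> where "C \<ge> 0" "0 < \<theta>" "\<theta> < 1"
      "\<And>m k. norm (ayx (cube_kernel m) B) \<le> C * \<theta> ^ nat \<bar>m k\<bar>" by blast
    \<comment> \<open>A non-admissible function has empty domain by definition, so membership of A
      carries the admissibility.\<close>
    moreover have "fc_admissible (h_alpha \<alpha>)" using A_dom by (auto simp: fc_domain_def split: if_splits)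
    ultimately show ?thesis using YX.fc_domain_of_decay[OF \<alpha> _ B_op] by blast
  qed
  ultimately show ?thesis by blast
qed

end
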